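(* Let $\Gamma$ be a labelled graph representing a Coxeter matrix over a finite set, and suppose that the Artin group $A_\Gamma$ is even and of FC type. Then $A_\Gamma$ is poly-free.
   Context: Let $S$ be a finite set. A Coxeter matrix over $S$ is a matrix $M=(m_{s,t})_{s,t\in S}$ with coefficients in $\mathbb N\cup\{\infty\}$ such that $m_{s,s}=1$ for all $s$, and $m_{s,t}=m_{t,s}\ge 2$ for $s\ne t$. It is represented by a labelled graph $\Gamma$ with vertex set $V(\Gamma)=S$, where distinct $s,t$ are joined by an edge labelled $m_{s,t}$ exactly when $m_{s,t}\neq\infty$. For $m\ge 2$ let $\Pi(a,b:m)$ be the alternating word $aba\cdots$ of length $m$. The Artin group is $A_\Gamma=\langle S\mid \Pi(s,t:m_{s,t})=\Pi(t,s:m_{s,t})$ for all $s\neq t$ with $m_{s,t}\ne\infty\rangle$, and the Coxeter group $W_\Gamma$ is the quotient of $A_\Gamma$ by the relations $s^2=1$, $s\in S$. For $T\subset S$, $\Gamma_T$ is the full labelled subgraph spanned by $T$, and $A_T$ is the subgroup of $A_\Gamma$ generated by $T$ (it is the Artin group of $\Gamma_T$ by van der Lek). $A_\Gamma$ is of spherical type if $W_\Gamma$ is finite. $A_\Gamma$ is of FC type if $A_T$ is of spherical type (i.e. $W_{\Gamma_T}$ is finite) for every $T\subset S$ such that $m_{s,t}\neq\infty$ for all $s,t\in T$. $A_\Gamma$ is even if $m_{s,t}$ is even for all distinct $s,t\in S$ ($\infty$ counts as even). A group $G$ is poly-free if there is a finite tower of subgroups $1=G_0\unlhd G_1\unlhd\cdots\unlhd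 G_N=G$ (each normal in the next) such that each quotient $G_{i+1}/G_i$ is a free group (of arbitrary, possibly infinite, rank). *)

theory Defs
  imports "HOL-Algebra.Coset" "HOL-Library.Extended_Nat"
begin

section \<open>Group presentations\<close>

text \<open>
  A letter \<open>(x, True)\<close> stands for the generator \<open>x\<close> and \<open>(x, False)\<close> for its formal inverse.
  A relation \<open>u = v\<close> is the pair \<open>(u, v)\<close> of words; pairs that are not words over \<open>X\<close> are ignored.
\<close>

type_synonym 'a word = "('a \<times> bool) list"

abbreviation words :: "'a set \<Rightarrow> 'a word set" where
  "words X \<equiv> lists (X \<times> UNIV)"

inductive_set pres_rel :: "'a set \<Rightarrow> ('a word \<times> 'a word) set \<Rightarrow> ('a word \<times> 'a word) set"
  for X :: "'a set" and R :: "('a word \<times> 'a word) set" where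
  refl: "u \<in> words X \<Longrightarrow> (u, u) \<in> pres_rel X R"
| sym: "(u, v) \<in> pres_rel X R \<Longrightarrow> (v, u) \<in> pres_rel X R"
| trans: "(u, v) \<in> pres_rel X R \<Longrightarrow> (v, w) \<in> pres_rel X R \<Longrightarrow> (u, w) \<in> pres_rel X R"
| cancel: "u \<in> words X \<Longrightarrow> v \<in> words X \<Longrightarrow> x \<in> X \<Longrightarrow>
    (u @ [(x, b), (x, \<not> b)] @ v, u @ v) \<in> pres_rel X R"
| relator: "(r, s) \<in> R \<Longrightarrow> r \<in> words X \<Longrightarrow> s \<in> words X \<Longrightarrow> u \<in> words X \<Longrightarrow> v \<in> words X \<Longrightarrow>
    (u @ r @ v, u @ s @ v) \<in> pres_rel X R"

text \<open>The group \<open>\<langle>X | R\<rangle>\<close>; its elements are classes of words.\<close>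

definition presented_group :: "'a set \<Rightarrow> ('a word \<times> 'a word) set \<Rightarrow> 'a word set monoid" where
  "presented_group X R =
    \<lparr>carrier = words X // pres_rel X R,
     monoid.mult = (\<lambda>A B. \<Union>a\<in>A. \<Union>b\<in>B. pres_rel X R `` {a @ b}),
     one = pres_rel X R `` {[]}\<rparr>"

definition pres_gen :: "'a set \<Rightarrow> ('a word \<times> 'a word) set \<Rightarrow> 'a \<Rightarrow> 'a word set" where
  "pres_gen X R x = pres_rel X R `` {[(x, True)]}"

lemma pres_rel_words:
  assumes "(u, v) \<in> pres_rel X R"
  shows "u \<in> words X \<and> v \<in> words X"
  using assms by (induction rule: pres_rel.induct) auto

lemma equiv_pres_rel: "equiv (words X) (pres_rel X R)"
proof (rule equivI)
  show "pres_rel X R \<subseteq> words X \<times> words X"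
    using pres_rel_words by fast
  show "refl_on (words X) (pres_rel X R)"
    by (rule refl_onI) (rule pres_rel.refl)
  show "Relation.sym (pres_rel X R)"
    by (rule symI) (rule pres_rel.sym)
  show "Relation.trans (pres_rel X R)"
    by (rule transI) (rule pres_rel.trans)
qed

lemma pres_rel_append_left:
  assumes "(u, v) \<in> pres_rel X R" "w \<in> words X"
  shows "(w @ u, w @ v) \<in> pres_rel X R"
  using assms
proof (induction rule: pres_rel.induct)
  case (cancel u v x b)
  then show ?case using pres_rel.cancel[of "w @ u" X v x b R] by simp
next
  case (relator r s u v)
  then show ?case using pres_rel.relator[of r s R X "w @ u" v] by simp
next
  case (refl u)
  then show ?case by (intro pres_rel.refl) simp
qed (blast intro: pres_rel.intros)+

lemma pres_rel_append_right:
  assumes "(u, v) \<in> pres_rel X R" "w \<in> words X"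
  shows "(u @ w, v @ w) \<in> pres_rel X R"
  using assms
proof (induction rule: pres_rel.induct)
  case (cancel u v x b)
  then show ?case using pres_rel.cancel[of u X "v @ w" x b R] by simp
next
  case (relator r s u v)
  then show ?case using pres_rel.relator[of r s R X u "v @ w"] by simp
next
  case (refl u)
  then show ?case by (intro pres_rel.refl) simp
qed (blast intro: pres_rel.intros)+

lemma pres_rel_append:
  assumes "(u, u') \<in> pres_rel X R" "(v, v') \<in> pres_rel X R"
  shows "(u @ v, u' @ v') \<in> pres_rel X R"
  by (meson assms pres_rel.trans pres_rel_append_left pres_rel_append_right pres_rel_words)

lemma pres_mult_class:
  assumes "u \<in> words X" "v \<in> words X"
  shows "pres_rel X R `` {u} \<otimes>\<^bsub>presented_group X R\<^esub> pres_rel X R `` {v} =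
    pres_rel X R `` {u @ v}"
proof -
  let ?c = "\<lambda>w. pres_rel X R `` {w}"
  have "?c (a @ b) = ?c (u @ v)" if "a \<in> ?c u" "b \<in> ?c v" for a b
    using equiv_class_eq[OF equiv_pres_rel pres_rel_append, of u a X R v b] that by simp
  moreover have "u \<in> ?c u" "v \<in> ?c v"
    using assms by (auto intro: pres_rel.refl simp del: in_lists_conv_set)
  ultimately have "(\<Union>a\<in>?c u. \<Union>b\<in>?c v. ?c (a @ b)) = ?c (u @ v)"
    by blast
  then show ?thesis by (simp add: presented_group_def)
qed

lemma pres_inverse_word:
  "u \<in> words X \<Longrightarrow> (rev (map (map_prod id Not) u) @ u, []) \<in> pres_rel X R"
proof (induction u)
  case Nil
  then show ?case by (auto intro: pres_rel.refl)
next
  case (Cons a u)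
  obtain x b where a: "a = (x, b)" by fastforce
  let ?v = "rev (map (map_prod id Not) u)"
  have u: "u \<in> words X" "x \<in> X" using Cons.prems a by auto
  then have "?v \<in> words X" by (auto simp: in_lists_conv_set)
  then have "(?v @ [(x, \<not> b), (x, \<not> \<not> b)] @ u, ?v @ u) \<in> pres_rel X R"
    using u by (intro pres_rel.cancel)
  from pres_rel.trans[OF this Cons.IH[OF u(1)]] show ?case by (simp add: a id_def)
qed

lemma group_presented_group: "group (presented_group X R)"
proof (rule groupI)
  let ?G = "presented_group X R"
  let ?c = "\<lambda>w. pres_rel X R `` {w}"
  have carrierE: "\<exists>u\<in>words X. A = ?c u" if "A \<in> carrier ?G" for A
    using that by (auto simp: presented_group_def quotient_def)
  have carrierI: "?c u \<in> carrier ?G" if "u \<in> words X" for u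
    using that by (auto simp: presented_group_def intro: quotientI)
  have one: "\<one>\<^bsub>?G\<^esub> = ?c []" by (simp add: presented_group_def)
  show "\<one>\<^bsub>?G\<^esub> \<in> carrier ?G" unfolding one by (rule carrierI) simp
  fix A assume "A \<in> carrier ?G"
  then obtain u where u: "u \<in> words X" "A = ?c u" using carrierE by blast
  show "\<one>\<^bsub>?G\<^esub> \<otimes>\<^bsub>?G\<^esub> A = A"
    using u pres_mult_class[of "[]" X u R] by (simp add: one)
  let ?v = "rev (map (map_prod id Not) u)"
  have v: "?v \<in> words X" using u by (auto simp: in_lists_conv_set)
  then have "?c ?v \<otimes>\<^bsub>?G\<^esub> A = ?c (?v @ u)" using u by (simp only: pres_mult_class)
  also have "\<dots> = ?c []"
    using pres_inverse_word[OF u(1)] by (rule equiv_class_eq[OF equiv_pres_rel])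
  finally show "\<exists>B\<in>carrier ?G. B \<otimes>\<^bsub>?G\<^esub> A = \<one>\<^bsub>?G\<^esub>"
    using carrierI[OF v] one by metis
  fix B assume "B \<in> carrier ?G"
  then obtain v where v: "v \<in> words X" "B = ?c v" using carrierE by blast
  have uv: "u @ v \<in> words X" using u v by simp
  show "A \<otimes>\<^bsub>?G\<^esub> B \<in> carrier ?G"
    using carrierI[OF uv] u v by (simp only: pres_mult_class)
  fix C assume "C \<in> carrier ?G"
  then obtain w where w: "w \<in> words X" "C = ?c w" using carrierE by blast
  have vw: "v @ w \<in> words X" using v w by simp
  show "A \<otimes>\<^bsub>?G\<^esub> B \<otimes>\<^bsub>?G\<^esub> C = A \<otimes>\<^bsub>?G\<^esub> (B \<otimes>\<^bsub>?G\<^esub> C)"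
    using u v w uv vw by (simp only: pres_mult_class append_assoc)
qed

section \<open>Free groups and poly-free groups\<close>

text \<open>
  A free basis of \<open>G\<close> is in particular a set of elements of \<open>G\<close>, so it suffices to let the
  generating set \<open>X\<close> range over subsets of \<open>carrier G\<close>; there is no restriction on its cardinality.
\<close>

definition is_free_group :: "('g, 'r) monoid_scheme \<Rightarrow> bool" where
  "is_free_group G \<longleftrightarrow> group G \<and> (\<exists>X\<subseteq>carrier G. presented_group X {} \<cong> G)"

definition poly_free :: "('g, 'r) monoid_scheme \<Rightarrow> bool" where
  "poly_free G \<longleftrightarrow> group G \<and>
    (\<exists>(N::nat) H. H 0 = {\<one>\<^bsub>G\<^esub>} \<and> H N = carrier G \<and>
      (\<forall>i\<le>N. subgroup (H i) G) \<and>
      (\<forall>i<N. H i \<lhd> (G\<lparr>carrier := H (Suc i)\<rparr>) \<and>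
        is_free_group ((G\<lparr>carrier := H (Suc i)\<rparr>) Mod (H i))))"

section \<open>Coxeter matrices, Artin groups and Coxeter groups\<close>

text \<open>
  The labelled graph with vertex set \<open>S\<close> and the Coxeter matrix \<open>m\<close> determine each other: distinct
  \<open>s\<close>, \<open>t\<close> are joined by an edge, labelled \<open>m s t\<close>, iff \<open>m s t \<noteq> \<infinity>\<close>. A labelled graph is therefore
  given as the pair of \<open>S\<close> and \<open>m\<close>. Values of \<open>m\<close> outside \<open>S\<close> are irrelevant, so
  the full labelled subgraph spanned by \<open>T \<subseteq> S\<close> is the pair of \<open>T\<close> and \<open>m\<close>.
\<close>

definition coxeter_matrix :: "'a set \<Rightarrow> ('a \<Rightarrow> 'a \<Rightarrow> enat) \<Rightarrow> bool" where
  "coxeter_matrix S m \<longleftrightarrow>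
    (\<forall>s\<in>S. m s s = 1) \<and> (\<forall>s\<in>S. \<forall>t\<in>S. s \<noteq> t \<longrightarrow> m s t = m t s \<and> m s t \<ge> 2)"

fun alt_word :: "'a \<Rightarrow> 'a \<Rightarrow> nat \<Rightarrow> 'a word" where
  "alt_word a b 0 = []"
| "alt_word a b (Suc n) = (a, True) # alt_word b a n"

definition artin_relations :: "'a set \<Rightarrow> ('a \<Rightarrow> 'a \<Rightarrow> enat) \<Rightarrow> ('a word \<times> 'a word) set" where
  "artin_relations S m =
    {(alt_word s t n, alt_word t s n) | s t n. s \<in> S \<and> t \<in> S \<and> s \<noteq> t \<and> m s t = enat n}"

definition artin_group :: "'a set \<Rightarrow> ('a \<Rightarrow> 'a \<Rightarrow> enat) \<Rightarrow> 'a word set monoid" where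
  "artin_group S m = presented_group S (artin_relations S m)"

definition artin_gen :: "'a set \<Rightarrow> ('a \<Rightarrow> 'a \<Rightarrow> enat) \<Rightarrow> 'a \<Rightarrow> 'a word set" where
  "artin_gen S m = pres_gen S (artin_relations S m)"

definition normal_closure :: "('g, 'r) monoid_scheme \<Rightarrow> 'g set \<Rightarrow> 'g set" where
  "normal_closure G A = \<Inter>{N. N \<lhd> G \<and> A \<subseteq> N}"

lemma (in group) normal_normal_closure:
  assumes "A \<subseteq> carrier G"
  shows "normal_closure G A \<lhd> G"
proof -
  let ?F = "{N. N \<lhd> G \<and> A \<subseteq> N}"
  have "carrier G \<lhd> G"
    by (auto simp: normal_inv_iff subgroup_self)
  then have "?F \<noteq> {}" using assms by blast
  then have "subgroup (\<Inter>?F) G"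
    by (intro subgroups_Inter) (auto intro: normal_imp_subgroup)
  then show ?thesis
    by (auto simp: normal_closure_def normal_inv_iff)
qed

definition coxeter_group :: "'a set \<Rightarrow> ('a \<Rightarrow> 'a \<Rightarrow> enat) \<Rightarrow> 'a word set set monoid" where
  "coxeter_group S m =
    artin_group S m Mod
      normal_closure (artin_group S m)
        {artin_gen S m s \<otimes>\<^bsub>artin_group S m\<^esub> artin_gen S m s | s. s \<in> S}"

definition spherical_type :: "'a set \<Rightarrow> ('a \<Rightarrow> 'a \<Rightarrow> enat) \<Rightarrow> bool" where
  "spherical_type S m \<longleftrightarrow> finite (carrier (coxeter_group S m))"

definition FC_type :: "'a set \<Rightarrow> ('a \<Rightarrow> 'a \<Rightarrow> enat) \<Rightarrow> bool" where
  "FC_type S m \<longleftrightarrow>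
    (\<forall>T\<subseteq>S. (\<forall>s\<in>T. \<forall>t\<in>T. m s t \<noteq> \<infinity>) \<longrightarrow> spherical_type T m)"

definition even_type :: "'a set \<Rightarrow> ('a \<Rightarrow> 'a \<Rightarrow> enat) \<Rightarrow> bool" where
  "even_type S m \<longleftrightarrow>
    (\<forall>s\<in>S. \<forall>t\<in>S. s \<noteq> t \<longrightarrow> m s t = \<infinity> \<or> (\<exists>n. m s t = enat n \<and> even n))"

end

theory Submission
  imports Defs "HOL-Algebra.Generated_Groups"
begin

text \<open>
  Fix a vertex \<open>z\<close> and let \<open>P\<close> be the Artin group on \<open>T = S - {z}\<close>. Since all labels are even,
  killing \<open>z\<close> is a retraction of the Artin group onto \<open>P\<close>, and by induction on \<open>S\<close> it suffices that
  its kernel \<open>K\<close> is free. \<open>K\<close> is generated by the conjugates \<open>c g = g z g\<^sup>-\<^sup>1\<close> with \<open>g \<in> P\<close>, and its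
  defining relations are \<open>c g \<cdot> c (g t) \<cdots> c (g t\<^sup>k\<^sup>-\<^sup>1) = c (g t) \<cdots> c (g t\<^sup>k)\<close> whenever \<open>m z t = 2 k\<close>.
  For \<open>k = 1\<close> they say that \<open>c\<close> is constant on cosets of the group on \<open>L2 = {t. m z t = 2}\<close>. For \<open>k \<ge> 2\<close>
  they relate the points of a line \<open>i \<mapsto> g t\<^sup>i\<close> and express all values on it through any \<open>k\<close> consecutive
  ones. A Coxeter group on three vertices with finite even labels, two of which exceed \<open>2\<close>, is
  infinite; hence by the FC condition the vertices of \<open>L4 = {t. 4 \<le> m z t < \<infinity>}\<close> are pairwise not
  joined, and each commutes with or is not joined to every vertex of \<open>L2\<close>. So the group on \<open>L2 \<union> L4\<close>
  is the semidirect product of a free group by the group on \<open>L2\<close>, and the cosets and lines form a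
  forest, given by the syllable normal forms in that free group. Walking along the forest away
  from the roots, every line adds \<open>k - 1\<close> free generators of \<open>K\<close>.
\<close>

section \<open>Homomorphisms from and actions of presented groups\<close>

text \<open>The obstacle is that a presentation of \<open>K\<close> is naturally read off a
  semidirect product by \<open>P\<close>, and an action of \<open>P\<close> on the candidate free
  group \<open>F\<close> is not at hand before \<open>K\<close> is known to be \<open>F\<close>. So
  only a mapping property is used: values in any group \<open>H\<close> that satisfy the window
  identities make the Artin group act on \<open>H \<times> P\<close>, and on \<open>K\<close> the
  first coordinate of this action is a homomorphism to \<open>H\<close>
  (\<open>compatible_hom\<close>). For \<open>H = F\<close> it inverts the evident map from
  \<open>F\<close> to \<open>K\<close>. Actions also replace normal form theorems: the forest
  coordinates are well defined because the group on \<open>L\<close> acts on reduced lists paired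
  with elements of \<open>A2\<close>, and the Coxeter triangle is infinite because it has an
  infinite orbit on the integers. Evenness enters twice. It gives the retractions, which embed the
  Artin groups of subsets, and it turns the braid relation (z t)^k = (t z)^k into a comparison of
  two windows of length k on a line.\<close>

declare in_lists_conv_set [simp del] in_listsD [rule del] in_listsI [rule del]

abbreviation pcl :: "'a set \<Rightarrow> ('a word \<times> 'a word) set \<Rightarrow> 'a word \<Rightarrow> 'a word set" where
  "pcl X R u \<equiv> pres_rel X R `` {u}"

lemma pcl_closed: "u \<in> words X \<Longrightarrow> pcl X R u \<in> carrier (presented_group X R)"
  by (auto simp: presented_group_def intro: quotientI)

lemma pcl_cases:
  assumes "A \<in> carrier (presented_group X R)"
  obtains u where "u \<in> words X" "A = pcl X R u"
  using assms by (auto simp: presented_group_def quotient_def)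

lemma pcl_eq_iff:
  "u \<in> words X \<Longrightarrow> v \<in> words X \<Longrightarrow> pcl X R u = pcl X R v \<longleftrightarrow> (u, v) \<in> pres_rel X R"
  by (rule eq_equiv_class_iff[OF equiv_pres_rel])

lemma one_presented_group: "\<one>\<^bsub>presented_group X R\<^esub> = pcl X R []"
  by (simp add: presented_group_def)

lemma pres_gen_closed: "x \<in> X \<Longrightarrow> pres_gen X R x \<in> carrier (presented_group X R)"
  unfolding pres_gen_def by (rule pcl_closed) simp

lemma inv_pres_gen:
  assumes "x \<in> X"
  shows "inv\<^bsub>presented_group X R\<^esub> (pres_gen X R x) = pcl X R [(x, False)]"
proof -
  interpret group "presented_group X R" by (rule group_presented_group)
  have "([] @ [(x, False), (x, \<not> False)] @ [], [] @ []) \<in> pres_rel X R"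
    using assms by (intro pres_rel.cancel) auto
  then have "pcl X R [(x, False)] \<otimes>\<^bsub>presented_group X R\<^esub> pres_gen X R x = \<one>\<^bsub>presented_group X R\<^esub>"
    using assms by (simp add: pres_gen_def pres_mult_class one_presented_group pcl_eq_iff)
  then show ?thesis
    using assms by (intro inv_equality) (auto intro!: pcl_closed simp: pres_gen_def)
qed

definition word_eval :: "('g, 'r) monoid_scheme \<Rightarrow> ('a \<Rightarrow> 'g) \<Rightarrow> 'a word \<Rightarrow> 'g" where
  "word_eval H f u =
    foldr (\<lambda>(x, b) h. (if b then f x else inv\<^bsub>H\<^esub> (f x)) \<otimes>\<^bsub>H\<^esub> h) u \<one>\<^bsub>H\<^esub>"

lemma word_eval_simps [simp]:
  "word_eval H f [] = \<one>\<^bsub>H\<^esub>"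
  "word_eval H f ((x, b) # u) =
    (if b then f x else inv\<^bsub>H\<^esub> (f x)) \<otimes>\<^bsub>H\<^esub> word_eval H f u"
  by (simp_all add: word_eval_def)

context group
begin

lemma word_eval_closed [simp]:
  "f \<in> X \<rightarrow> carrier G \<Longrightarrow> u \<in> words X \<Longrightarrow> word_eval G f u \<in> carrier G"
  by (induction u) (auto simp: Pi_iff)

lemma word_eval_append:
  "f \<in> X \<rightarrow> carrier G \<Longrightarrow> u \<in> words X \<Longrightarrow> v \<in> words X \<Longrightarrow>
    word_eval G f (u @ v) = word_eval G f u \<otimes> word_eval G f v"
  by (induction u) (auto simp: Pi_iff m_assoc)

lemma word_eval_pres_rel:
  assumes f: "f \<in> X \<rightarrow> carrier G"
    and R: "\<And>r s. (r, s) \<in> R \<Longrightarrow> r \<in> words X \<Longrightarrow> s \<in> words X \<Longrightarrow>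
      word_eval G f r = word_eval G f s"
    and "(u, v) \<in> pres_rel X R"
  shows "word_eval G f u = word_eval G f v"
  using assms(3)
proof (induction rule: pres_rel.induct)
  case (cancel u v x b)
  have "f x \<in> carrier G" using f cancel by auto
  moreover have "word_eval G f v \<in> carrier G" using f cancel by simp
  ultimately have "word_eval G f ([(x, b), (x, \<not> b)] @ v) = word_eval G f v"
    by (cases b) (simp_all add: m_assoc[symmetric])
  then show ?case
    using cancel by (simp add: word_eval_append[OF f] del: word_eval_simps append.simps)
next
  case (relator r s u v)
  then show ?case by (simp add: word_eval_append[OF f] R)
qed auto

text \<open>Von Dyck's theorem. Evaluation is constant on classes of words, so the arbitrary
  representative chosen in \<open>h\<close> does not matter.\<close>

lemma presented_group_hom:
  assumes f: "f \<in> X \<rightarrow> carrier G"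
    and R: "\<And>r s. (r, s) \<in> R \<Longrightarrow> r \<in> words X \<Longrightarrow> s \<in> words X \<Longrightarrow>
      word_eval G f r = word_eval G f s"
  obtains h where "h \<in> hom (presented_group X R) G"
    and "\<And>u. u \<in> words X \<Longrightarrow> h (pcl X R u) = word_eval G f u"
proof -
  define h where "h A = word_eval G f (SOME u. u \<in> words X \<and> A = pcl X R u)" for A
  have h: "h (pcl X R u) = word_eval G f u" if u: "u \<in> words X" for u
  proof -
    let ?P = "\<lambda>v. v \<in> words X \<and> pcl X R u = pcl X R v"
    let ?v = "SOME v. ?P v"
    have "\<exists>v. ?P v" using u by auto
    then have "?P ?v" by (rule someI_ex)
    then have "(?v, u) \<in> pres_rel X R" using u pcl_eq_iff[of ?v X u R] by simp
    with word_eval_pres_rel[OF f] R show ?thesis unfolding h_def by blast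
  qed
  have "h \<in> hom (presented_group X R) G"
  proof (rule homI)
    fix A assume "A \<in> carrier (presented_group X R)"
    then obtain u where u: "u \<in> words X" "A = pcl X R u" by (rule pcl_cases)
    then show "h A \<in> carrier G" using f h by simp
    fix B assume "B \<in> carrier (presented_group X R)"
    then obtain v where v: "v \<in> words X" "B = pcl X R v" by (rule pcl_cases)
    then show "h (A \<otimes>\<^bsub>presented_group X R\<^esub> B) = h A \<otimes> h B"
      using u f by (simp add: pres_mult_class h word_eval_append)
  qed
  then show thesis using h that by blast
qed

end

lemma word_eval_pres_gen:
  "u \<in> words X \<Longrightarrow> word_eval (presented_group X R) (pres_gen X R) u = pcl X R u"
proof (induction u)
  case Nil
  then show ?case by (simp add: one_presented_group)
next
  case (Cons a u)
  obtain x b where a: "a = (x, b)" by fastforce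
  have x: "x \<in> X" "u \<in> words X" using Cons.prems a by auto
  show ?case
    using x Cons.IH[OF x(2)] pres_mult_class[of "[(x, b)]" X u R]
    by (cases b) (simp_all add: a inv_pres_gen, simp add: pres_gen_def)
qed

lemma (in group) hom_word_eval:
  assumes "group H" "h \<in> hom G H" "f \<in> X \<rightarrow> carrier G" "u \<in> words X"
  shows "h (word_eval G f u) = word_eval H (\<lambda>x. h (f x)) u"
proof -
  interpret h: group_hom G H h using assms by (simp add: group_hom_def group_hom_axioms_def is_group)
  show ?thesis
    using assms(4)
  proof (induction u rule: list.induct)
    case (Cons a u)
    obtain x b where a: "a = (x, b)" by fastforce
    have x: "x \<in> X" "f x \<in> carrier G" "u \<in> words X" using Cons.prems a assms(3) by auto
    then have "word_eval G f u \<in> carrier G" using assms(3) by simp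
    then show ?case using x Cons.IH[OF x(3)] by (cases b) (simp_all add: a)
  qed simp
qed

lemma word_eval_cong:
  "(\<And>x. x \<in> X \<Longrightarrow> f x = g x) \<Longrightarrow> u \<in> words X \<Longrightarrow> word_eval H f u = word_eval H g u"
  by (induction u) auto

lemma presented_group_hom_eqI:
  assumes "group H" "h \<in> hom (presented_group X R) H" "h' \<in> hom (presented_group X R) H"
    and "\<And>x. x \<in> X \<Longrightarrow> h (pres_gen X R x) = h' (pres_gen X R x)"
    and "A \<in> carrier (presented_group X R)"
  shows "h A = h' A"
proof -
  interpret group "presented_group X R" by (rule group_presented_group)
  obtain u where u: "u \<in> words X" "A = pcl X R u" using assms(5) by (rule pcl_cases)
  have gen: "pres_gen X R \<in> X \<rightarrow> carrier (presented_group X R)"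
    by (simp add: pres_gen_closed)
  have "h A = word_eval H (\<lambda>x. h (pres_gen X R x)) u"
    using hom_word_eval[OF assms(1,2) gen u(1)] u by (simp add: word_eval_pres_gen)
  also have "\<dots> = word_eval H (\<lambda>x. h' (pres_gen X R x)) u"
    using assms(4) u(1) by (rule word_eval_cong)
  also have "\<dots> = h' A"
    using hom_word_eval[OF assms(1,3) gen u(1)] u by (simp add: word_eval_pres_gen)
  finally show ?thesis .
qed

lemma free_group_hom:
  assumes "group H" "f \<in> X \<rightarrow> carrier H"
  obtains h where "h \<in> hom (presented_group X {}) H"
    and "\<And>x. x \<in> X \<Longrightarrow> h (pres_gen X {} x) = f x"
proof -
  interpret group H by fact
  obtain h where h: "h \<in> hom (presented_group X {}) H"
    "\<And>u. u \<in> words X \<Longrightarrow> h (pcl X {} u) = word_eval H f u"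
    using presented_group_hom[OF assms(2), of "{}"] by blast
  have "h (pres_gen X {} x) = f x" if "x \<in> X" for x
  proof -
    have "f x \<in> carrier H" using that assms(2) by auto
    then show ?thesis using h(2)[of "[(x, True)]"] that by (simp add: pres_gen_def)
  qed
  with h(1) show thesis by (rule that)
qed

lemma isoI_inverse:
  assumes "h \<in> hom G H" "k \<in> hom H G"
    and "\<And>x. x \<in> carrier G \<Longrightarrow> k (h x) = x" "\<And>y. y \<in> carrier H \<Longrightarrow> h (k y) = y"
  shows "G \<cong> H"
proof -
  have "bij_betw h (carrier G) (carrier H)"
    using assms by (intro bij_betw_byWitness[where f' = k]) (auto simp: hom_def)
  then show ?thesis using assms(1) by (auto simp: is_iso_def iso_def)
qed

lemma hom_id: "(\<lambda>x. x) \<in> hom G G"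
  by (simp add: hom_def)

lemma hom_comp: "h \<in> hom G H \<Longrightarrow> k \<in> hom H K \<Longrightarrow> (\<lambda>x. k (h x)) \<in> hom G K"
  using hom_compose[of h G H k K] by (simp add: comp_def)

text \<open>\<open>is_free_group\<close> asks for a basis inside the carrier, so an isomorphism has
  to move the basis to its image; this supplies the renaming.\<close>

lemma free_group_reindex:
  assumes "bij_betw f X Y"
  shows "presented_group X {} \<cong> presented_group Y {}"
proof -
  let ?F = "presented_group X {}" and ?F' = "presented_group Y {}"
  let ?g = "the_inv_into X f"
  have f: "inj_on f X" "f ` X = Y" using assms by (auto simp: bij_betw_def)
  have gY: "?g y \<in> X" if "y \<in> Y" for y
    using the_inv_into_into[OF f(1) _ subset_refl] f(2) that by simp
  obtain h where h: "h \<in> hom ?F ?F'" "\<And>x. x \<in> X \<Longrightarrow> h (pres_gen X {} x) = pres_gen Y {} (f x)"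
    using free_group_hom[OF group_presented_group[of Y "{}"], of "\<lambda>x. pres_gen Y {} (f x)" X] f(2)
    by (auto intro!: pres_gen_closed)
  obtain k where k: "k \<in> hom ?F' ?F" "\<And>y. y \<in> Y \<Longrightarrow> k (pres_gen Y {} y) = pres_gen X {} (?g y)"
    using free_group_hom[OF group_presented_group[of X "{}"], of "\<lambda>y. pres_gen X {} (?g y)" Y]
      gY by (metis (no_types, lifting) Pi_I pres_gen_closed)
  show ?thesis
  proof (rule isoI_inverse[OF h(1) k(1)])
    fix x assume x: "x \<in> carrier ?F"
    have "k (h (pres_gen X {} x)) = pres_gen X {} x" if "x \<in> X" for x
      using that h(2) k(2) f by (metis imageI the_inv_into_f_f)
    with presented_group_hom_eqI[OF group_presented_group hom_comp[OF h(1) k(1)] hom_id _ x]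
    show "k (h x) = x" .
  next
    fix y assume y: "y \<in> carrier ?F'"
    have "h (k (pres_gen Y {} y)) = pres_gen Y {} y" if "y \<in> Y" for y
      using that h(2) k(2) f gY by (metis f_the_inv_into_f)
    with presented_group_hom_eqI[OF group_presented_group hom_comp[OF k(1) h(1)] hom_id _ y]
    show "h (k y) = y" .
  qed
qed

lemma is_free_group_iso:
  assumes "G \<cong> H" "group H" "is_free_group G"
  shows "is_free_group H"
proof -
  obtain X where X: "X \<subseteq> carrier G" "presented_group X {} \<cong> G" and G: "group G"
    using assms(3) by (auto simp: is_free_group_def)
  interpret G: group G by fact
  obtain h where h: "h \<in> iso G H" using assms(1) by (auto simp: is_iso_def)
  then have "bij_betw h (carrier G) (carrier H)" by (simp add: iso_def)
  then have b: "bij_betw h X (h ` X)" and s: "h ` X \<subseteq> carrier H"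
    using X(1) by (auto simp: bij_betw_def intro: inj_on_subset)
  have "presented_group (h ` X) {} \<cong> presented_group X {}"
    using group.iso_sym[OF group_presented_group free_group_reindex[OF b]] .
  from iso_trans[OF iso_trans[OF this X(2)] assms(1)] show ?thesis using assms(2) s by (auto simp: is_free_group_def)
qed

section \<open>Right actions given on letters\<close>

definition word_act :: "('a \<Rightarrow> bool \<Rightarrow> 'b \<Rightarrow> 'b) \<Rightarrow> 'a word \<Rightarrow> 'b \<Rightarrow> 'b" where
  "word_act p u \<omega> = foldl (\<lambda>\<omega> (x, b). p x b \<omega>) \<omega> u"

lemma word_act_simps [simp]:
  "word_act p [] \<omega> = \<omega>"
  "word_act p ((x, b) # u) \<omega> = word_act p u (p x b \<omega>)"
  "word_act p (u @ v) \<omega> = word_act p v (word_act p u \<omega>)"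
  by (simp_all add: word_act_def)

text \<open>Letters act from left to right, so words act from the right, as fits the right
  multiplications to which this is applied. The flag \<open>b\<close> is the sign of the
  letter.\<close>

locale word_action =
  fixes X :: "'a set" and R :: "('a word \<times> 'a word) set"
    and \<Omega> :: "'b set" and p :: "'a \<Rightarrow> bool \<Rightarrow> 'b \<Rightarrow> 'b"
  assumes closed: "x \<in> X \<Longrightarrow> \<omega> \<in> \<Omega> \<Longrightarrow> p x b \<omega> \<in> \<Omega>"
    and inverse: "x \<in> X \<Longrightarrow> \<omega> \<in> \<Omega> \<Longrightarrow> p x (\<not> b) (p x b \<omega>) = \<omega>"
    and relators: "(r, s) \<in> R \<Longrightarrow> r \<in> words X \<Longrightarrow> s \<in> words X \<Longrightarrow> \<omega> \<in> \<Omega> \<Longrightarrow>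
      word_act p r \<omega> = word_act p s \<omega>"
begin

lemma word_act_closed: "u \<in> words X \<Longrightarrow> \<omega> \<in> \<Omega> \<Longrightarrow> word_act p u \<omega> \<in> \<Omega>"
  by (induction u arbitrary: \<omega>) (auto simp: closed)

lemma word_act_pres_rel:
  assumes "(u, v) \<in> pres_rel X R" "\<omega> \<in> \<Omega>"
  shows "word_act p u \<omega> = word_act p v \<omega>"
  using assms
proof (induction rule: pres_rel.induct)
  case (cancel u v x b)
  then show ?case using inverse[of x "word_act p u \<omega>" b] word_act_closed by simp
next
  case (relator r s u v)
  then show ?case using relators[of r s "word_act p u \<omega>"] word_act_closed by simp
qed auto

end

section \<open>Extensions of poly-free groups by free groups\<close>

text \<open>Serves the lowest step of a tower: the quotient by the trivial subgroup consists of
  cosets and is only isomorphic to the group.\<close>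

lemma is_free_group_Mod_one:
  assumes "is_free_group G"
  shows "is_free_group (G Mod {\<one>\<^bsub>G\<^esub>})"
proof -
  interpret G: group G using assms by (simp add: is_free_group_def)
  have h: "group_hom G G (\<lambda>x. x)"
    by (simp add: group_hom_def group_hom_axioms_def hom_id G.is_group)
  have k: "kernel G G (\<lambda>x. x) = {\<one>\<^bsub>G\<^esub>}"
    using G.one_closed unfolding kernel_def by blast
  have "G Mod {\<one>\<^bsub>G\<^esub>} \<cong> G"
    using group_hom.FactGroup_iso[OF h] unfolding k by simp
  moreover have g: "group (G Mod {\<one>\<^bsub>G\<^esub>})"
    using normal.factorgroup_is_group[OF group_hom.normal_kernel[OF h]] unfolding k .
  ultimately have "G \<cong> G Mod {\<one>\<^bsub>G\<^esub>}"
    using group.iso_sym by blast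
  then show ?thesis using g assms by (rule is_free_group_iso)
qed

text \<open>The preimages of the tower of \<open>P\<close> start with the kernel, so prefixing the
  trivial group gives a tower of \<open>G\<close> that is longer by one. Above the kernel the
  quotients are those of \<open>P\<close> by the isomorphism theorem.\<close>

lemma poly_free_extension:
  assumes "group_hom G P \<pi>" and onto: "\<pi> ` carrier G = carrier P"
    and free: "is_free_group (G\<lparr>carrier := kernel G P \<pi>\<rparr>)"
    and "poly_free P"
  shows "poly_free G"
proof -
  interpret \<pi>: group_hom G P \<pi> by fact
  let ?K = "kernel G P \<pi>"
  obtain N H where H: "H 0 = {\<one>\<^bsub>P\<^esub>}" "H N = carrier P"
    "\<And>i. i \<le> N \<Longrightarrow> subgroup (H i) P"
    "\<And>i. i < N \<Longrightarrow> H i \<lhd> (P\<lparr>carrier := H (Suc i)\<rparr>)"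
    "\<And>i. i < N \<Longrightarrow> is_free_group ((P\<lparr>carrier := H (Suc i)\<rparr>) Mod (H i))"
    using assms(4) unfolding poly_free_def by blast
  define H' where "H' i = (case i of 0 \<Rightarrow> {\<one>\<^bsub>G\<^esub>} | Suc j \<Rightarrow> {x \<in> carrier G. \<pi> x \<in> H j})" for i
  have H'_simps: "H' 0 = {\<one>\<^bsub>G\<^esub>}" "H' (Suc j) = {x \<in> carrier G. \<pi> x \<in> H j}" for j
    by (simp_all add: H'_def)
  have H'_1: "H' (Suc 0) = ?K" by (simp add: H'_simps H(1) kernel_def)
  have sub: "subgroup (H' i) G" if "i \<le> Suc N" for i
  proof (cases i)
    case 0
    then show ?thesis by (simp add: H'_simps \<pi>.G.triv_subgroup)
  next
    case (Suc j)
    then interpret Hj: subgroup "H j" P using that H(3) by simp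
    show ?thesis unfolding Suc H'_simps by unfold_locales auto
  qed
  have step: "H' (Suc j) \<lhd> (G\<lparr>carrier := H' (Suc (Suc j))\<rparr>) \<and>
      is_free_group ((G\<lparr>carrier := H' (Suc (Suc j))\<rparr>) Mod (H' (Suc j)))" if j: "j < N" for j
  proof -
    let ?G = "G\<lparr>carrier := H' (Suc (Suc j))\<rparr>" and ?P = "P\<lparr>carrier := H (Suc j)\<rparr>"
    let ?h = "\<lambda>x. H j #>\<^bsub>?P\<^esub> \<pi> x"
    interpret G': group ?G
      using subgroup.subgroup_is_group[OF sub[of "Suc (Suc j)"] \<pi>.G.is_group] j by simp
    interpret P': group ?P
      using subgroup.subgroup_is_group[OF H(3)[of "Suc j"] \<pi>.H.is_group] j by simp
    interpret n: normal "H j" ?P by (rule H(4)[OF j])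
    have "\<pi> \<in> hom ?G ?P"
      by (auto simp: hom_def H'_simps)
    then have "?h \<in> hom ?G (?P Mod H j)"
      using hom_comp n.r_coset_hom_Mod by blast
    then interpret h: group_hom ?G "?P Mod H j" ?h
      by (simp add: group_hom_def group_hom_axioms_def G'.is_group n.factorgroup_is_group)
    have "?h ` carrier ?G = carrier (?P Mod H j)"
    proof -
      have "\<pi> ` H' (Suc (Suc j)) = H (Suc j)"
        using onto subgroup.subset[OF H(3)[of "Suc j"]] j by (auto simp: H'_simps image_iff)
      then have "?h ` H' (Suc (Suc j)) = (\<lambda>y. H j #>\<^bsub>?P\<^esub> y) ` H (Suc j)"
        by (metis image_image)
      then show ?thesis by (simp add: carrier_FactGroup)
    qed
    note iso = h.FactGroup_iso[OF this]
    have Hj: "H j \<subseteq> H (Suc j)" using n.subset by simp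
    have "(?h x = H j) = (\<pi> x \<in> H j)" if "x \<in> carrier ?G" for x
    proof -
      have "\<pi> x \<in> carrier ?P" using that by (simp add: H'_simps)
      then show ?thesis
        using P'.coset_join1[OF _ _ n.is_subgroup] P'.coset_join2[OF _ n.is_subgroup] by blast
    qed
    then have ker: "kernel ?G (?P Mod H j) ?h = H' (Suc j)"
      using Hj by (auto simp: kernel_def H'_simps)
    have g: "group (?G Mod H' (Suc j))"
      using normal.factorgroup_is_group[OF h.normal_kernel] by (simp only: ker)
    have "?P Mod H j \<cong> ?G Mod H' (Suc j)"
      by (rule group.iso_sym[OF g]) (use iso in \<open>simp only: ker\<close>)
    then have "is_free_group (?G Mod H' (Suc j))"
      using g H(5)[OF j] by (rule is_free_group_iso)
    then show ?thesis using h.normal_kernel by (simp only: ker)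
  qed
  have "H' i \<lhd> (G\<lparr>carrier := H' (Suc i)\<rparr>) \<and>
      is_free_group ((G\<lparr>carrier := H' (Suc i)\<rparr>) Mod (H' i))" if "i < Suc N" for i
  proof (cases i)
    case 0
    interpret K: group "G\<lparr>carrier := ?K\<rparr>"
      using free by (simp add: is_free_group_def)
    show ?thesis
      using K.one_is_normal is_free_group_Mod_one[OF free] by (simp add: 0 H'_1 H'_simps(1))
  next
    case (Suc j)
    then show ?thesis using step that by simp
  qed
  moreover have "H' (Suc N) = carrier G" by (auto simp: H'_simps H(2))
  ultimately show ?thesis
    unfolding poly_free_def using sub H'_simps(1) \<pi>.G.is_group
    by (intro conjI exI[of _ "Suc N"] exI[of _ H']) auto
qed

section \<open>Sequences with constant window products\<close>

primrec gprod :: "('g, 'r) monoid_scheme \<Rightarrow> (nat \<Rightarrow> 'g) \<Rightarrow> nat \<Rightarrow> 'g" where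
  "gprod H f 0 = \<one>\<^bsub>H\<^esub>"
| "gprod H f (Suc k) = gprod H f k \<otimes>\<^bsub>H\<^esub> f k"

lemma gprod_cong: "(\<And>j. j < k \<Longrightarrow> f j = g j) \<Longrightarrow> gprod H f k = gprod H g k"
  by (induction k) auto

text \<open>
  If all products of \<open>k\<close> consecutive terms of a two-sided sequence equal \<open>x\<close>, then shifting by \<open>k\<close>
  conjugates by \<open>x\<close>; this extends arbitrary values on \<open>0, \<dots>, k - 1\<close> uniquely.
\<close>

definition rext :: "('g, 'r) monoid_scheme \<Rightarrow> nat \<Rightarrow> (nat \<Rightarrow> 'g) \<Rightarrow> int \<Rightarrow> 'g" where
  "rext H k y i = (let x = gprod H y k; q = i div int k in
     inv\<^bsub>H\<^esub> (x [^]\<^bsub>H\<^esub> q) \<otimes>\<^bsub>H\<^esub> y (nat (i mod int k)) \<otimes>\<^bsub>H\<^esub> x [^]\<^bsub>H\<^esub> q)"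

text \<open>The shape that the relations for one vertex \<open>t\<close> take along the whole line i
  \<mapsto> g t^i, negative positions included.\<close>

definition rseq :: "('g, 'r) monoid_scheme \<Rightarrow> nat \<Rightarrow> (int \<Rightarrow> 'g) \<Rightarrow> bool" where
  "rseq H k Y \<longleftrightarrow> (\<forall>i. Y i \<in> carrier H) \<and>
    (\<forall>i. gprod H (\<lambda>j. Y (i + int j)) k = gprod H (\<lambda>j. Y (i + 1 + int j)) k)"

lemma rext_cong: "k > 0 \<Longrightarrow> (\<And>j. j < k \<Longrightarrow> f j = g j) \<Longrightarrow> rext H k f i = rext H k g i"
  using gprod_cong[of k f g H] by (simp add: rext_def Let_def nat_less_iff)

context group
begin

lemma inv_cancel_left:
  "a \<in> carrier G \<Longrightarrow> b \<in> carrier G \<Longrightarrow> inv a \<otimes> (a \<otimes> b) = b"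
  "a \<in> carrier G \<Longrightarrow> b \<in> carrier G \<Longrightarrow> a \<otimes> (inv a \<otimes> b) = b"
  by (simp_all add: m_assoc[symmetric])

lemma gprod_closed [simp]: "(\<And>j. j < k \<Longrightarrow> f j \<in> carrier G) \<Longrightarrow> gprod G f k \<in> carrier G"
  by (induction k) auto

lemma gprod_add:
  "(\<And>j. j < a + b \<Longrightarrow> f j \<in> carrier G) \<Longrightarrow>
    gprod G f (a + b) = gprod G f a \<otimes> gprod G (\<lambda>j. f (a + j)) b"
  by (induction b) (auto simp: m_assoc)

lemma gprod_Suc_left:
  assumes "\<And>j. j < Suc k \<Longrightarrow> f j \<in> carrier G"
  shows "gprod G f (Suc k) = f 0 \<otimes> gprod G (\<lambda>j. f (Suc j)) k"
  using gprod_add[of 1 k f] assms by simp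

lemma gprod_conj:
  assumes "a \<in> carrier G" "\<And>j. j < k \<Longrightarrow> f j \<in> carrier G"
  shows "gprod G (\<lambda>j. inv a \<otimes> f j \<otimes> a) k = inv a \<otimes> gprod G f k \<otimes> a"
  using assms(2)
proof (induction k)
  case (Suc k)
  have "gprod G f k \<in> carrier G" "f k \<in> carrier G" using Suc.prems by auto
  then show ?case
    using Suc assms(1) by (simp add: m_assoc inv_cancel_left)
qed (use assms in simp)

lemma hom_gprod:
  assumes "group_hom G H h" "\<And>j. j < k \<Longrightarrow> f j \<in> carrier G"
  shows "h (gprod G f k) = gprod H (\<lambda>j. h (f j)) k"
proof -
  interpret h: group_hom G H h by fact
  show ?thesis using assms(2) by (induction k) auto
qed

lemma hom_rext:
  assumes "group_hom G H h" "k > 0" "\<And>j. j < k \<Longrightarrow> y j \<in> carrier G"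
  shows "h (rext G k y i) = rext H k (\<lambda>j. h (y j)) i"
proof -
  interpret h: group_hom G H h by fact
  have "gprod G y k \<in> carrier G" "y (nat (i mod int k)) \<in> carrier G"
    using assms by (auto simp: nat_less_iff)
  then show ?thesis
    using hom_gprod[OF assms(1), of k y] assms by (simp add: rext_def Let_def h.hom_int_pow)
qed

lemma rext_closed [simp]:
  assumes "k > 0" "\<And>j. j < k \<Longrightarrow> y j \<in> carrier G"
  shows "rext G k y i \<in> carrier G"
  using assms by (simp add: rext_def Let_def nat_less_iff)

lemma rext_small:
  assumes "r < k" "\<And>j. j < k \<Longrightarrow> y j \<in> carrier G"
  shows "rext G k y (int r) = y r"
  using assms by (simp add: rext_def Let_def)

text \<open>Write i = q k + r. The window at i is the tail \<open>A\<close> of the block from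
  position r on, conjugated by x^q, followed by the head \<open>B\<close>, conjugated by x^(q+1). As
  x = B A, the factor A x^-1 B in the middle is trivial, and what remains is x conjugated by its own
  power x^q.\<close>

lemma gprod_rext:
  assumes k: "k > 0" and y: "\<And>j. j < k \<Longrightarrow> y j \<in> carrier G"
  shows "gprod G (\<lambda>j. rext G k y (i + int j)) k = gprod G y k"
proof -
  define x q r where "x = gprod G y k" and "q = i div int k" and "r = nat (i mod int k)"
  have r: "r < k" "i = q * int k + int r" using k by (auto simp: r_def q_def nat_less_iff)
  define A B where "A = gprod G (\<lambda>j. y (r + j)) (k - r)" and "B = gprod G y r"
  define z where "z = x [^] q"
  have c: "x \<in> carrier G" "A \<in> carrier G" "B \<in> carrier G" "z \<in> carrier G"
    using y r by (auto simp: x_def A_def B_def z_def)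
  have x: "x = B \<otimes> A" using gprod_add[of r "k - r" y] y r by (simp add: x_def A_def B_def)
  have z1: "x [^] (q + 1) = x \<otimes> z"
    using c int_pow_mult[of x 1 q] by (simp add: z_def add.commute)
  have dm: "(int a + p * int k) div int k = p" "(int a + p * int k) mod int k = int a" if "a < k" for a p
    using that by simp_all
  have 1: "rext G k y (i + int j) = inv z \<otimes> y (r + j) \<otimes> z" if "j < k - r" for j
  proof -
    have "i + int j = int (r + j) + q * int k" using r by simp
    moreover have "r + j < k" using that by simp
    ultimately show ?thesis by (simp only: rext_def Let_def x_def z_def nat_int dm)
  qed
  have 2: "rext G k y (i + int (k - r + j)) = inv (x \<otimes> z) \<otimes> y j \<otimes> (x \<otimes> z)" if "j < r" for j
  proof -
    have "i + int (k - r + j) = int j + (q + 1) * int k" using r by (simp add: algebra_simps of_nat_diff)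
    moreover have "j < k" using that r by simp
    ultimately show ?thesis by (simp only: rext_def Let_def x_def[symmetric] z1 nat_int dm)
  qed
  have "gprod G (\<lambda>j. rext G k y (i + int j)) k =
      gprod G (\<lambda>j. rext G k y (i + int j)) (k - r) \<otimes>
      gprod G (\<lambda>j. rext G k y (i + int (k - r + j))) r"
  proof -
    have "rext G k y i' \<in> carrier G" for i' by (intro rext_closed k y)
    then show ?thesis
      using gprod_add[of "k - r" r "\<lambda>j. rext G k y (i + int j)"]
      by (simp only: le_add_diff_inverse2[OF less_imp_le[OF r(1)]])
  qed
  also have "gprod G (\<lambda>j. rext G k y (i + int j)) (k - r) = inv z \<otimes> A \<otimes> z"
    using gprod_conj[of z "k - r" "\<lambda>j. y (r + j)"] c y by (simp add: A_def 1 cong: gprod_cong)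
  also have "gprod G (\<lambda>j. rext G k y (i + int (k - r + j))) r = inv (x \<otimes> z) \<otimes> B \<otimes> (x \<otimes> z)"
  proof -
    have "gprod G (\<lambda>j. rext G k y (i + int (k - r + j))) r = gprod G (\<lambda>j. inv (x \<otimes> z) \<otimes> y j \<otimes> (x \<otimes> z)) r"
      by (rule gprod_cong) (rule 2)
    then show ?thesis using gprod_conj[of "x \<otimes> z" r y] c y r(1) by (simp add: B_def)
  qed
  also have "inv z \<otimes> A \<otimes> z \<otimes> (inv (x \<otimes> z) \<otimes> B \<otimes> (x \<otimes> z)) = inv z \<otimes> (A \<otimes> inv x \<otimes> B) \<otimes> x \<otimes> z"
    using c by (simp add: inv_mult_group m_assoc inv_cancel_left)
  also have "A \<otimes> inv x \<otimes> B = \<one>"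
    using c by (simp add: x inv_mult_group m_assoc inv_cancel_left)
  also have "inv z \<otimes> \<one> \<otimes> x \<otimes> z = x"
  proof -
    have "x \<otimes> z = z \<otimes> x" unfolding z_def using c int_pow_mult[of x 1 q] int_pow_mult[of x q 1]
      by (simp add: add.commute)
    then show ?thesis using c by (simp add: m_assoc inv_cancel_left)
  qed
  finally show ?thesis by (simp add: x_def)
qed

lemma rseq_rext:
  assumes "k > 0" "\<And>j. j < k \<Longrightarrow> y j \<in> carrier G"
  shows "rseq G k (rext G k y)"
  unfolding rseq_def
proof (intro conjI allI)
  show "rext G k y i \<in> carrier G" for i by (intro rext_closed assms)
  show "gprod G (\<lambda>j. rext G k y (i + int j)) k = gprod G (\<lambda>j. rext G k y (i + 1 + int j)) k" for i
    using gprod_rext[of k y i] gprod_rext[of k y "i + 1"] assms by presburger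
qed

text \<open>The windows at i and i + 1 share the factor p = Y (i + 1) ... Y (i + k - 1), so Y i p =
  x = p Y (i + k), whence Y (i + k) = x^-1 (Y i) x.\<close>

lemma rseq_eq_rext:
  assumes Y: "rseq G k Y" and k: "k > 0"
  shows "Y i = rext G k (\<lambda>j. Y (int j)) i"
proof -
  have c [simp]: "Y i \<in> carrier G" for i using Y by (simp add: rseq_def)
  define x where "x = gprod G (\<lambda>j. Y (int j)) k"
  have xc [simp]: "x \<in> carrier G" by (simp add: x_def)
  have step: "gprod G (\<lambda>j. Y (i + int j)) k = gprod G (\<lambda>j. Y (i + 1 + int j)) k" for i
    using Y by (simp add: rseq_def)
  have x: "gprod G (\<lambda>j. Y (i + int j)) k = x" for i
  proof (induction i rule: int_induct[of _ 0])
    case base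
    then show ?case by (simp add: x_def)
  next
    case (step1 i)
    then show ?case using step[of i] by simp
  next
    case (step2 i)
    then show ?case using step[of "i - 1"] by simp
  qed
  obtain k' where k': "k = Suc k'" using k by (cases k) auto
  have shift: "Y (i + int k) = inv x \<otimes> Y i \<otimes> x" for i
  proof -
    define p where "p = gprod G (\<lambda>j. Y (i + 1 + int j)) k'"
    have pc: "p \<in> carrier G" by (simp add: p_def)
    have 1: "x = Y i \<otimes> p"
      using x[of i] gprod_Suc_left[of k' "\<lambda>j. Y (i + int j)"] by (simp add: k' p_def add.assoc)
    have "p \<otimes> Y (i + int k) = x"
      using x[of "i + 1"] by (simp add: k' p_def add.assoc)
    then have "Y (i + int k) = inv p \<otimes> x" using pc by (metis c xc inv_solve_left)
    also have "\<dots> = inv x \<otimes> Y i \<otimes> x"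
    proof -
      have "inv p = inv x \<otimes> Y i" using pc by (simp add: 1 inv_mult_group m_assoc)
      then show ?thesis by simp
    qed
    finally show ?thesis .
  qed
  have "Y (int r + q * int k) = inv (x [^] q) \<otimes> Y (int r) \<otimes> x [^] q" for q r
  proof (induction q rule: int_induct[of _ 0])
    case base
    then show ?case by simp
  next
    case (step1 q)
    have e: "x [^] (q + 1) = x [^] q \<otimes> x" by (simp add: int_pow_mult)
    have "Y (int r + (q + 1) * int k) = inv x \<otimes> Y (int r + q * int k) \<otimes> x"
      using shift[of "int r + q * int k"] by (simp add: algebra_simps)
    then show ?case unfolding e step1.IH by (simp add: inv_mult_group m_assoc)
  next
    case (step2 q)
    have e: "x [^] q = x [^] (q - 1) \<otimes> x" using int_pow_mult[of x "q - 1" 1] by simp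
    let ?a = "Y (int r + (q - 1) * int k)"
    have "Y (int r + q * int k) = inv x \<otimes> ?a \<otimes> x"
      using shift[of "int r + (q - 1) * int k"] by (simp add: algebra_simps)
    then have "?a = x \<otimes> Y (int r + q * int k) \<otimes> inv x"
      by (simp add: m_assoc inv_cancel_left)
    also have "\<dots> = inv (x [^] (q - 1)) \<otimes> Y (int r) \<otimes> x [^] (q - 1)"
      unfolding step2.IH e by (simp add: inv_mult_group m_assoc inv_cancel_left)
    finally show ?case .
  qed
  from this[of "nat (i mod int k)" "i div int k"] show ?thesis
    using k by (simp add: rext_def Let_def x_def[symmetric])
qed

end

section \<open>Infinite Coxeter groups on three vertices\<close>

context word_action
begin

definition class_act :: "'a word set \<Rightarrow> 'b \<Rightarrow> 'b" where
  "class_act A = word_act p (SOME u. u \<in> A)"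

lemma class_act_pcl:
  assumes "u \<in> words X" "\<omega> \<in> \<Omega>"
  shows "class_act (pcl X R u) \<omega> = word_act p u \<omega>"
proof -
  have "u \<in> pcl X R u" using assms by (simp add: pres_rel.refl)
  then have "(SOME v. v \<in> pcl X R u) \<in> pcl X R u" by (rule someI)
  then have "(u, SOME v. v \<in> pcl X R u) \<in> pres_rel X R" by (simp only: Image_singleton_iff)
  from word_act_pres_rel[OF this assms(2)] show ?thesis by (simp only: class_act_def)
qed

lemma class_act_closed:
  "A \<in> carrier (presented_group X R) \<Longrightarrow> \<omega> \<in> \<Omega> \<Longrightarrow> class_act A \<omega> \<in> \<Omega>"
  by (auto elim!: pcl_cases simp: class_act_pcl word_act_closed)

lemma class_act_mult:
  assumes "A \<in> carrier (presented_group X R)" "B \<in> carrier (presented_group X R)" "\<omega> \<in> \<Omega>"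
  shows "class_act (A \<otimes>\<^bsub>presented_group X R\<^esub> B) \<omega> = class_act B (class_act A \<omega>)"
proof -
  obtain u where u: "u \<in> words X" "A = pcl X R u" using assms(1) by (rule pcl_cases)
  obtain v where v: "v \<in> words X" "B = pcl X R v" using assms(2) by (rule pcl_cases)
  show ?thesis using u v assms(3) by (simp add: pres_mult_class class_act_pcl word_act_closed)
qed

lemma class_act_one: "\<omega> \<in> \<Omega> \<Longrightarrow> class_act \<one>\<^bsub>presented_group X R\<^esub> \<omega> = \<omega>"
  by (simp add: one_presented_group class_act_pcl)

lemma class_act_gen: "x \<in> X \<Longrightarrow> \<omega> \<in> \<Omega> \<Longrightarrow> class_act (pres_gen X R x) \<omega> = p x True \<omega>"
  by (simp add: pres_gen_def class_act_pcl)

lemma normal_pointwise_stabilizer: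
  "{A \<in> carrier (presented_group X R). \<forall>\<omega>\<in>\<Omega>. class_act A \<omega> = \<omega>} \<lhd> presented_group X R"
    (is "?N \<lhd> ?G")
proof -
  interpret group ?G by (rule group_presented_group)
  have inv: "class_act (inv\<^bsub>?G\<^esub> A) (class_act A \<omega>) = \<omega>" if "A \<in> carrier ?G" "\<omega> \<in> \<Omega>" for A \<omega>
    using class_act_mult[of A "inv\<^bsub>?G\<^esub> A" \<omega>] that by (simp add: class_act_one)
  have "subgroup ?N ?G"
  proof (rule subgroupI)
    show "?N \<noteq> {}" using class_act_one by blast
    show "inv\<^bsub>?G\<^esub> A \<in> ?N" if "A \<in> ?N" for A
      using that inv[of A] by auto
    show "A \<otimes>\<^bsub>?G\<^esub> B \<in> ?N" if "A \<in> ?N" "B \<in> ?N" for A B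
      using that by (simp add: class_act_mult)
  qed auto
  moreover have "A \<otimes>\<^bsub>?G\<^esub> B \<otimes>\<^bsub>?G\<^esub> inv\<^bsub>?G\<^esub> A \<in> ?N" if "A \<in> carrier ?G" "B \<in> ?N" for A B
    using that by (simp add: class_act_mult class_act_closed inv)
  ultimately show ?thesis by (simp add: normal_inv_iff)
qed

text \<open>Elements of \<open>N\<close> fix \<omega> and act first, so the image of \<omega> under
  u depends only on the coset N u.\<close>

lemma finite_orbit:
  assumes N: "N \<lhd> presented_group X R" "\<And>A \<omega>. A \<in> N \<Longrightarrow> \<omega> \<in> \<Omega> \<Longrightarrow> class_act A \<omega> = \<omega>"
    and fin: "finite (carrier (presented_group X R Mod N))" and \<omega>: "\<omega> \<in> \<Omega>"
  shows "finite ((\<lambda>u. word_act p u \<omega>) ` words X)"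
proof -
  let ?G = "presented_group X R"
  interpret group ?G by (rule group_presented_group)
  let ?f = "\<lambda>C. class_act (SOME A. A \<in> C) \<omega>"
  have "word_act p u \<omega> \<in> ?f ` carrier (?G Mod N)" if u: "u \<in> words X" for u
  proof
    let ?C = "N #>\<^bsub>?G\<^esub> pcl X R u"
    have c: "pcl X R u \<in> carrier ?G" using u by (rule pcl_closed)
    then show "?C \<in> carrier (?G Mod N)" by (simp add: carrier_FactGroup)
    have "pcl X R u \<in> ?C" using c N(1) by (simp add: normal_imp_subgroup rcos_self)
    then have "(SOME A. A \<in> ?C) \<in> ?C" by (rule someI)
    then obtain B where B: "B \<in> N" "(SOME A. A \<in> ?C) = B \<otimes>\<^bsub>?G\<^esub> pcl X R u"
      unfolding r_coset_def by blast
    have "B \<in> carrier ?G" using B(1) N(1) by (meson normal_imp_subgroup subgroup.mem_carrier)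
    then show "word_act p u \<omega> = ?f ?C"
      using B c \<omega> N(2) u by (simp add: class_act_mult class_act_pcl)
  qed
  then have "(\<lambda>u. word_act p u \<omega>) ` words X \<subseteq> ?f ` carrier (?G Mod N)" by blast
  then show ?thesis using fin by (rule finite_surj[rotated])
qed

end

lemma word_act_alt_even: "word_act p (alt_word a b (2 * k)) \<omega> = ((p b True \<circ> p a True) ^^ k) \<omega>"
  by (induction k arbitrary: \<omega>) (simp_all add: funpow_swap1)

lemma alt_word_closed: "a \<in> X \<Longrightarrow> b \<in> X \<Longrightarrow> alt_word a b n \<in> words X"
  by (induction n arbitrary: a b) auto

text \<open>
  With labels \<open>2 (r + 1)\<close> and \<open>2 (P - r + 1)\<close> at \<open>z\<close> the Coxeter group acts transitively on the
  integers: \<open>z\<close> swaps \<open>2 i\<close> and \<open>2 i + 1\<close>, and the remaining edges of the line are given, periodically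
  with period \<open>P\<close>, \<open>r\<close> times to \<open>s\<close> and then \<open>P - r\<close> times to \<open>t\<close>. A maximal block of \<open>s\<close>-edges
  with its adjacent \<open>z\<close>-edges is a path on \<open>2 (r + 1)\<close> vertices, on which \<open>z s\<close> acts as a single cycle.
\<close>

definition zswap :: "int \<Rightarrow> int" where
  "zswap x = (if even x then x + 1 else x - 1)"

definition xswap :: "int \<Rightarrow> int" where
  "xswap x = (if odd x then x + 1 else x - 1)"

text \<open>Edge number i joins 2 i + 1 and 2 i + 2, so (x - 1) div 2 is the number of the edge at x
  that does not belong to \<open>z\<close>; \<open>c\<close> is the number at which a block
  starts.\<close>

definition run :: "int \<Rightarrow> int \<Rightarrow> int \<Rightarrow> int \<Rightarrow> int" where
  "run c r P x = (if ((x - 1) div 2 - c) mod P < r then xswap x else x)"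

lemma zswap_zswap [simp]: "zswap (zswap x) = x"
  by (simp add: zswap_def)

lemma xswap_xswap [simp]: "xswap (xswap x) = x"
  by (simp add: xswap_def)

lemma xswap_edge [simp]: "(xswap x - 1) div 2 = (x - 1) div 2"
  unfolding xswap_def by presburger

lemma run_run [simp]: "run c r P (run c r P x) = x"
  by (simp add: run_def)

lemma mod_diff_complement:
  fixes e r P :: int
  assumes "0 \<le> r" "r \<le> P" "0 < P"
  shows "(e - r) mod P < P - r \<longleftrightarrow> \<not> e mod P < r"
proof (cases "e mod P < r")
  case True
  have "(e - r) mod P = (e mod P - r + P) mod P"
    by (metis mod_add_self2 mod_diff_left_eq)
  also have "\<dots> = e mod P - r + P"
    using True assms pos_mod_sign[of P e] by (intro mod_pos_pos_trivial) linarith+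
  finally show ?thesis using True assms pos_mod_sign[OF assms(3), of e] by simp
next
  case False
  have "(e - r) mod P = (e mod P - r) mod P" by (simp add: mod_diff_left_eq)
  also have "\<dots> = e mod P - r"
    using False assms pos_mod_bound[OF assms(3), of e] by (intro mod_pos_pos_trivial) linarith+
  finally show ?thesis using False pos_mod_bound[OF assms(3), of e] by simp
qed

lemma run_complement:
  assumes "0 \<le> r" "r \<le> P" "0 < P"
  shows "run r (P - r) P x = (if ((x - 1) div 2) mod P < r then x else xswap x)"
  using mod_diff_complement[OF assms, of "(x - 1) div 2"] by (simp add: run_def)

text \<open>Each of these edges lies in exactly one of the two runs, so the composite in either
  order swaps all of them. Hence \<open>s\<close> and \<open>t\<close> commute, and their braid
  relation holds whatever the label.\<close>

lemma run_comp_complement: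
  assumes "0 \<le> r" "r \<le> P" "0 < P"
  shows "run r (P - r) P \<circ> run 0 r P = xswap" "run 0 r P \<circ> run r (P - r) P = xswap"
  by (auto simp: fun_eq_iff run_complement[OF assms]) (auto simp: run_def)

context
  fixes c P :: int and r :: nat
  assumes rP: "int r < P"
begin

private abbreviation "y \<equiv> zswap \<circ> run c (int r) P"

text \<open>Block \<open>q\<close> consists of the cells {2 n, 2 n + 1} with n from c + q P to c + q
  P + r. Odd points travel right cell by cell and turn into even ones in the last cell; even points
  travel left and turn in the first cell (\<open>y_even\<close>).\<close>

private lemma y_odd:
  assumes "l \<le> r"
  shows "y (2 * (c + q * P + int l) + 1) =
    (if l < r then 2 * (c + q * P + int (Suc l)) + 1 else 2 * (c + q * P + int l))"
proof -
  have "(int l + q * P) mod P = int l" using assms rP by simp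
  then have "(q * P + int l) mod P = int l" by (simp only: add.commute)
  then show ?thesis using assms by (auto simp: run_def xswap_def zswap_def)
qed

private lemma y_even:
  assumes "l \<le> r"
  shows "y (2 * (c + q * P + int l)) =
    (if l > 0 then 2 * (c + q * P + int (l - 1)) else 2 * (c + q * P) + 1)"
proof -
  have e: "(2 * (c + q * P + int l) - 1) div 2 - c = (int l - 1) + q * P" by presburger
  show ?thesis
  proof (cases "l > 0")
    case True
    then have "((int l - 1) + q * P) mod P = int l - 1" using assms rP by simp
    then show ?thesis using True assms unfolding comp_apply run_def e xswap_def zswap_def by simp
  next
    case False
    then have m: "((int l - 1) + q * P) mod P = P - 1" using rP zmod_minus1[of P] mod_mult_self1[of "- 1" q P] by simp
    have "run c (int r) P (2 * (c + q * P + int l)) = 2 * (c + q * P + int l)"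
      unfolding run_def e m using rP by simp
    then show ?thesis using False by (simp add: zswap_def)
  qed
qed

private lemma y_odd_funpow:
  "l + n \<le> r \<Longrightarrow> (y ^^ n) (2 * (c + q * P + int l) + 1) = 2 * (c + q * P + int (l + n)) + 1"
proof (induction n)
  case (Suc n)
  have "(y ^^ Suc n) (2 * (c + q * P + int l) + 1) = y (2 * (c + q * P + int (l + n)) + 1)"
  proof -
    have IH: "(y ^^ n) (2 * (c + q * P + int l) + 1) = 2 * (c + q * P + int (l + n)) + 1"
      by (rule Suc.IH) (use Suc.prems in simp)
    have "(y ^^ Suc n) w = y ((y ^^ n) w)" for w by simp
    then show ?thesis by (simp only: IH)
  qed
  also have "\<dots> = 2 * (c + q * P + int (l + Suc n)) + 1"
    using Suc.prems y_odd[of "l + n" q] by simp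
  finally show ?case .
qed simp

private lemma y_even_funpow:
  "n \<le> l \<Longrightarrow> l \<le> r \<Longrightarrow> (y ^^ n) (2 * (c + q * P + int l)) = 2 * (c + q * P + int (l - n))"
proof (induction n)
  case (Suc n)
  have "(y ^^ Suc n) (2 * (c + q * P + int l)) = y (2 * (c + q * P + int (l - n)))"
  proof -
    have IH: "(y ^^ n) (2 * (c + q * P + int l)) = 2 * (c + q * P + int (l - n))"
      by (rule Suc.IH) (use Suc.prems in simp_all)
    have "(y ^^ Suc n) w = y ((y ^^ n) w)" for w by simp
    then show ?thesis by (simp only: IH)
  qed
  also have "\<dots> = 2 * (c + q * P + int (l - Suc n))"
    using Suc.prems y_even[of "l - n" q] by simp
  finally show ?case .
qed simp

text \<open>Half a turn around the cycle of length 2 (r + 1) leads to the opposite point;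
  \<open>y_even_full\<close> is the other half.\<close>

private lemma y_odd_full:
  assumes "l \<le> r"
  shows "(y ^^ Suc r) (2 * (c + q * P + int l) + 1) = 2 * (c + q * P + int (r - l))"
proof -
  have "Suc r = l + Suc (r - l)" using assms by simp
  then have "(y ^^ Suc r) (2 * (c + q * P + int l) + 1) =
      (y ^^ l) (y ((y ^^ (r - l)) (2 * (c + q * P + int l) + 1)))"
    by (simp only: funpow_add comp_apply funpow.simps)
  also have "\<dots> = (y ^^ l) (y (2 * (c + q * P + int r) + 1))"
    using assms y_odd_funpow[of l "r - l" q] by simp
  also have "\<dots> = (y ^^ l) (2 * (c + q * P + int r))"
    using y_odd[of r q] by simp
  also have "\<dots> = 2 * (c + q * P + int (r - l))"
    using assms y_even_funpow[of l r q] by simp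
  finally show ?thesis .
qed

private lemma y_even_full:
  assumes "l \<le> r"
  shows "(y ^^ Suc r) (2 * (c + q * P + int l)) = 2 * (c + q * P + int (r - l)) + 1"
proof -
  have "Suc r = (r - l) + Suc l" using assms by simp
  then have "(y ^^ Suc r) (2 * (c + q * P + int l)) =
      (y ^^ (r - l)) (y ((y ^^ l) (2 * (c + q * P + int l))))"
    by (simp only: funpow_add comp_apply funpow.simps)
  also have "\<dots> = (y ^^ (r - l)) (y (2 * (c + q * P + int 0)))"
    using assms y_even_funpow[of l l q] by simp
  also have "\<dots> = (y ^^ (r - l)) (2 * (c + q * P + int 0) + 1)"
    using y_even[of 0 q] by simp
  also have "\<dots> = 2 * (c + q * P + int (r - l)) + 1"
    using assms y_odd_funpow[of 0 "r - l" q] by simp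
  finally show ?thesis .
qed

lemma zswap_run_period: "((zswap \<circ> run c (int r) P) ^^ (2 * Suc r)) x = x"
proof -
  define u where "u = x div 2 - c"
  define l where "l = nat (u mod P)"
  have P: "0 < P" using rP by simp
  define q where "q = u div P"
  have u: "u = q * P + int l" using P by (simp add: l_def q_def)
  have dbl: "(y ^^ (2 * Suc r)) x = (y ^^ Suc r) ((y ^^ Suc r) x)" for x
    by (simp only: mult_2 funpow_add comp_apply)
  show ?thesis
  proof (cases "l \<le> r")
    case True
    show ?thesis
    proof (cases "even x")
      case even: True
      then have "x = 2 * (c + u)" by (simp add: u_def)
      then have "x = 2 * (c + q * P + int l)" by (simp add: u)
      then show ?thesis using True by (simp only: dbl y_even_full y_odd_full diff_le_self diff_diff_cancel)
    next
      case False
      then have "x = 2 * (c + u) + 1" by (simp add: u_def)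
      then have "x = 2 * (c + q * P + int l) + 1" by (simp add: u)
      then show ?thesis using True by (simp only: dbl y_even_full y_odd_full diff_le_self diff_diff_cancel)
    qed
  next
    case False
    then have m: "int r < u mod P" using P by (simp add: l_def)
    have m': "(u - 1) mod P = u mod P - 1"
    proof -
      have "(u - 1) mod P = (u mod P - 1) mod P" by (simp add: mod_diff_left_eq)
      also have "\<dots> = u mod P - 1" using m P pos_mod_bound[OF P, of u] by (intro mod_pos_pos_trivial) linarith+
      finally show ?thesis .
    qed
    \<comment> \<open>Both edges at the cell of \<open>x\<close> lie outside the run, so
      \<open>y\<close> is \<open>zswap\<close> there, an involution, and the exponent is
      even.\<close>
    have fix_run: "run c (int r) P w = w" if "w div 2 - c = u" for w
    proof -
      have "(w - 1) div 2 - c = u \<or> (w - 1) div 2 - c = u - 1" using that by presburger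
      then show ?thesis using m m' by (auto simp: run_def)
    qed
    have "zswap x div 2 = x div 2" unfolding zswap_def by presburger
    then have "y (y x) = x" using fix_run[of x] fix_run[of "zswap x"] by (simp add: u_def)
    then have "(y ^^ (n * 2)) x = x" for n by (induction n) (simp_all add: numeral_2_eq_2)
    then show ?thesis by (simp only: mult.commute)
  qed
qed

end

text \<open>For involutions (g f)^k undoes (f g)^k; if (f g)^(2 k) is trivial, then (f g)^k undoes
  itself as well.\<close>

lemma involution_braid:
  assumes "\<And>x. f (f x) = x" "\<And>x. g (g x) = x" "\<And>x. ((f \<circ> g) ^^ (2 * k)) x = x"
  shows "((f \<circ> g) ^^ k) x = ((g \<circ> f) ^^ k) x"
proof -
  have cancel: "((g \<circ> f) ^^ k) (((f \<circ> g) ^^ k) x) = x" for k x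
  proof (induction k arbitrary: x)
    case (Suc k)
    have "((g \<circ> f) ^^ Suc k) (((f \<circ> g) ^^ Suc k) x) =
        ((g \<circ> f) ^^ k) ((g \<circ> f) ((f \<circ> g) (((f \<circ> g) ^^ k) x)))"
      by (simp only: funpow_Suc_right[of k "g \<circ> f"] funpow.simps(2)[of k "f \<circ> g"]
          comp_apply[of "(g \<circ> f) ^^ k"] comp_apply[of "f \<circ> g"])
    also have "(g \<circ> f) ((f \<circ> g) (((f \<circ> g) ^^ k) x)) = ((f \<circ> g) ^^ k) x"
      using assms(1,2) by simp
    finally show ?case by (simp only: Suc)
  qed simp
  have "((f \<circ> g) ^^ k) (((f \<circ> g) ^^ k) x) = x"
    using assms(3)[of x] by (simp only: mult_2 funpow_add comp_apply)
  then show ?thesis using cancel[of k "((f \<circ> g) ^^ k) x"] by simp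
qed

lemma infinite_coxeter_triangle:
  fixes m :: "'a \<Rightarrow> 'a \<Rightarrow> enat"
  assumes d: "z \<noteq> s" "z \<noteq> t" "s \<noteq> t"
    and sym: "m s z = m z s" "m t z = m z t" "m t s = m s t"
    and lab: "m z s = enat (2 * a)" "m z t = enat (2 * b)" "m s t = enat (2 * n)"
    and ab: "a \<ge> 2" "b \<ge> 2"
  shows "\<not> spherical_type {z, s, t} m"
proof
  let ?T = "{z, s, t}"
  \<comment> \<open>The labels are 2 a = 2 (r + 1) and 2 b = 2 (r' + 1). As a, b \<ge> 2, both runs
    are nonempty, hence both are shorter than the period.\<close>
  define r r' where "r = a - 1" and "r' = b - 1"
  define P where "P = int r + int r'"
  \<comment> \<open>The sign \<open>w\<close> is ignored since generators act by involutions; this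
    is also why the action factors through the Coxeter group.\<close>
  define p where "p x (w::bool) = (if x = z then zswap else if x = s then run 0 (int r) P
    else run (int r) (int r') P)" for x w
  have P: "0 \<le> int r" "int r \<le> P" "0 < P" "P - int r = int r'" "int r < P" "int r' < P"
    using ab by (auto simp: P_def r_def r'_def)
  have ps: "p z w = zswap" "p s w = run 0 (int r) P" "p t w = run (int r) (int r') P" for w
    using d by (auto simp: p_def)
  have zs: "((zswap \<circ> run 0 (int r) P) ^^ a) x = ((run 0 (int r) P \<circ> zswap) ^^ a) x" for x
    using zswap_run_period[OF P(5), of 0] ab by (intro involution_braid) (simp_all add: r_def)
  have zt: "((zswap \<circ> run (int r) (int r') P) ^^ b) x = ((run (int r) (int r') P \<circ> zswap) ^^ b) x" for x
    using zswap_run_period[OF P(6), of "int r"] ab by (intro involution_braid) (simp_all add: r'_def)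
  have st: "run (int r) (int r') P \<circ> run 0 (int r) P = run 0 (int r) P \<circ> run (int r) (int r') P"
    using run_comp_complement[OF P(1-3)] P(4) by simp
  interpret word_action ?T "artin_relations ?T m" UNIV p
  proof
    show "p x (\<not> w) (p x w \<omega>) = \<omega>" for x w \<omega> by (simp add: p_def)
    fix u v \<omega> assume "(u, v) \<in> artin_relations ?T m"
    then obtain g h k where gh: "u = alt_word g h k" "v = alt_word h g k" "g \<in> ?T" "h \<in> ?T"
      "g \<noteq> h" "m g h = enat k"
      by (auto simp: artin_relations_def)
    show "word_act p u \<omega> = word_act p v \<omega>"
      using gh d sym lab zs[of \<omega>] zt[of \<omega>] st by (auto simp: word_act_alt_even ps)
  qed simp
  let ?G = "artin_group ?T m"
  let ?Q = "{artin_gen ?T m g \<otimes>\<^bsub>?G\<^esub> artin_gen ?T m g | g. g \<in> ?T}"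
  let ?N = "normal_closure ?G ?Q"
  interpret G: group ?G unfolding artin_group_def by (rule group_presented_group)
  have gen: "artin_gen ?T m g \<in> carrier ?G" if "g \<in> ?T" for g
    unfolding artin_gen_def artin_group_def using that by (rule pres_gen_closed)
  assume "spherical_type ?T m"
  then have fin: "finite (carrier (?G Mod ?N))"
    by (simp add: spherical_type_def coxeter_group_def)
  have nor: "?N \<lhd> ?G" using gen by (intro G.normal_normal_closure) auto
  have stab: "class_act A \<omega> = \<omega>" if "A \<in> ?N" for A \<omega>
  proof -
    \<comment> \<open>The pointwise stabilizer is normal, so containing the squares it contains
      their normal closure.\<close>
    have "?Q \<subseteq> {A \<in> carrier ?G. \<forall>\<omega>\<in>UNIV. class_act A \<omega> = \<omega>}"
    proof
      fix A assume "A \<in> ?Q"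
      then obtain g where g: "g \<in> ?T" "A = artin_gen ?T m g \<otimes>\<^bsub>?G\<^esub> artin_gen ?T m g" by blast
      have "A \<in> carrier ?G" using gen[OF g(1)] g(2) by simp
      moreover have "class_act A \<omega> = \<omega>" for \<omega>
        using g(1) gen[OF g(1)] unfolding g(2) artin_group_def artin_gen_def
        by (simp only: class_act_mult class_act_gen UNIV_I pres_gen_closed) (simp add: p_def)
      ultimately show "A \<in> {A \<in> carrier ?G. \<forall>\<omega>\<in>UNIV. class_act A \<omega> = \<omega>}" by blast
    qed
    then have "?N \<subseteq> {A \<in> carrier ?G. \<forall>\<omega>\<in>UNIV. class_act A \<omega> = \<omega>}"
      using normal_pointwise_stabilizer unfolding normal_closure_def artin_group_def by blast
    then show ?thesis using that by blast
  qed
  have reach: "\<exists>u\<in>words ?T. word_act p u 0 = int k" for k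
  proof (induction k)
    case 0
    show ?case by (intro bexI[of _ "[]"]) auto
  next
    case (Suc k)
    then obtain u where u: "u \<in> words ?T" "word_act p u 0 = int k" by blast
    \<comment> \<open>From an even point \<open>z\<close> steps to the right; from an odd point one
      of \<open>s\<close>, \<open>t\<close> does, namely the one whose run contains the
      edge.\<close>
    have "\<exists>g\<in>?T. p g True (int k) = int (Suc k)"
    proof (cases "even k")
      case True
      then show ?thesis by (intro bexI[of _ z]) (auto simp: ps zswap_def)
    next
      case False
      then have "xswap (int k) = int (Suc k)" by (simp add: xswap_def)
      then have "p s True (int k) = int (Suc k) \<or> p t True (int k) = int (Suc k)"
        using run_complement[OF P(1-3), of "int k"] P(4) by (auto simp: ps run_def)
      then show ?thesis by blast
    qed
    then obtain g where "g \<in> ?T" "p g True (int k) = int (Suc k)" by blast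
    then show ?case using u by (intro bexI[of _ "u @ [(g, True)]"]) auto
  qed
  have "finite ((\<lambda>u. word_act p u 0) ` words ?T)"
    by (rule finite_orbit[of ?N]) (use nor fin stab in \<open>simp_all add: artin_group_def\<close>)
  moreover have "range int \<subseteq> (\<lambda>u. word_act p u 0) ` words ?T"
    using reach by (metis (no_types, lifting) image_eqI image_subsetI)
  ultimately have "finite (range int)" by (rule finite_subset[rotated])
  then show False using finite_imageD[of int UNIV] by (simp add: inj_of_nat)
qed

section \<open>Retractions between even Artin groups\<close>

abbreviation art :: "'a set \<Rightarrow> ('a \<Rightarrow> 'a \<Rightarrow> enat) \<Rightarrow> 'a word \<Rightarrow> 'a word set" where
  "art S m u \<equiv> pres_rel S (artin_relations S m) `` {u}"

lemma group_artin: "group (artin_group S m)"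
  unfolding artin_group_def by (rule group_presented_group)

lemma art_closed: "u \<in> words S \<Longrightarrow> art S m u \<in> carrier (artin_group S m)"
  unfolding artin_group_def by (rule pcl_closed)

lemma art_cases:
  assumes "A \<in> carrier (artin_group S m)"
  obtains u where "u \<in> words S" "A = art S m u"
  using assms unfolding artin_group_def by (rule pcl_cases)

lemma art_append:
  "u \<in> words S \<Longrightarrow> v \<in> words S \<Longrightarrow> art S m (u @ v) = art S m u \<otimes>\<^bsub>artin_group S m\<^esub> art S m v"
  unfolding artin_group_def by (rule pres_mult_class[symmetric])

lemma art_Nil: "art S m [] = \<one>\<^bsub>artin_group S m\<^esub>"
  unfolding artin_group_def by (rule one_presented_group[symmetric])

lemma artin_gen_closed: "x \<in> S \<Longrightarrow> artin_gen S m x \<in> carrier (artin_group S m)"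
  unfolding artin_group_def artin_gen_def by (rule pres_gen_closed)

lemma art_letter:
  "x \<in> S \<Longrightarrow> art S m [(x, b)] =
    (if b then artin_gen S m x else inv\<^bsub>artin_group S m\<^esub> (artin_gen S m x))"
  unfolding artin_group_def artin_gen_def by (simp add: inv_pres_gen) (simp add: pres_gen_def)

lemma words_mono: "T \<subseteq> S \<Longrightarrow> words T \<subseteq> words S"
  by (intro lists_mono) auto

lemma subgroup_art_words:
  assumes "T \<subseteq> S"
  shows "subgroup (art S m ` words T) (artin_group S m)"
proof -
  interpret group "artin_group S m" by (rule group_artin)
  have T: "words T \<subseteq> words S" using assms by (rule words_mono)
  show ?thesis
  proof (rule subgroupI)
    show "art S m ` words T \<subseteq> carrier (artin_group S m)" using T art_closed by blast
    show "art S m ` words T \<noteq> {}" using Nil by blast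
    fix A assume "A \<in> art S m ` words T"
    then obtain u where u: "u \<in> words T" "A = art S m u" by blast
    let ?v = "rev (map (map_prod id Not) u)"
    have v: "?v \<in> words T" using u(1) by (auto simp: in_lists_conv_set)
    have uv: "u \<in> words S" "?v \<in> words S" using u(1) v T by blast+
    have "art S m (?v @ u) = art S m []"
      using uv(1) by (intro equiv_class_eq[OF equiv_pres_rel] pres_inverse_word)
    then have "art S m ?v \<otimes>\<^bsub>artin_group S m\<^esub> A = \<one>\<^bsub>artin_group S m\<^esub>"
      unfolding u(2) art_append[OF uv(2,1)] art_Nil .
    then have "inv\<^bsub>artin_group S m\<^esub> A = art S m ?v"
      using uv u(2) by (intro inv_equality) (simp_all add: art_closed)
    then show "inv\<^bsub>artin_group S m\<^esub> A \<in> art S m ` words T" using v by blast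
    fix B assume "B \<in> art S m ` words T"
    then obtain w where w: "w \<in> words T" "B = art S m w" by blast
    then have "w \<in> words S" using T by blast
    then have eq: "A \<otimes>\<^bsub>artin_group S m\<^esub> B = art S m (u @ w)"
      unfolding u(2) w(2) by (rule art_append[OF uv(1), symmetric])
    have "u @ w \<in> words T" using u(1) w(1) by simp
    then show "A \<otimes>\<^bsub>artin_group S m\<^esub> B \<in> art S m ` words T"
      unfolding eq by (rule imageI)
  qed
qed

lemma art_alt_even:
  assumes "a \<in> S" "b \<in> S"
  shows "art S m (alt_word a b (2 * k)) =
    (artin_gen S m a \<otimes>\<^bsub>artin_group S m\<^esub> artin_gen S m b) [^]\<^bsub>artin_group S m\<^esub> k"
proof (induction k)
  case 0
  interpret group "artin_group S m" by (rule group_artin)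
  show ?case by (simp add: art_Nil)
next
  case (Suc k)
  interpret group "artin_group S m" by (rule group_artin)
  have "art S m ([(a, True)] @ [(b, True)] @ alt_word a b (2 * k)) =
      artin_gen S m a \<otimes>\<^bsub>artin_group S m\<^esub> (artin_gen S m b \<otimes>\<^bsub>artin_group S m\<^esub> art S m (alt_word a b (2 * k)))"
    using assms alt_word_closed[OF assms, of "2 * k"] art_letter[of _ S m True]
    by (simp del: append.simps add: art_append)
  then show ?case
    using assms by (simp add: Suc.IH artin_gen_closed m_assoc[symmetric] nat_pow_Suc2[symmetric] del: nat_pow_Suc)
qed

lemma artin_braid:
  assumes "a \<in> S" "b \<in> S" "a \<noteq> b" "m a b = enat (2 * k)"
  shows "(artin_gen S m a \<otimes>\<^bsub>artin_group S m\<^esub> artin_gen S m b) [^]\<^bsub>artin_group S m\<^esub> k =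
    (artin_gen S m b \<otimes>\<^bsub>artin_group S m\<^esub> artin_gen S m a) [^]\<^bsub>artin_group S m\<^esub> k"
proof -
  have "([] @ alt_word a b (2 * k) @ [], [] @ alt_word b a (2 * k) @ []) \<in> pres_rel S (artin_relations S m)"
    using assms by (intro pres_rel.relator alt_word_closed) (auto simp: artin_relations_def)
  then have "art S m (alt_word a b (2 * k)) = art S m (alt_word b a (2 * k))"
    by (simp add: equiv_class_eq[OF equiv_pres_rel])
  then show ?thesis using assms by (simp add: art_alt_even)
qed

abbreviation restrict_word :: "'a set \<Rightarrow> 'a word \<Rightarrow> 'a word" where
  "restrict_word T \<equiv> filter (\<lambda>x. fst x \<in> T)"

lemma restrict_word_closed: "u \<in> words S \<Longrightarrow> restrict_word T u \<in> words (S \<inter> T)"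
  by (induction u) auto

lemma restrict_word_id: "u \<in> words T \<Longrightarrow> restrict_word T u = u"
  by (induction u) auto

text \<open>This is where evenness gives retractions: both alternating words carry \<open>k\<close>
  copies of each letter, so if at most one of the two letters survives, both become the same power
  of it.\<close>

lemma restrict_alt_word:
  "a \<in> T \<Longrightarrow> b \<notin> T \<Longrightarrow> restrict_word T (alt_word a b (2 * k)) = replicate k (a, True)"
  "a \<notin> T \<Longrightarrow> b \<in> T \<Longrightarrow> restrict_word T (alt_word a b (2 * k)) = replicate k (b, True)"
  "a \<notin> T \<Longrightarrow> b \<notin> T \<Longrightarrow> restrict_word T (alt_word a b (2 * k)) = []"
  by (induction k) auto

lemma artin_relations_mono: "T \<subseteq> S \<Longrightarrow> artin_relations T m \<subseteq> artin_relations S m"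
  unfolding artin_relations_def by blast

lemma pres_rel_artin_mono:
  assumes "(u, v) \<in> pres_rel T (artin_relations T m)" "T \<subseteq> S"
  shows "(u, v) \<in> pres_rel S (artin_relations S m)"
proof -
  have T: "words T \<subseteq> words S" using assms(2) by (rule words_mono)
  show ?thesis
    using assms(1)
  proof (induction rule: pres_rel.induct)
    case (cancel u v x b)
    then show ?case using T assms(2) by (intro pres_rel.cancel) auto
  next
    case (relator r s u v)
    then show ?case using T artin_relations_mono[OF assms(2)] by (intro pres_rel.relator) auto
  qed (use T in \<open>blast intro: pres_rel.intros\<close>)+
qed

locale even_artin =
  fixes S :: "'a set" and m :: "'a \<Rightarrow> 'a \<Rightarrow> enat"
  assumes coxeter: "coxeter_matrix S m" and even: "even_type S m"
begin

lemma sym: "s \<in> S \<Longrightarrow> t \<in> S \<Longrightarrow> m s t = m t s"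
  using coxeter by (cases "s = t") (auto simp: coxeter_matrix_def)

lemma label_cases:
  assumes "s \<in> S" "t \<in> S" "s \<noteq> t"
  obtains "m s t = \<infinity>" | k where "k \<ge> 1" "m s t = enat (2 * k)"
proof (cases "m s t = \<infinity>")
  case False
  then obtain n where n: "m s t = enat n" "even n"
    using even[unfolded even_type_def, rule_format, OF assms] False by auto
  have "enat 2 \<le> enat n"
    using coxeter assms unfolding coxeter_matrix_def n(1)[symmetric] by (simp add: numeral_eq_enat)
  then have "n \<ge> 2" by simp
  then show ?thesis using n that by (auto elim!: evenE)
qed (rule that)

lemma subset: "T \<subseteq> S \<Longrightarrow> even_artin T m"
  using coxeter even unfolding even_artin_def coxeter_matrix_def even_type_def
  by (intro conjI ballI impI) (simp_all add: subset_iff)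

lemma restrict_pres_rel:
  assumes "(u, v) \<in> pres_rel S (artin_relations S m)" "T \<subseteq> S"
  shows "(restrict_word T u, restrict_word T v) \<in> pres_rel T (artin_relations T m)"
proof -
  have ST: "S \<inter> T = T" using assms(2) by blast
  have c: "restrict_word T u \<in> words T" if "u \<in> words S" for u
    using restrict_word_closed[OF that, of T] by (simp add: ST)
  show ?thesis
    using assms(1)
  proof (induction rule: pres_rel.induct)
    case (refl u)
    then show ?case by (intro pres_rel.refl c)
  next
    case (cancel u v x b)
    show ?case
    proof (cases "x \<in> T")
      case True
      then show ?thesis using pres_rel.cancel[of "restrict_word T u" T "restrict_word T v" x b] c cancel by simp
    next
      case False
      then show ?thesis using c[of "u @ v"] cancel by (auto intro: pres_rel.refl)
    qed
  next
    case (relator r s u v)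
    then obtain a b n where ab: "a \<in> S" "b \<in> S" "a \<noteq> b" "m a b = enat n"
      "r = alt_word a b n" "s = alt_word b a n" by (auto simp: artin_relations_def)
    then obtain k where k: "n = 2 * k" by (cases rule: label_cases[OF ab(1-3)]) auto
    show ?case
    proof (cases "a \<in> T \<and> b \<in> T")
      case True
      then have w: "r \<in> words T" "s \<in> words T" using ab by (auto intro: alt_word_closed)
      moreover have "(r, s) \<in> artin_relations T m" using True ab by (auto simp: artin_relations_def)
      ultimately show ?thesis
        using pres_rel.relator[of r s "artin_relations T m" T "restrict_word T u" "restrict_word T v"]
          c relator by (simp add: restrict_word_id)
    next
      case False
      then have "restrict_word T r = restrict_word T s"
        unfolding ab k by (cases "a \<in> T"; cases "b \<in> T") (simp_all add: restrict_alt_word)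
      then show ?thesis using c[of "u @ r @ v"] relator by (auto intro: pres_rel.refl)
    qed
  qed (blast intro: pres_rel.intros)+
qed

end

definition artin_retract :: "'a set \<Rightarrow> ('a \<Rightarrow> 'a \<Rightarrow> enat) \<Rightarrow> 'a word set \<Rightarrow> 'a word set" where
  "artin_retract T m A = art T m (restrict_word T (SOME u. u \<in> A))"

definition artin_incl :: "'a set \<Rightarrow> ('a \<Rightarrow> 'a \<Rightarrow> enat) \<Rightarrow> 'a word set \<Rightarrow> 'a word set" where
  "artin_incl S m A = art S m (SOME u. u \<in> A)"

lemma some_art:
  assumes "u \<in> words S"
  shows "(u, SOME v. v \<in> art S m u) \<in> pres_rel S (artin_relations S m)"
proof -
  have "u \<in> art S m u" using assms by (simp add: pres_rel.refl)
  then have "(SOME v. v \<in> art S m u) \<in> art S m u" by (rule someI)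
  then show ?thesis by (simp only: Image_singleton_iff)
qed

lemma artin_incl_art:
  assumes "T \<subseteq> S" "u \<in> words T"
  shows "artin_incl S m (art T m u) = art S m u"
  using pres_rel_artin_mono[OF some_art[OF assms(2)] assms(1)] unfolding artin_incl_def
  by (rule equiv_class_eq[OF equiv_pres_rel, symmetric])

lemma artin_incl_hom:
  assumes "T \<subseteq> S"
  shows "artin_incl S m \<in> hom (artin_group T m) (artin_group S m)"
proof (rule homI)
  have T: "words T \<subseteq> words S" using assms by (rule words_mono)
  fix A assume "A \<in> carrier (artin_group T m)"
  then obtain u where u: "u \<in> words T" "A = art T m u" by (rule art_cases)
  then show "artin_incl S m A \<in> carrier (artin_group S m)"
    using T assms by (auto simp: artin_incl_art intro!: art_closed)
  fix B assume "B \<in> carrier (artin_group T m)"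
  then obtain v where v: "v \<in> words T" "B = art T m v" by (rule art_cases)
  have "u @ v \<in> words T" using u v by simp
  then have "artin_incl S m (art T m (u @ v)) = art S m (u @ v)"
    using assms by (rule artin_incl_art[rotated])
  moreover have "u \<in> words S" "v \<in> words S" using u v T by auto
  ultimately show "artin_incl S m (A \<otimes>\<^bsub>artin_group T m\<^esub> B) =
      artin_incl S m A \<otimes>\<^bsub>artin_group S m\<^esub> artin_incl S m B"
    using u v by (simp add: art_append[symmetric] artin_incl_art[OF assms])
qed

lemma artin_incl_gen: "T \<subseteq> S \<Longrightarrow> x \<in> T \<Longrightarrow> artin_incl S m (artin_gen T m x) = artin_gen S m x"
  using artin_incl_art[of T S "[(x, True)]" m] by (simp add: artin_gen_def pres_gen_def)

context even_artin
begin

lemma artin_retract_art: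
  assumes "T \<subseteq> S" "u \<in> words S"
  shows "artin_retract T m (art S m u) = art T m (restrict_word T u)"
  using restrict_pres_rel[OF some_art[OF assms(2)] assms(1)] unfolding artin_retract_def
  by (rule equiv_class_eq[OF equiv_pres_rel, symmetric])

lemma artin_retract_hom:
  assumes "T \<subseteq> S"
  shows "artin_retract T m \<in> hom (artin_group S m) (artin_group T m)"
proof (rule homI)
  have ST: "S \<inter> T = T" using assms by blast
  have c: "restrict_word T u \<in> words T" if "u \<in> words S" for u
    using restrict_word_closed[OF that, of T] by (simp add: ST)
  fix A assume "A \<in> carrier (artin_group S m)"
  then obtain u where u: "u \<in> words S" "A = art S m u" by (rule art_cases)
  then show "artin_retract T m A \<in> carrier (artin_group T m)"
    using c assms by (auto simp: artin_retract_art intro!: art_closed)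
  fix B assume "B \<in> carrier (artin_group S m)"
  then obtain v where v: "v \<in> words S" "B = art S m v" by (rule art_cases)
  have "u @ v \<in> words S" using u v by simp
  then have "artin_retract T m (art S m (u @ v)) = art T m (restrict_word T (u @ v))"
    using assms by (rule artin_retract_art[rotated])
  then show "artin_retract T m (A \<otimes>\<^bsub>artin_group S m\<^esub> B) =
      artin_retract T m A \<otimes>\<^bsub>artin_group T m\<^esub> artin_retract T m B"
    using u v c by (simp add: art_append[symmetric] artin_retract_art[OF assms])
qed

lemma artin_retract_gen:
  "T \<subseteq> S \<Longrightarrow> x \<in> S \<Longrightarrow> artin_retract T m (artin_gen S m x) =
    (if x \<in> T then artin_gen T m x else \<one>\<^bsub>artin_group T m\<^esub>)"
  using artin_retract_art[of T "[(x, True)]"] art_Nil[of T m] by (simp add: artin_gen_def pres_gen_def)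

text \<open>Splits the map induced by the inclusion of \<open>T\<close>, which is therefore
  injective.\<close>

lemma artin_retract_incl:
  assumes "T \<subseteq> S" "A \<in> carrier (artin_group T m)"
  shows "artin_retract T m (artin_incl S m A) = A"
proof -
  obtain u where u: "u \<in> words T" "A = art T m u" using assms(2) by (rule art_cases)
  moreover have "u \<in> words S" using u(1) words_mono[OF assms(1)] by blast
  ultimately show ?thesis
    using assms(1) by (simp add: artin_incl_art artin_retract_art restrict_word_id)
qed

end

lemma hom_closedI: "h \<in> hom G H \<Longrightarrow> x \<in> carrier G \<Longrightarrow> h x \<in> carrier H"
  by (auto simp: hom_def)

section \<open>The kernel of killing one vertex\<close>

locale artin_kill = even_artin +
  fixes z :: 'a
  assumes z: "z \<in> S"
begin

definition "T = S - {z}"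
definition "G = artin_group S m"
definition "P = artin_group T m"
definition "gen = artin_gen S m"
definition "pgen = artin_gen T m"
definition "\<pi> = artin_retract T m"
definition "\<iota> = artin_incl S m"

lemma TS: "T \<subseteq> S" by (auto simp: T_def)

sublocale G: group G unfolding G_def by (rule group_artin)
sublocale P: group P unfolding P_def by (rule group_artin)
sublocale \<pi>: group_hom G P \<pi>
  unfolding group_hom_def group_hom_axioms_def \<pi>_def
  using artin_retract_hom[OF TS] G.is_group P.is_group by (simp add: G_def P_def)
sublocale \<iota>: group_hom P G \<iota>
  unfolding group_hom_def group_hom_axioms_def \<iota>_def
  using artin_incl_hom[OF TS] G.is_group P.is_group by (simp add: G_def P_def)

lemma \<pi>_\<iota>: "A \<in> carrier P \<Longrightarrow> \<pi> (\<iota> A) = A"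
  unfolding \<pi>_def \<iota>_def P_def by (rule artin_retract_incl[OF TS])

lemma gen_closed [simp]: "x \<in> S \<Longrightarrow> gen x \<in> carrier G"
  unfolding gen_def G_def by (rule artin_gen_closed)

lemma pgen_closed [simp]: "x \<in> T \<Longrightarrow> pgen x \<in> carrier P"
  unfolding pgen_def P_def by (rule artin_gen_closed)

lemma \<iota>_pgen: "x \<in> T \<Longrightarrow> \<iota> (pgen x) = gen x"
  unfolding \<iota>_def pgen_def gen_def by (rule artin_incl_gen[OF TS])

lemma \<pi>_gen: "x \<in> T \<Longrightarrow> \<pi> (gen x) = pgen x" "\<pi> (gen z) = \<one>\<^bsub>P\<^esub>"
  unfolding \<pi>_def pgen_def gen_def P_def using artin_retract_gen[OF TS] z
  by (auto simp: T_def)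

definition conj :: "'a word set \<Rightarrow> 'a word set" where
  "conj g = \<iota> g \<otimes>\<^bsub>G\<^esub> gen z \<otimes>\<^bsub>G\<^esub> inv\<^bsub>G\<^esub> (\<iota> g)"

lemma conj_closed [simp]: "g \<in> carrier P \<Longrightarrow> conj g \<in> carrier G"
  using z by (simp add: conj_def)

lemma conj_kernel: "g \<in> carrier P \<Longrightarrow> conj g \<in> kernel G P \<pi>"
  using z by (simp add: kernel_def conj_def \<pi>_\<iota> \<pi>_gen)

text \<open>
  The condition on the images of the generators \<open>conj g\<close> under which they define a homomorphism on
  the kernel; that it suffices is \<open>compatible_hom\<close>.
\<close>

definition compatible :: "('h, 'r) monoid_scheme \<Rightarrow> ('a word set \<Rightarrow> 'h) \<Rightarrow> bool" where
  "compatible H \<zeta> \<longleftrightarrow> (\<forall>g\<in>carrier P. \<zeta> g \<in> carrier H) \<and>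
    (\<forall>t\<in>T. \<forall>k. m z t = enat (2 * k) \<longrightarrow> (\<forall>g\<in>carrier P.
      gprod H (\<lambda>j. \<zeta> (g \<otimes>\<^bsub>P\<^esub> pgen t [^]\<^bsub>P\<^esub> j)) k =
      gprod H (\<lambda>j. \<zeta> (g \<otimes>\<^bsub>P\<^esub> pgen t [^]\<^bsub>P\<^esub> Suc j)) k))"

text \<open>Telescoping: each inverse power meets the next power and leaves one \<open>b\<close>.
  Both products end in the inverse of b^k, so comparing them means comparing (a b)^k with (b
  a)^k.\<close>

lemma (in group) gprod_conj_pow:
  assumes a: "a \<in> carrier G" and b: "b \<in> carrier G"
  shows "gprod G (\<lambda>j. b [^] j \<otimes> a \<otimes> inv (b [^] j)) k = (a \<otimes> b) [^] k \<otimes> inv (b [^] k)"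
    and "gprod G (\<lambda>j. b [^] Suc j \<otimes> a \<otimes> inv (b [^] Suc j)) k = (b \<otimes> a) [^] k \<otimes> inv (b [^] k)"
proof (induction k)
  case (Suc k)
  have c: "b [^] k \<in> carrier G" "(a \<otimes> b) [^] k \<in> carrier G" "(b \<otimes> a) [^] k \<in> carrier G"
    using a b by auto
  case 1
  show ?case using Suc c a b by (simp add: inv_mult_group m_assoc inv_cancel_left)
  case 2
  have comm: "b [^] k \<otimes> b = b \<otimes> b [^] k" using b by (metis nat_pow_Suc nat_pow_Suc2)
  moreover have "inv b \<otimes> inv (b [^] k) = inv (b [^] k) \<otimes> inv b"
    using b c(1) inv_mult_group comm by metis
  ultimately show ?case using Suc c a b
    by (simp add: inv_mult_group m_assoc inv_cancel_left)
qed auto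

lemma compatible_conj: "compatible G conj"
  unfolding compatible_def
proof (intro conjI ballI allI impI)
  fix t k g assume t: "t \<in> T" and k: "m z t = enat (2 * k)" and g: "g \<in> carrier P"
  let ?b = "gen t" and ?a = "gen z" and ?h = "inv\<^bsub>G\<^esub> (\<iota> g)"
  have tS: "t \<in> S" "z \<noteq> t" using t by (auto simp: T_def)
  have c: "?b \<in> carrier G" "?a \<in> carrier G" "?h \<in> carrier G" "\<iota> g \<in> carrier G"
    using tS z g by auto
  have braid: "(?a \<otimes>\<^bsub>G\<^esub> ?b) [^]\<^bsub>G\<^esub> k = (?b \<otimes>\<^bsub>G\<^esub> ?a) [^]\<^bsub>G\<^esub> k"
    unfolding gen_def G_def using z tS k by (intro artin_braid)
  \<comment> \<open>Written with the inverse \<open>?h\<close> to match the form x^-1 f x of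
    \<open>gprod_conj\<close>.\<close>
  have e: "conj (g \<otimes>\<^bsub>P\<^esub> pgen t [^]\<^bsub>P\<^esub> j) =
      inv\<^bsub>G\<^esub> ?h \<otimes>\<^bsub>G\<^esub> (?b [^]\<^bsub>G\<^esub> j \<otimes>\<^bsub>G\<^esub> ?a \<otimes>\<^bsub>G\<^esub> inv\<^bsub>G\<^esub> (?b [^]\<^bsub>G\<^esub> j)) \<otimes>\<^bsub>G\<^esub> ?h" for j :: nat
    using c g t by (simp add: conj_def \<iota>.hom_nat_pow \<iota>_pgen G.inv_mult_group G.m_assoc del: G.nat_pow_Suc)
  have "gprod G (\<lambda>j. conj (g \<otimes>\<^bsub>P\<^esub> pgen t [^]\<^bsub>P\<^esub> j)) k =
      inv\<^bsub>G\<^esub> ?h \<otimes>\<^bsub>G\<^esub> gprod G (\<lambda>j. ?b [^]\<^bsub>G\<^esub> j \<otimes>\<^bsub>G\<^esub> ?a \<otimes>\<^bsub>G\<^esub> inv\<^bsub>G\<^esub> (?b [^]\<^bsub>G\<^esub> j)) k \<otimes>\<^bsub>G\<^esub> ?h"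
    unfolding e using c by (intro G.gprod_conj) auto
  also have "\<dots> = inv\<^bsub>G\<^esub> ?h \<otimes>\<^bsub>G\<^esub>
      gprod G (\<lambda>j. ?b [^]\<^bsub>G\<^esub> Suc j \<otimes>\<^bsub>G\<^esub> ?a \<otimes>\<^bsub>G\<^esub> inv\<^bsub>G\<^esub> (?b [^]\<^bsub>G\<^esub> Suc j)) k \<otimes>\<^bsub>G\<^esub> ?h"
    unfolding G.gprod_conj_pow[OF c(2,1)] braid ..
  also have "\<dots> = gprod G (\<lambda>j. conj (g \<otimes>\<^bsub>P\<^esub> pgen t [^]\<^bsub>P\<^esub> Suc j)) k"
    unfolding e by (rule G.gprod_conj[symmetric]) (use c in auto)
  finally show "gprod G (\<lambda>j. conj (g \<otimes>\<^bsub>P\<^esub> pgen t [^]\<^bsub>P\<^esub> j)) k =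
      gprod G (\<lambda>j. conj (g \<otimes>\<^bsub>P\<^esub> pgen t [^]\<^bsub>P\<^esub> Suc j)) k" .
qed simp

lemma group_kernel: "group (G\<lparr>carrier := kernel G P \<pi>\<rparr>)"
  using subgroup.subgroup_is_group[OF \<pi>.subgroup_kernel G.is_group] .

lemma conj_generate:
  assumes "A \<in> kernel G P \<pi>"
  shows "A \<in> generate G (conj ` carrier P)"
proof -
  let ?N = "generate G (conj ` carrier P)"
  have sub: "subgroup ?N G" by (rule G.generate_is_subgroup) auto
  \<comment> \<open>The induction runs over all words u, with u (\<iota> (\<pi> u))^-1 in place of
    u: a letter of \<open>T\<close> leaves this element unchanged, a letter \<open>z\<close>
    multiplies it by \<open>conj\<close> of \<pi> u or the inverse. On the kernel it is the element
    itself.\<close>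
  have "art S m u \<otimes>\<^bsub>G\<^esub> inv\<^bsub>G\<^esub> (\<iota> (\<pi> (art S m u))) \<in> ?N" if "u \<in> words S" for u
    using that
  proof (induction u rule: rev_induct)
    case Nil
    then show ?case unfolding art_Nil G_def[symmetric] by (simp add: subgroup.one_closed[OF sub])
  next
    case (snoc l u)
    obtain x b where l: "l = (x, b)" by fastforce
    have x: "x \<in> S" and u: "u \<in> words S" using snoc.prems l by auto
    let ?u = "art S m u"
    let ?y = "if b then gen x else inv\<^bsub>G\<^esub> (gen x)"
    have uc: "?u \<in> carrier G" using u unfolding G_def by (rule art_closed)
    have yc: "?y \<in> carrier G" using x by simp
    have app: "art S m (u @ [l]) = ?u \<otimes>\<^bsub>G\<^esub> ?y"
      unfolding G_def gen_def l using u x by (simp only: art_append art_letter Cons_in_lists_iff mem_Sigma_iff UNIV_I Nil lists.Nil simp_thms)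
    have IH: "?u \<otimes>\<^bsub>G\<^esub> inv\<^bsub>G\<^esub> (\<iota> (\<pi> ?u)) \<in> ?N" using snoc.IH u by blast
    show ?case
    proof (cases "x = z")
      case False
      then have xT: "x \<in> T" using x by (simp add: T_def)
      have "\<iota> (\<pi> (?u \<otimes>\<^bsub>G\<^esub> ?y)) = \<iota> (\<pi> ?u) \<otimes>\<^bsub>G\<^esub> ?y"
        using uc x xT by (cases b) (simp_all add: \<pi>_gen \<iota>_pgen)
      then have "?u \<otimes>\<^bsub>G\<^esub> ?y \<otimes>\<^bsub>G\<^esub> inv\<^bsub>G\<^esub> (\<iota> (\<pi> (?u \<otimes>\<^bsub>G\<^esub> ?y))) = ?u \<otimes>\<^bsub>G\<^esub> inv\<^bsub>G\<^esub> (\<iota> (\<pi> ?u))"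
        using uc yc by (simp add: G.inv_mult_group G.m_assoc G.inv_cancel_left del: if_split)
      then show ?thesis using IH unfolding app by simp
    next
      case True
      have "\<pi> (?u \<otimes>\<^bsub>G\<^esub> ?y) = \<pi> ?u"
        using uc x True by (cases b) (simp_all add: \<pi>_gen)
      moreover have "?u \<otimes>\<^bsub>G\<^esub> ?y \<otimes>\<^bsub>G\<^esub> inv\<^bsub>G\<^esub> (\<iota> (\<pi> ?u)) =
          (?u \<otimes>\<^bsub>G\<^esub> inv\<^bsub>G\<^esub> (\<iota> (\<pi> ?u))) \<otimes>\<^bsub>G\<^esub> (if b then conj (\<pi> ?u) else inv\<^bsub>G\<^esub> (conj (\<pi> ?u)))"
        using uc z True by (cases b) (simp_all add: conj_def G.inv_mult_group G.m_assoc G.inv_cancel_left)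
      moreover have "conj (\<pi> ?u) \<in> ?N" using uc by (intro generate.incl) auto
      then have "(if b then conj (\<pi> ?u) else inv\<^bsub>G\<^esub> (conj (\<pi> ?u))) \<in> ?N"
        using subgroup.m_inv_closed[OF sub] by simp
      ultimately show ?thesis using subgroup.m_closed[OF sub IH] unfolding app by (simp only:)
    qed
  qed
  moreover obtain u where "u \<in> words S" "A = art S m u"
    using assms art_cases[of A S m] by (auto simp: kernel_def G_def)
  ultimately have "A \<otimes>\<^bsub>G\<^esub> inv\<^bsub>G\<^esub> (\<iota> (\<pi> A)) \<in> ?N" by blast
  then show ?thesis using assms by (simp add: kernel_def)
qed

lemma kernel_hom_eqI:
  assumes H: "group H" and h: "h \<in> hom (G\<lparr>carrier := kernel G P \<pi>\<rparr>) H"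
    and h': "h' \<in> hom (G\<lparr>carrier := kernel G P \<pi>\<rparr>) H"
    and eq: "\<And>g. g \<in> carrier P \<Longrightarrow> h (conj g) = h' (conj g)"
    and A: "A \<in> kernel G P \<pi>"
  shows "h A = h' A"
proof -
  let ?K = "G\<lparr>carrier := kernel G P \<pi>\<rparr>"
  interpret h: group_hom ?K H h using H h group_kernel by (simp add: group_hom_def group_hom_axioms_def)
  interpret h': group_hom ?K H h' using H h' group_kernel by (simp add: group_hom_def group_hom_axioms_def)
  have kinv: "inv\<^bsub>?K\<^esub> x = inv\<^bsub>G\<^esub> x" if "x \<in> kernel G P \<pi>" for x
    using that \<pi>.subgroup_kernel by (simp add: G.m_inv_consistent)
  have "A \<in> generate G (conj ` carrier P)" using A by (rule conj_generate)
  then have "A \<in> kernel G P \<pi> \<and> h A = h' A"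
  proof (induction rule: generate.induct)
    case one
    show ?case using h.hom_one h'.hom_one subgroup.one_closed[OF \<pi>.subgroup_kernel] by simp
  next
    case (incl x)
    then show ?case using eq conj_kernel by auto
  next
    case (inv x)
    then obtain g where g: "g \<in> carrier P" "x = conj g" by blast
    have x: "x \<in> kernel G P \<pi>" using g conj_kernel by simp
    then have "inv\<^bsub>G\<^esub> x \<in> kernel G P \<pi>" using subgroup.m_inv_closed[OF \<pi>.subgroup_kernel] by blast
    then show ?case using h.hom_inv[of x] h'.hom_inv[of x] x g eq by (simp add: kinv)
  next
    case (eng x y)
    then show ?case
      using h.hom_mult[of x y] h'.hom_mult[of x y] subgroup.m_closed[OF \<pi>.subgroup_kernel] by simp
  qed
  then show ?thesis by simp
qed

text \<open>
  Right multiplication in the semidirect product of \<open>H\<close> by \<open>P\<close> in which \<open>z\<close> conjugated by \<open>g\<close> is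
  \<open>\<zeta> g\<close>, written without the action of \<open>P\<close> on \<open>H\<close> (which need not exist): the pair \<open>(f, g)\<close> stands
  for \<open>f g\<close>, and \<open>f g z = f (\<zeta> g) g\<close>.
\<close>

definition kact :: "('h, 'r) monoid_scheme \<Rightarrow> ('a word set \<Rightarrow> 'h) \<Rightarrow> 'a \<Rightarrow> bool \<Rightarrow>
    'h \<times> 'a word set \<Rightarrow> 'h \<times> 'a word set" where
  "kact H \<zeta> x b \<omega> = (if x = z
    then (fst \<omega> \<otimes>\<^bsub>H\<^esub> (if b then \<zeta> (snd \<omega>) else inv\<^bsub>H\<^esub> \<zeta> (snd \<omega>)), snd \<omega>)
    else (fst \<omega>, snd \<omega> \<otimes>\<^bsub>P\<^esub> (if b then pgen x else inv\<^bsub>P\<^esub> pgen x)))"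

context
  fixes H :: "('h, 'r) monoid_scheme" and \<zeta> :: "'a word set \<Rightarrow> 'h"
  assumes H: "group H" and \<zeta>: "compatible H \<zeta>"
begin

interpretation H: group H by (rule H)

lemma \<zeta>_closed [simp]: "g \<in> carrier P \<Longrightarrow> \<zeta> g \<in> carrier H"
  using \<zeta> by (simp add: compatible_def)

lemma kact_words_T:
  assumes "u \<in> words T" "f \<in> carrier H" "g \<in> carrier P"
  shows "word_act (kact H \<zeta>) u (f, g) = (f, g \<otimes>\<^bsub>P\<^esub> art T m u)"
  using assms(1,3)
proof (induction u arbitrary: g rule: list.induct)
  case Nil
  then show ?case unfolding art_Nil P_def[symmetric] by simp
next
  case (Cons a u)
  obtain x b where a: "a = (x, b)" by fastforce
  let ?y = "if b then pgen x else inv\<^bsub>P\<^esub> pgen x"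
  have x: "x \<in> T" "x \<noteq> z" "u \<in> words T" using Cons.prems a by (auto simp: T_def)
  have "art T m ([a] @ u) = ?y \<otimes>\<^bsub>P\<^esub> art T m u"
    unfolding P_def pgen_def a using x
    by (simp only: art_append art_letter Cons_in_lists_iff mem_Sigma_iff UNIV_I lists.Nil simp_thms)
  moreover have "art T m u \<in> carrier P" using x unfolding P_def by (intro art_closed)
  moreover have "?y \<in> carrier P" using x by simp
  ultimately show ?case
    using Cons.IH[OF x(3), of "g \<otimes>\<^bsub>P\<^esub> ?y"] x Cons.prems by (simp add: a kact_def P.m_assoc)
qed

text \<open>The first coordinate collects the values along the line through \<open>g\<close>. The
  order of the two letters decides whether the window starts at g or at g t, so
  \<open>compatible\<close> is exactly the braid relation for this action.\<close>

lemma kact_alt: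
  assumes "t \<in> T" "f \<in> carrier H" "g \<in> carrier P"
  shows "word_act (kact H \<zeta>) (alt_word z t (2 * k)) (f, g) =
      (f \<otimes>\<^bsub>H\<^esub> gprod H (\<lambda>j. \<zeta> (g \<otimes>\<^bsub>P\<^esub> pgen t [^]\<^bsub>P\<^esub> j)) k, g \<otimes>\<^bsub>P\<^esub> pgen t [^]\<^bsub>P\<^esub> k)"
    and "word_act (kact H \<zeta>) (alt_word t z (2 * k)) (f, g) =
      (f \<otimes>\<^bsub>H\<^esub> gprod H (\<lambda>j. \<zeta> (g \<otimes>\<^bsub>P\<^esub> pgen t [^]\<^bsub>P\<^esub> Suc j)) k, g \<otimes>\<^bsub>P\<^esub> pgen t [^]\<^bsub>P\<^esub> k)"
proof -
  have t: "t \<noteq> z" using assms by (auto simp: T_def)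
  have pc: "pgen t [^]\<^bsub>P\<^esub> j \<in> carrier P" for j :: nat using assms by simp
  show "word_act (kact H \<zeta>) (alt_word z t (2 * k)) (f, g) =
      (f \<otimes>\<^bsub>H\<^esub> gprod H (\<lambda>j. \<zeta> (g \<otimes>\<^bsub>P\<^esub> pgen t [^]\<^bsub>P\<^esub> j)) k, g \<otimes>\<^bsub>P\<^esub> pgen t [^]\<^bsub>P\<^esub> k)"
    using assms t pc unfolding word_act_alt_even
    by (induction k) (simp_all add: kact_def H.m_assoc P.m_assoc)
  show "word_act (kact H \<zeta>) (alt_word t z (2 * k)) (f, g) =
      (f \<otimes>\<^bsub>H\<^esub> gprod H (\<lambda>j. \<zeta> (g \<otimes>\<^bsub>P\<^esub> pgen t [^]\<^bsub>P\<^esub> Suc j)) k, g \<otimes>\<^bsub>P\<^esub> pgen t [^]\<^bsub>P\<^esub> k)"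
    using assms t pc unfolding word_act_alt_even
    by (induction k) (simp_all add: kact_def H.m_assoc P.m_assoc)
qed

lemma kact_action: "word_action S (artin_relations S m) (carrier H \<times> carrier P) (kact H \<zeta>)"
proof
  fix x b \<omega> assume x: "x \<in> S" and \<omega>: "\<omega> \<in> carrier H \<times> carrier P"
  show "kact H \<zeta> x b \<omega> \<in> carrier H \<times> carrier P"
    using x \<omega> by (auto simp: kact_def T_def)
  have "x \<noteq> z \<Longrightarrow> pgen x \<in> carrier P" using x by (simp add: T_def)
  then show "kact H \<zeta> x (\<not> b) (kact H \<zeta> x b \<omega>) = \<omega>"
    using \<omega> by (cases b) (auto simp: kact_def H.m_assoc P.m_assoc)
next
  fix r s \<omega> assume "(r, s) \<in> artin_relations S m" and \<omega>: "\<omega> \<in> carrier H \<times> carrier P"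
  then obtain a b n where ab: "a \<in> S" "b \<in> S" "a \<noteq> b" "m a b = enat n"
    "r = alt_word a b n" "s = alt_word b a n" by (auto simp: artin_relations_def)
  then obtain k where k: "n = 2 * k" by (cases rule: label_cases[OF ab(1-3)]) auto
  obtain f g where fg: "\<omega> = (f, g)" "f \<in> carrier H" "g \<in> carrier P" using \<omega> by auto
  have zt: "word_act (kact H \<zeta>) (alt_word z t (2 * k)) \<omega> = word_act (kact H \<zeta>) (alt_word t z (2 * k)) \<omega>"
    if "t \<in> T" "m z t = enat (2 * k)" for t
    using \<zeta> that fg kact_alt[OF that(1) fg(2,3)] unfolding compatible_def by simp
  consider "a = z" "b \<in> T" | "b = z" "a \<in> T" | "a \<in> T" "b \<in> T"
    using ab by (auto simp: T_def)
  then show "word_act (kact H \<zeta>) r \<omega> = word_act (kact H \<zeta>) s \<omega>"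
  proof cases
    case 1
    then show ?thesis using zt[of b] ab k by simp
  next
    case 2
    then show ?thesis using zt[of a] ab k sym[of a b] by simp
  next
    case 3
    then have "r \<in> words T" "s \<in> words T" using ab by (auto intro: alt_word_closed)
    moreover have "art T m r = art T m s"
      unfolding ab k using 3 ab(3,4) k artin_braid[of a T b m k] by (simp add: art_alt_even)
    ultimately show ?thesis using fg by (simp add: kact_words_T)
  qed
qed

interpretation act: word_action S "artin_relations S m" "carrier H \<times> carrier P" "kact H \<zeta>"
  by (rule kact_action)

lemma kact_snd:
  assumes "u \<in> words S" "f \<in> carrier H" "g \<in> carrier P"
  shows "snd (word_act (kact H \<zeta>) u (f, g)) = g \<otimes>\<^bsub>P\<^esub> \<pi> (art S m u)"
  using assms
proof (induction u arbitrary: f g rule: list.induct)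
  case Nil
  have "\<pi> (art S m []) = \<one>\<^bsub>P\<^esub>" unfolding art_Nil G_def[symmetric] by simp
  then show ?case using Nil by simp
next
  case (Cons a u)
  obtain x b where a: "a = (x, b)" by fastforce
  have x: "x \<in> S" "u \<in> words S" using Cons.prems a by auto
  let ?y = "if b then gen x else inv\<^bsub>G\<^esub> (gen x)"
  have uc: "art S m u \<in> carrier G" using x unfolding G_def by (intro art_closed)
  have "art S m ([a] @ u) = ?y \<otimes>\<^bsub>G\<^esub> art S m u"
    unfolding G_def gen_def a using x
    by (simp only: art_append art_letter Cons_in_lists_iff mem_Sigma_iff UNIV_I lists.Nil simp_thms)
  then have p: "\<pi> (art S m (a # u)) = \<pi> ?y \<otimes>\<^bsub>P\<^esub> \<pi> (art S m u)"
    using uc x by simp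
  have "word_act (kact H \<zeta>) (a # u) (f, g) = word_act (kact H \<zeta>) u (kact H \<zeta> x b (f, g))"
    by (simp add: a)
  moreover have "kact H \<zeta> x b (f, g) \<in> carrier H \<times> carrier P"
    using act.closed x Cons.prems by simp
  then obtain f1 g1 where k: "kact H \<zeta> x b (f, g) = (f1, g1)" "f1 \<in> carrier H" "g1 \<in> carrier P" by auto
  moreover have "snd (kact H \<zeta> x b (f, g)) = g \<otimes>\<^bsub>P\<^esub> \<pi> ?y"
  proof (cases "x = z")
    case True
    then show ?thesis using Cons.prems z by (simp add: kact_def \<pi>_gen)
  next
    case False
    then have "x \<in> T" using x by (simp add: T_def)
    then show ?thesis using False Cons.prems x by (simp add: kact_def \<pi>_gen)
  qed
  then have "g1 = g \<otimes>\<^bsub>P\<^esub> \<pi> ?y" by (simp add: k(1))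
  moreover have "\<pi> ?y \<in> carrier P" using x by simp
  ultimately show ?case
    using Cons.IH[OF x(2) k(2,3)] p uc Cons.prems by (simp add: P.m_assoc del: if_split)
qed

text \<open>The first coordinate is only ever multiplied from the right, by values that depend on
  the second one. This makes the map of \<open>compatible_hom\<close> multiplicative.\<close>

lemma kact_equivariant:
  assumes "u \<in> words S" "f \<in> carrier H" "f' \<in> carrier H" "g \<in> carrier P"
  shows "word_act (kact H \<zeta>) u (f' \<otimes>\<^bsub>H\<^esub> f, g) =
    map_prod (\<lambda>x. f' \<otimes>\<^bsub>H\<^esub> x) id (word_act (kact H \<zeta>) u (f, g))"
  using assms(1,2,4)
proof (induction u arbitrary: f g rule: list.induct)
  case (Cons a u)
  obtain x b where a: "a = (x, b)" by fastforce
  have x: "x \<in> S" "u \<in> words S" using Cons.prems a by auto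
  have "kact H \<zeta> x b (f' \<otimes>\<^bsub>H\<^esub> f, g) = map_prod (\<lambda>x. f' \<otimes>\<^bsub>H\<^esub> x) id (kact H \<zeta> x b (f, g))"
    using Cons.prems assms(3) by (simp add: kact_def H.m_assoc)
  moreover have "kact H \<zeta> x b (f, g) \<in> carrier H \<times> carrier P"
    using act.closed x Cons.prems by simp
  then obtain f1 g1 where "kact H \<zeta> x b (f, g) = (f1, g1)" "f1 \<in> carrier H" "g1 \<in> carrier P" by auto
  ultimately show ?case using Cons.IH[OF x(2), of f1 g1] by (simp add: a)
qed simp

text \<open>Elements of the kernel preserve the slice \<open>H \<times> {1}\<close> and act on it by
  right multiplication; \<psi> records where they send (1, 1).\<close>

lemma compatible_hom:
  obtains \<psi> where "\<psi> \<in> hom (G\<lparr>carrier := kernel G P \<pi>\<rparr>) H"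
    and "\<And>g. g \<in> carrier P \<Longrightarrow> \<psi> (conj g) = \<zeta> g"
proof
  let ?o = "(\<one>\<^bsub>H\<^esub>, \<one>\<^bsub>P\<^esub>)"
  define \<psi> where "\<psi> A = fst (act.class_act A ?o)" for A
  have o: "?o \<in> carrier H \<times> carrier P" by simp
  have cl: "act.class_act (art S m u) \<omega> = word_act (kact H \<zeta>) u \<omega>"
    if "u \<in> words S" "\<omega> \<in> carrier H \<times> carrier P" for u \<omega>
    using act.class_act_pcl that by simp
  have \<psi>: "act.class_act A (f, \<one>\<^bsub>P\<^esub>) = (f \<otimes>\<^bsub>H\<^esub> \<psi> A, \<one>\<^bsub>P\<^esub>)" "\<psi> A \<in> carrier H"
    if "A \<in> kernel G P \<pi>" "f \<in> carrier H" for A f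
  proof -
    have "A \<in> carrier (artin_group S m)" "\<pi> A = \<one>\<^bsub>P\<^esub>" using that by (auto simp: kernel_def G_def)
    then obtain u where u: "u \<in> words S" "A = art S m u" "\<pi> (art S m u) = \<one>\<^bsub>P\<^esub>"
      by (metis art_cases)
    then show "\<psi> A \<in> carrier H"
      using act.word_act_closed[OF u(1) o] cl[OF u(1) o] by (auto simp: \<psi>_def)
    have "act.class_act A (f, \<one>\<^bsub>P\<^esub>) = map_prod (\<lambda>x. f \<otimes>\<^bsub>H\<^esub> x) id (word_act (kact H \<zeta>) u ?o)"
      using kact_equivariant[OF u(1), of "\<one>\<^bsub>H\<^esub>" f "\<one>\<^bsub>P\<^esub>"] that u by (simp add: cl)
    moreover have "word_act (kact H \<zeta>) u ?o = (\<psi> A, \<one>\<^bsub>P\<^esub>)"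
      using kact_snd[OF u(1), of "\<one>\<^bsub>H\<^esub>" "\<one>\<^bsub>P\<^esub>"] u cl[OF u(1) o] by (simp add: \<psi>_def prod_eq_iff)
    ultimately show "act.class_act A (f, \<one>\<^bsub>P\<^esub>) = (f \<otimes>\<^bsub>H\<^esub> \<psi> A, \<one>\<^bsub>P\<^esub>)" by simp
  qed
  show "\<psi> \<in> hom (G\<lparr>carrier := kernel G P \<pi>\<rparr>) H"
  proof (rule homI)
    show "\<psi> A \<in> carrier H" if "A \<in> carrier (G\<lparr>carrier := kernel G P \<pi>\<rparr>)" for A
      using \<psi>(2)[of A "\<one>\<^bsub>H\<^esub>"] that by simp
    fix A B assume AB: "A \<in> carrier (G\<lparr>carrier := kernel G P \<pi>\<rparr>)" "B \<in> carrier (G\<lparr>carrier := kernel G P \<pi>\<rparr>)"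
    then have "A \<in> carrier (presented_group S (artin_relations S m))"
      "B \<in> carrier (presented_group S (artin_relations S m))"
      by (auto simp: kernel_def G_def artin_group_def)
    then have "act.class_act (A \<otimes>\<^bsub>G\<^esub> B) ?o = act.class_act B (act.class_act A ?o)"
      unfolding G_def artin_group_def using o by (rule act.class_act_mult)
    also have "\<dots> = (\<psi> A \<otimes>\<^bsub>H\<^esub> \<psi> B, \<one>\<^bsub>P\<^esub>)"
      using AB \<psi>[of A "\<one>\<^bsub>H\<^esub>"] \<psi>(1)[of B "\<psi> A"] by simp
    finally show "\<psi> (A \<otimes>\<^bsub>G\<lparr>carrier := kernel G P \<pi>\<rparr>\<^esub> B) = \<psi> A \<otimes>\<^bsub>H\<^esub> \<psi> B"
      by (simp add: \<psi>_def)
  qed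
  fix g assume g: "g \<in> carrier P"
  obtain v where v: "v \<in> words T" "g = art T m v" using g art_cases[of g T m] by (auto simp: P_def)
  have "inv\<^bsub>P\<^esub> g \<in> carrier P" using g by simp
  then obtain w where w: "w \<in> words T" "inv\<^bsub>P\<^esub> g = art T m w"
    using art_cases[of "inv\<^bsub>P\<^esub> g" T m] by (auto simp: P_def)
  have vw: "v \<in> words S" "w \<in> words S" using v w words_mono[OF TS] by auto
  have "\<iota> g = art S m v" unfolding v(2) \<iota>_def by (rule artin_incl_art[OF TS v(1)])
  moreover have "inv\<^bsub>G\<^esub> (\<iota> g) = art S m w"
    using w(2) artin_incl_art[OF TS w(1), of m] \<iota>.hom_inv[OF g] by (simp add: \<iota>_def)
  moreover have "gen z = art S m [(z, True)]" by (simp add: gen_def artin_gen_def pres_gen_def)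
  \<comment> \<open>This word walks from 1 to \<open>g\<close> in \<open>P\<close>, picks up \<zeta>
    g at the letter \<open>z\<close>, and walks back to 1.\<close>
  ultimately have "conj g = art S m (v @ [(z, True)] @ w)"
    unfolding conj_def G_def using vw z by (simp add: art_append[symmetric])
  then have "act.class_act (conj g) ?o = word_act (kact H \<zeta>) (v @ [(z, True)] @ w) ?o"
    using cl[of "v @ [(z, True)] @ w" ?o] vw z by simp
  also have "\<dots> = (\<zeta> g, \<one>\<^bsub>P\<^esub>)"
    using v w g kact_words_T[OF v(1), of "\<one>\<^bsub>H\<^esub>" "\<one>\<^bsub>P\<^esub>"] kact_words_T[OF w(1), of "\<zeta> g" g]
    by (simp add: kact_def v(2)[symmetric] w(2)[symmetric])
  finally show "\<psi> (conj g) = \<zeta> g" by (simp add: \<psi>_def)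
qed

end

end

section \<open>Syllable lists\<close>

text \<open>
  The list \<open>[(e\<^sub>n, i\<^sub>n), \<dots>, (e\<^sub>1, i\<^sub>1)]\<close> stands for the element \<open>e\<^sub>1\<^sup>i\<^sup>1 \<cdots> e\<^sub>n\<^sup>i\<^sup>n\<close> of a free group: the head
  is the last syllable.
\<close>

definition syl_pt :: "'e \<Rightarrow> ('e \<times> int) list \<Rightarrow> int \<Rightarrow> ('e \<times> int) list" where
  "syl_pt e \<tau> i = (if i = 0 then \<tau> else (e, i) # \<tau>)"

definition syl_split :: "'e \<Rightarrow> ('e \<times> int) list \<Rightarrow> int \<times> ('e \<times> int) list" where
  "syl_split e \<sigma> = (case \<sigma> of [] \<Rightarrow> (0, []) | (e', n) # \<tau> \<Rightarrow> if e' = e then (n, \<tau>) else (0, \<sigma>))"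

definition syl_shift :: "'e \<Rightarrow> int \<Rightarrow> ('e \<times> int) list \<Rightarrow> ('e \<times> int) list" where
  "syl_shift e d \<sigma> = (let (n, \<tau>) = syl_split e \<sigma> in syl_pt e \<tau> (n + d))"

text \<open>The condition on \<open>syl_split\<close> says that \<tau> has no
  \<open>e\<close>-syllable at its head, since the exponents of a reduced list are nonzero.\<close>

fun syl_ok :: "'e set \<Rightarrow> ('e \<times> int) list \<Rightarrow> bool" where
  "syl_ok E [] \<longleftrightarrow> True"
| "syl_ok E ((e, n) # \<tau>) \<longleftrightarrow> e \<in> E \<and> n \<noteq> 0 \<and> fst (syl_split e \<tau>) = 0 \<and> syl_ok E \<tau>"

lemma syl_pt_0 [simp]: "syl_pt e \<tau> 0 = \<tau>"
  by (simp add: syl_pt_def)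

lemma syl_split_pt:
  assumes "syl_ok E \<tau>" "fst (syl_split e \<tau>) = 0"
  shows "syl_split e (syl_pt e \<tau> i) = (i, \<tau>)"
  using assms by (auto simp: syl_pt_def syl_split_def split: list.splits if_splits)

lemma syl_shift_pt:
  assumes "syl_ok E \<tau>" "fst (syl_split e \<tau>) = 0"
  shows "syl_shift e d (syl_pt e \<tau> i) = syl_pt e \<tau> (i + d)"
  by (simp add: syl_shift_def syl_split_pt[OF assms])

lemma syl_ok_pt:
  "e \<in> E \<Longrightarrow> syl_ok E \<tau> \<Longrightarrow> fst (syl_split e \<tau>) = 0 \<Longrightarrow> syl_ok E (syl_pt e \<tau> i)"
  by (simp add: syl_pt_def)

text \<open>Each reduced list lies on a line in direction \<open>e\<close>, with base \<tau> and
  position \<open>n\<close>. Position 0, where the syllable is absent, is included, which spares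
  case distinctions for shifts.\<close>

lemma syl_pt_cases:
  assumes "syl_ok E \<sigma>"
  obtains \<tau> n where "\<sigma> = syl_pt e \<tau> n" "syl_ok E \<tau>" "fst (syl_split e \<tau>) = 0"
proof (cases "fst (syl_split e \<sigma>) = 0")
  case True
  then show thesis using that[of \<sigma> 0] assms by simp
next
  case False
  then obtain n \<tau> where "\<sigma> = (e, n) # \<tau>"
    by (auto simp: syl_split_def split: list.splits if_splits)
  then show thesis using that[of \<tau> n] assms by (simp add: syl_pt_def)
qed

lemma syl_shift_shift:
  assumes "syl_ok E \<sigma>"
  shows "syl_shift e d' (syl_shift e d \<sigma>) = syl_shift e (d + d') \<sigma>"
proof -
  obtain \<tau> n where "\<sigma> = syl_pt e \<tau> n" "syl_ok E \<tau>" "fst (syl_split e \<tau>) = 0"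
    using assms by (rule syl_pt_cases)
  then show ?thesis by (simp add: syl_shift_pt add.assoc)
qed

lemma syl_shift_0: "syl_ok E \<sigma> \<Longrightarrow> syl_shift e 0 \<sigma> = \<sigma>"
  by (erule syl_pt_cases[of E \<sigma> e]) (simp add: syl_shift_pt)

lemma syl_ok_shift:
  assumes "syl_ok E \<sigma>" "e \<in> E"
  shows "syl_ok E (syl_shift e d \<sigma>)"
proof -
  obtain \<tau> n where "\<sigma> = syl_pt e \<tau> n" "syl_ok E \<tau>" "fst (syl_split e \<tau>) = 0"
    using assms(1) by (rule syl_pt_cases)
  then show ?thesis using assms(2) by (simp add: syl_shift_pt syl_ok_pt)
qed

section \<open>Normal forms and freeness of the kernel\<close>

definition lrep :: "('g, 'r) monoid_scheme \<Rightarrow> 'g set \<Rightarrow> 'g \<Rightarrow> 'g" where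
  "lrep G H g = (SOME x. x \<in> carrier G \<and> inv\<^bsub>G\<^esub> x \<otimes>\<^bsub>G\<^esub> g \<in> H)"

context group
begin

lemma int_pow_commute:
  fixes d :: int
  assumes "x \<otimes> y = y \<otimes> x" "x \<in> carrier G" "y \<in> carrier G"
  shows "x [^] d \<otimes> y = y \<otimes> x [^] d"
proof -
  have pos: "x [^] int n \<otimes> y = y \<otimes> x [^] int n" for n
    using assms by (simp add: int_pow_int group_commutes_pow)
  show ?thesis
  proof (cases d rule: int_cases2)
    case (nonpos n)
    have c: "x [^] int n \<in> carrier G" using assms by simp
    have "inv (x [^] int n) \<otimes> y = inv (x [^] int n) \<otimes> (y \<otimes> x [^] int n) \<otimes> inv (x [^] int n)"
      using c assms by (simp add: m_assoc)
    also have "\<dots> = y \<otimes> inv (x [^] int n)"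
      unfolding pos[symmetric] using c assms by (simp add: inv_cancel_left)
    finally show ?thesis using assms nonpos by (simp add: int_pow_neg)
  qed (use pos in simp)
qed

lemma lrep:
  assumes "subgroup H G" "g \<in> carrier G"
  shows "lrep G H g \<in> carrier G" "inv (lrep G H g) \<otimes> g \<in> H"
proof -
  have "g \<in> carrier G \<and> inv g \<otimes> g \<in> H" using assms by (simp add: subgroup.one_closed)
  then have "lrep G H g \<in> carrier G \<and> inv (lrep G H g) \<otimes> g \<in> H"
    unfolding lrep_def by (rule someI)
  then show "lrep G H g \<in> carrier G" "inv (lrep G H g) \<otimes> g \<in> H" by auto
qed

text \<open>The same elements are eligible for g h as for g, so \<open>SOME\<close> makes the same
  choice.\<close>

lemma lrep_mult:
  assumes "subgroup H G" "g \<in> carrier G" "h \<in> H"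
  shows "lrep G H (g \<otimes> h) = lrep G H g"
proof -
  interpret subgroup H G by fact
  have "inv x \<otimes> (g \<otimes> h) \<in> H \<longleftrightarrow> inv x \<otimes> g \<in> H" if x: "x \<in> carrier G" for x
  proof
    assume "inv x \<otimes> (g \<otimes> h) \<in> H"
    then have "inv x \<otimes> (g \<otimes> h) \<otimes> inv h \<in> H" using assms by blast
    then show "inv x \<otimes> g \<in> H" using assms x by (simp add: m_assoc)
  next
    assume "inv x \<otimes> g \<in> H"
    then have "inv x \<otimes> g \<otimes> h \<in> H" using assms by blast
    then show "inv x \<otimes> (g \<otimes> h) \<in> H" using assms x by (simp add: m_assoc)
  qed
  then show ?thesis unfolding lrep_def by (metis (no_types, lifting))
qed

lemma lrep_lrep:
  assumes "subgroup H G" "g \<in> carrier G"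
  shows "lrep G H (lrep G H g) = lrep G H g"
  using lrep_mult[OF assms(1) lrep(1)[OF assms] lrep(2)[OF assms]] lrep(1)[OF assms] assms(2)
  by (simp add: inv_cancel_left)

end

text \<open>A finite label between \<open>s\<close> and \<open>t\<close> would leave the three
  vertices pairwise joined, and FC would make an infinite triangle group finite.\<close>

lemma (in even_artin) FC_triangle:
  assumes FC: "FC_type S m" and x: "x \<in> S" "s \<in> S" "t \<in> S" "x \<noteq> s" "x \<noteq> t" "s \<noteq> t"
    and "m x s = enat (2 * a)" "m x t = enat (2 * b)" "a \<ge> 2" "b \<ge> 2"
  shows "m s t = \<infinity>"
proof (cases rule: label_cases[OF x(2,3,6)])
  case (2 k)
  have one: "m y y \<noteq> \<infinity>" if "y \<in> S" for y using coxeter that by (simp add: coxeter_matrix_def)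
  have s: "m s x = m x s" "m t x = m x t" "m t s = m s t" using sym x by auto
  have "\<forall>p\<in>{x, s, t}. \<forall>q\<in>{x, s, t}. m p q \<noteq> \<infinity>"
    using one x s 2 assms(8,9) by simp
  then have "spherical_type {x, s, t} m"
    using FC[unfolded FC_type_def, THEN spec, of "{x, s, t}"] x by simp
  with infinite_coxeter_triangle[OF x(4-6) s assms(8,9) 2(2) assms(10,11)]
  show ?thesis by (rule notE)
qed

section \<open>The neighbours of \<open>z\<close> and the group on \<open>L\<close>\<close>

locale artin_kill_FC = artin_kill +
  assumes FC: "FC_type S m"
begin

definition "L2 = {s \<in> T. m z s = 2}"
definition "L4 = {t \<in> T. \<exists>k\<ge>2. m z t = enat (2 * k)}"
definition "L = L2 \<union> L4"
definition "half t = (SOME k. m z t = enat (2 * k))"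
definition "Cm t = {s \<in> L2. m s t = 2}"
definition "A2 = artin_group L2 m"
text \<open>The conjugate of \<open>t\<close> by an element of \<open>A2\<close> depends only on the
  coset of that element modulo the group on \<open>Cm t\<close>.\<close>

definition "cr t = lrep A2 (art L2 m ` words (Cm t))"
definition "\<iota>2 = artin_incl T m"

lemma half_eq: "m z t = enat (2 * k) \<Longrightarrow> half t = k"
  by (simp add: half_def)

lemma L4D: "t \<in> L4 \<Longrightarrow> m z t = enat (2 * half t)" "t \<in> L4 \<Longrightarrow> half t \<ge> 2"
  using half_eq by (auto simp: L4_def)

lemma LT: "L \<subseteq> T" "L2 \<subseteq> T" "L4 \<subseteq> T" "L2 \<subseteq> L" "L4 \<subseteq> L"
  by (auto simp: L_def L2_def L4_def)

lemma TD: "t \<in> T \<Longrightarrow> t \<in> S" "t \<in> T \<Longrightarrow> z \<noteq> t"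
  by (auto simp: T_def)

lemma disjoint: "t \<in> L4 \<Longrightarrow> t \<notin> L2"
  by (auto simp: L4_def L2_def numeral_eq_enat)

lemma L4_L4: "s \<in> L4 \<Longrightarrow> t \<in> L4 \<Longrightarrow> s \<noteq> t \<Longrightarrow> m s t = \<infinity>"
  using FC_triangle[OF FC z] L4D LT TD by (meson subsetD)

text \<open>With a label of at least 4 between \<open>s\<close> and \<open>t\<close>, the triangle
  with apex \<open>t\<close> has two such labels, to \<open>s\<close> and to \<open>z\<close>. Then
  \<open>s\<close> and \<open>z\<close> would not be joined, whereas their label is 2.\<close>

lemma L2_L4:
  assumes "s \<in> L2" "t \<in> L4"
  shows "m s t = \<infinity> \<or> m s t = 2"
proof -
  have st: "s \<in> S" "t \<in> S" "s \<noteq> t" "z \<noteq> s" "z \<noteq> t"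
    using assms LT TD disjoint by blast+
  show ?thesis
  proof (cases rule: label_cases[OF st(1-3)])
    case (2 k)
    have "\<not> k \<ge> 2"
    proof
      assume "k \<ge> 2"
      moreover have "m t s = enat (2 * k)" "m t z = enat (2 * half t)"
        using 2 sym[OF st(1,2)] sym[OF z st(2)] L4D(1)[OF assms(2)] by auto
      ultimately have "m z s = \<infinity>"
        using FC_triangle[OF FC st(2) z st(1), of "half t" k] st L4D(2)[OF assms(2)] by auto
      then show False using assms(1) by (simp add: L2_def)
    qed
    then have "k = 1" using 2 by simp
    then show ?thesis using 2 by (simp add: numeral_eq_enat)
  qed simp
qed

sublocale A2: group A2 unfolding A2_def by (rule group_artin)
sublocale \<iota>2: group_hom A2 P \<iota>2
  unfolding group_hom_def group_hom_axioms_def \<iota>2_def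
  using artin_incl_hom[OF LT(2)] A2.is_group P.is_group by (simp add: A2_def P_def)

definition "gen2 = artin_gen L2 m"

lemma gen2_closed [simp]: "x \<in> L2 \<Longrightarrow> gen2 x \<in> carrier A2"
  unfolding gen2_def A2_def by (rule artin_gen_closed)

lemma \<iota>2_gen2: "x \<in> L2 \<Longrightarrow> \<iota>2 (gen2 x) = pgen x"
  unfolding \<iota>2_def gen2_def pgen_def by (rule artin_incl_gen[OF LT(2)])

lemma subgroup_Cm: "subgroup (art L2 m ` words (Cm t)) A2"
  unfolding A2_def by (rule subgroup_art_words) (auto simp: Cm_def)

lemma cr_closed [simp]: "a \<in> carrier A2 \<Longrightarrow> cr t a \<in> carrier A2"
  unfolding cr_def by (rule A2.lrep(1)[OF subgroup_Cm])

lemma cr_cr [simp]: "a \<in> carrier A2 \<Longrightarrow> cr t (cr t a) = cr t a"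
  unfolding cr_def by (rule A2.lrep_lrep[OF subgroup_Cm])

lemma cr_mult_gen: "a \<in> carrier A2 \<Longrightarrow> s \<in> Cm t \<Longrightarrow> cr t (a \<otimes>\<^bsub>A2\<^esub> gen2 s) = cr t a"
proof -
  assume a: "a \<in> carrier A2" and s: "s \<in> Cm t"
  have "art L2 m [(s, True)] \<in> art L2 m ` words (Cm t)" using s by (intro imageI) simp
  then have "gen2 s \<in> art L2 m ` words (Cm t)" by (simp add: gen2_def artin_gen_def pres_gen_def)
  then show ?thesis unfolding cr_def by (rule A2.lrep_mult[OF subgroup_Cm a])
qed

text \<open>
  \<open>E\<close> is the basis \<open>c t c\<^sup>-\<^sup>1\<close> of the kernel of the retraction from the group on \<open>L\<close> to \<open>A2\<close>; the
  canonical coset representative \<open>c\<close> takes care of \<open>t\<close> commuting with \<open>Cm t\<close>. The action \<open>lact\<close> is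
  right multiplication on pairs of a reduced word over \<open>E\<close> and an element of \<open>A2\<close>.
\<close>

definition "E = {(t, c). t \<in> L4 \<and> c \<in> carrier A2 \<and> cr t c = c}"
definition "\<Omega> = {(\<sigma>, a). syl_ok E \<sigma> \<and> a \<in> carrier A2}"

definition lact :: "'a \<Rightarrow> bool \<Rightarrow> (('a \<times> 'a word set) \<times> int) list \<times> 'a word set \<Rightarrow>
    (('a \<times> 'a word set) \<times> int) list \<times> 'a word set" where
  "lact x b \<omega> = (if x \<in> L2 then (fst \<omega>, snd \<omega> \<otimes>\<^bsub>A2\<^esub> (if b then gen2 x else inv\<^bsub>A2\<^esub> gen2 x))
    else (syl_shift (x, cr x (snd \<omega>)) (if b then 1 else - 1) (fst \<omega>), snd \<omega>))"

lemma lact_words_L2: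
  assumes "u \<in> words L2" "a \<in> carrier A2"
  shows "word_act lact u (\<sigma>, a) = (\<sigma>, a \<otimes>\<^bsub>A2\<^esub> art L2 m u)"
  using assms
proof (induction u arbitrary: a rule: list.induct)
  case Nil
  then show ?case unfolding art_Nil A2_def[symmetric] by simp
next
  case (Cons l u)
  obtain x b where l: "l = (x, b)" by fastforce
  let ?y = "if b then gen2 x else inv\<^bsub>A2\<^esub> gen2 x"
  have x: "x \<in> L2" "u \<in> words L2" using Cons.prems l by auto
  have "art L2 m ([l] @ u) = ?y \<otimes>\<^bsub>A2\<^esub> art L2 m u"
    unfolding A2_def gen2_def l using x
    by (simp only: art_append art_letter Cons_in_lists_iff mem_Sigma_iff UNIV_I lists.Nil simp_thms)
  moreover have "art L2 m u \<in> carrier A2" using x unfolding A2_def by (intro art_closed)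
  moreover have "?y \<in> carrier A2" using x by simp
  ultimately show ?case
    using Cons.IH[OF x(2), of "a \<otimes>\<^bsub>A2\<^esub> ?y"] x Cons.prems by (simp add: l lact_def A2.m_assoc)
qed

text \<open>There are no relations between two vertices of \<open>L4\<close>, those inside
  \<open>L2\<close> hold in \<open>A2\<close>, and the mixed ones are commutations, under which the
  coset representative is stable.\<close>

sublocale lact: word_action L "artin_relations L m" \<Omega> lact
proof
  fix x b \<omega> assume x: "x \<in> L" and \<omega>: "\<omega> \<in> \<Omega>"
  obtain \<sigma> a where sa: "\<omega> = (\<sigma>, a)" "syl_ok E \<sigma>" "a \<in> carrier A2" using \<omega> by (auto simp: \<Omega>_def)
  have e: "(x, cr x a) \<in> E" if "x \<notin> L2" using that x sa by (auto simp: E_def L_def)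
  show "lact x b \<omega> \<in> \<Omega>"
    using sa e by (auto simp: lact_def \<Omega>_def syl_ok_shift)
  show "lact x (\<not> b) (lact x b \<omega>) = \<omega>"
    using sa by (auto simp: lact_def A2.m_assoc syl_shift_shift syl_shift_0)
next
  fix r s \<omega> assume "(r, s) \<in> artin_relations L m" and \<omega>: "\<omega> \<in> \<Omega>"
  then obtain x y n where xy: "x \<in> L" "y \<in> L" "x \<noteq> y" "m x y = enat n"
    "r = alt_word x y n" "s = alt_word y x n" by (auto simp: artin_relations_def)
  have S: "x \<in> S" "y \<in> S" using xy LT TD by blast+
  obtain k where k: "n = 2 * k" using xy by (cases rule: label_cases[OF S xy(3)]) auto
  obtain \<sigma> a where sa: "\<omega> = (\<sigma>, a)" "syl_ok E \<sigma>" "a \<in> carrier A2" using \<omega> by (auto simp: \<Omega>_def)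
  have mixed: "word_act lact (alt_word x y n) \<omega> = word_act lact (alt_word y x n) \<omega>"
    if "x \<in> L2" "y \<in> L4" "m x y = enat n" for x y
  proof -
    have "m x y = 2" using L2_L4[OF that(1,2)] that(3) by auto
    then have n: "n = Suc (Suc 0)" and c: "x \<in> Cm y"
      using that by (auto simp: numeral_eq_enat Cm_def)
    show ?thesis using that sa disjoint[OF that(2)] cr_mult_gen[OF sa(3) c] by (simp add: n lact_def)
  qed
  consider "x \<in> L4" "y \<in> L4" | "x \<in> L2" "y \<in> L4" | "x \<in> L4" "y \<in> L2" | "x \<in> L2" "y \<in> L2"
    using xy by (auto simp: L_def)
  then show "word_act lact r \<omega> = word_act lact s \<omega>"
  proof cases
    case 1
    then show ?thesis using L4_L4 xy by simp
  next
    case 2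
    then show ?thesis using mixed xy by simp
  next
    case 3
    then show ?thesis using mixed[of y x] xy sym[OF S] by simp
  next
    case 4
    then have "r \<in> words L2" "s \<in> words L2" using xy by (auto intro: alt_word_closed)
    moreover have "art L2 m r = art L2 m s"
      unfolding xy k using 4 xy(3,4) k artin_braid[of x L2 y m k] by (simp add: art_alt_even)
    ultimately show ?thesis using sa by (simp add: lact_words_L2)
  qed
qed

text \<open>Evaluation in \<open>P\<close>: the basis element (t, c) is read as c t c^-1, and the
  head of the list is the last factor.\<close>

fun R :: "(('a \<times> 'a word set) \<times> int) list \<Rightarrow> 'a word set" where
  "R [] = \<one>\<^bsub>P\<^esub>"
| "R (((t, c), n) # \<tau>) =
    R \<tau> \<otimes>\<^bsub>P\<^esub> (\<iota>2 c \<otimes>\<^bsub>P\<^esub> pgen t [^]\<^bsub>P\<^esub> n \<otimes>\<^bsub>P\<^esub> inv\<^bsub>P\<^esub> \<iota>2 c)"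

lemma L4_pgen [simp]: "t \<in> L4 \<Longrightarrow> pgen t \<in> carrier P"
  using LT by auto

lemma R_closed [simp]: "syl_ok E \<sigma> \<Longrightarrow> R \<sigma> \<in> carrier P"
  by (induction \<sigma> rule: R.induct) (auto simp: E_def)

lemma R_pt:
  assumes "(t, c) \<in> E" "syl_ok E \<tau>"
  shows "R (syl_pt (t, c) \<tau> i) =
    R \<tau> \<otimes>\<^bsub>P\<^esub> (\<iota>2 c \<otimes>\<^bsub>P\<^esub> pgen t [^]\<^bsub>P\<^esub> i \<otimes>\<^bsub>P\<^esub> inv\<^bsub>P\<^esub> \<iota>2 c)"
  using assms by (cases "i = 0") (auto simp: syl_pt_def E_def)

lemma commute_Cm:
  assumes "h \<in> art L2 m ` words (Cm t)" "t \<in> L4"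
  shows "pgen t \<otimes>\<^bsub>P\<^esub> \<iota>2 h = \<iota>2 h \<otimes>\<^bsub>P\<^esub> pgen t"
proof -
  obtain u where u: "u \<in> words (Cm t)" "h = art L2 m u" using assms(1) by blast
  have C: "words (Cm t) \<subseteq> words L2" by (rule words_mono) (auto simp: Cm_def)
  have tc: "pgen t \<in> carrier P" using assms by simp
  have "pgen t \<otimes>\<^bsub>P\<^esub> \<iota>2 (art L2 m u) = \<iota>2 (art L2 m u) \<otimes>\<^bsub>P\<^esub> pgen t"
    using u(1)
  proof (induction u rule: list.induct)
    case Nil
    then show ?case using tc unfolding art_Nil A2_def[symmetric] by simp
  next
    case (Cons l u)
    obtain x b where l: "l = (x, b)" by fastforce
    have x: "x \<in> Cm t" "x \<in> L2" "u \<in> words (Cm t)" "u \<in> words L2"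
      using Cons.prems C l by (auto simp: Cm_def)
    let ?y = "if b then gen2 x else inv\<^bsub>A2\<^esub> gen2 x" and ?v = "\<iota>2 (art L2 m u)"
    have "art L2 m ([l] @ u) = ?y \<otimes>\<^bsub>A2\<^esub> art L2 m u"
      unfolding A2_def gen2_def l using x
      by (simp only: art_append art_letter Cons_in_lists_iff mem_Sigma_iff UNIV_I lists.Nil simp_thms)
    moreover have v: "art L2 m u \<in> carrier A2" using x unfolding A2_def by (intro art_closed)
    moreover have yc: "?y \<in> carrier A2" using x by simp
    ultimately have e: "\<iota>2 (art L2 m (l # u)) = \<iota>2 ?y \<otimes>\<^bsub>P\<^esub> ?v"
      by simp
    have xT: "x \<in> T" "t \<in> T" "x \<noteq> t" using x assms LT disjoint by blast+
    have "m x t = enat (2 * 1)" using x by (simp add: Cm_def numeral_eq_enat)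
    then have "(pgen x \<otimes>\<^bsub>P\<^esub> pgen t) [^]\<^bsub>P\<^esub> (1::nat) = (pgen t \<otimes>\<^bsub>P\<^esub> pgen x) [^]\<^bsub>P\<^esub> (1::nat)"
      unfolding pgen_def P_def by (rule artin_braid[OF xT])
    then have "pgen t \<otimes>\<^bsub>P\<^esub> pgen x = pgen x \<otimes>\<^bsub>P\<^esub> pgen t"
      using xT by simp
    then have "pgen t \<otimes>\<^bsub>P\<^esub> \<iota>2 ?y = \<iota>2 ?y \<otimes>\<^bsub>P\<^esub> pgen t"
      using x xT P.int_pow_commute[of "pgen x" "pgen t" "- 1"] by (simp add: \<iota>2_gen2 P.int_pow_neg)
    then have "pgen t \<otimes>\<^bsub>P\<^esub> (\<iota>2 ?y \<otimes>\<^bsub>P\<^esub> ?v) = \<iota>2 ?y \<otimes>\<^bsub>P\<^esub> (pgen t \<otimes>\<^bsub>P\<^esub> ?v)"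
      using tc v yc by (simp only: P.m_assoc[symmetric] \<iota>2.hom_closed)
    then show ?case unfolding e using Cons.IH[OF x(3)] tc v yc by (simp only: P.m_assoc \<iota>2.hom_closed)
  qed
  then show ?thesis by (simp add: u)
qed

text \<open>Write a = c h with c the representative and h in the group on \<open>Cm t\<close>. As h
  commutes with \<open>t\<close>, a t^d = (c t^d c^-1) a: right multiplication by t^d alters the
  last syllable and keeps \<open>a\<close>.\<close>

lemma R_shift:
  assumes "syl_ok E \<sigma>" "a \<in> carrier A2" "t \<in> L4"
  shows "R (syl_shift (t, cr t a) d \<sigma>) \<otimes>\<^bsub>P\<^esub> \<iota>2 a =
    R \<sigma> \<otimes>\<^bsub>P\<^esub> \<iota>2 a \<otimes>\<^bsub>P\<^esub> pgen t [^]\<^bsub>P\<^esub> d"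
proof -
  let ?c = "cr t a"
  have e: "(t, ?c) \<in> E" using assms by (simp add: E_def)
  obtain \<tau> n where \<tau>: "\<sigma> = syl_pt (t, ?c) \<tau> n" "syl_ok E \<tau>" "fst (syl_split (t, ?c) \<tau>) = 0"
    using assms(1) by (rule syl_pt_cases)
  define h where "h = inv\<^bsub>A2\<^esub> ?c \<otimes>\<^bsub>A2\<^esub> a"
  have h: "h \<in> art L2 m ` words (Cm t)" "h \<in> carrier A2"
    unfolding h_def cr_def using A2.lrep[OF subgroup_Cm assms(2)] assms(2) by auto
  have a: "\<iota>2 a = \<iota>2 ?c \<otimes>\<^bsub>P\<^esub> \<iota>2 h"
    using assms by (simp add: h_def P.inv_cancel_left)
  have c: "\<iota>2 ?c \<in> carrier P" "\<iota>2 h \<in> carrier P" "pgen t [^]\<^bsub>P\<^esub> d \<in> carrier P"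
    "pgen t [^]\<^bsub>P\<^esub> n \<in> carrier P" "R \<tau> \<in> carrier P"
    using assms h \<tau> by auto
  have "pgen t [^]\<^bsub>P\<^esub> d \<otimes>\<^bsub>P\<^esub> \<iota>2 h = \<iota>2 h \<otimes>\<^bsub>P\<^esub> pgen t [^]\<^bsub>P\<^esub> d"
    using commute_Cm[OF h(1) assms(3)] c(2) assms(3) by (intro P.int_pow_commute) auto
  moreover have "pgen t [^]\<^bsub>P\<^esub> (n + d) = pgen t [^]\<^bsub>P\<^esub> n \<otimes>\<^bsub>P\<^esub> pgen t [^]\<^bsub>P\<^esub> d"
    using assms by (simp add: P.int_pow_mult)
  ultimately show ?thesis
    unfolding \<tau>(1) syl_shift_pt[OF \<tau>(2,3)] R_pt[OF e \<tau>(2)] a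
    using c by (simp add: P.m_assoc P.inv_cancel_left)
qed

end

section \<open>Forest coordinates of the elements of \<open>P\<close>\<close>

context artin_kill_FC
begin

text \<open>
  Every \<open>g\<close> is \<open>dr g\<close> times an element of the group on \<open>L\<close>, whose normal form \<open>st g\<close> is read off
  after retracting to that group. The roots of the forest correspond to the values of \<open>dr\<close>, the
  vertices below a root to the values of \<open>sg\<close>.
\<close>

definition "dr = lrep P (art T m ` words L)"
definition "st g = lact.class_act (artin_retract L m (inv\<^bsub>P\<^esub> dr g \<otimes>\<^bsub>P\<^esub> g)) ([], \<one>\<^bsub>A2\<^esub>)"
definition "sg g = fst (st g)"

lemma subgroup_L: "subgroup (art T m ` words L) P"
  unfolding P_def by (rule subgroup_art_words[OF LT(1)])

lemma dr_closed [simp]: "g \<in> carrier P \<Longrightarrow> dr g \<in> carrier P"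
  unfolding dr_def by (rule P.lrep(1)[OF subgroup_L])

lemma base_\<Omega>: "([], \<one>\<^bsub>A2\<^esub>) \<in> \<Omega>"
  by (simp add: \<Omega>_def)

text \<open>The action loses no information: the pair reached from the base point evaluates back to
  the element, so that \<open>st_nf\<close> can recover \<open>g\<close>.\<close>

lemma word_act_rep:
  assumes "u \<in> words L"
  shows "art T m u = R (fst (word_act lact u ([], \<one>\<^bsub>A2\<^esub>))) \<otimes>\<^bsub>P\<^esub> \<iota>2 (snd (word_act lact u ([], \<one>\<^bsub>A2\<^esub>)))"
  using assms
proof (induction u rule: rev_induct)
  case Nil
  then show ?case unfolding art_Nil P_def[symmetric] by simp
next
  case (snoc l u)
  obtain x b where l: "l = (x, b)" by fastforce
  have x: "x \<in> L" "u \<in> words L" using snoc.prems l by auto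
  then have xT: "x \<in> T" "u \<in> words T" using LT words_mono[OF LT(1)] by auto
  obtain \<sigma> a where sa: "word_act lact u ([], \<one>\<^bsub>A2\<^esub>) = (\<sigma>, a)" "syl_ok E \<sigma>" "a \<in> carrier A2"
    using lact.word_act_closed[OF x(2) base_\<Omega>] by (auto simp: \<Omega>_def)
  let ?y = "if b then pgen x else inv\<^bsub>P\<^esub> pgen x"
  have "art T m (u @ [l]) = art T m u \<otimes>\<^bsub>P\<^esub> ?y"
    unfolding P_def pgen_def l using xT
    by (simp only: art_append art_letter Cons_in_lists_iff mem_Sigma_iff UNIV_I lists.Nil simp_thms)
  also have "art T m u = R \<sigma> \<otimes>\<^bsub>P\<^esub> \<iota>2 a" using snoc.IH[OF x(2)] by (simp add: sa)
  finally have 1: "art T m (u @ [l]) = R \<sigma> \<otimes>\<^bsub>P\<^esub> \<iota>2 a \<otimes>\<^bsub>P\<^esub> ?y" .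
  have 2: "word_act lact (u @ [l]) ([], \<one>\<^bsub>A2\<^esub>) = lact x b (\<sigma>, a)" by (simp add: sa l)
  show ?case
  proof (cases "x \<in> L2")
    case True
    then show ?thesis using sa xT unfolding 1 2 by (simp add: lact_def \<iota>2_gen2 P.m_assoc)
  next
    case False
    then have x4: "x \<in> L4" using x by (simp add: L_def)
    have "?y = pgen x [^]\<^bsub>P\<^esub> (if b then 1 else - 1 :: int)"
      using xT by (simp add: P.int_pow_neg)
    then show ?thesis using False R_shift[OF sa(2,3) x4] unfolding 1 2 by (simp add: lact_def)
  qed
qed

lemma retract_T: "even_artin T m"
  by (rule subset[OF TS])

lemma st_nf:
  assumes g: "g \<in> carrier P"
  shows "st g \<in> \<Omega>" and "g = dr g \<otimes>\<^bsub>P\<^esub> (R (sg g) \<otimes>\<^bsub>P\<^esub> \<iota>2 (snd (st g)))"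
proof -
  have "inv\<^bsub>P\<^esub> dr g \<otimes>\<^bsub>P\<^esub> g \<in> art T m ` words L"
    unfolding dr_def by (rule P.lrep(2)[OF subgroup_L g])
  then obtain u where u: "u \<in> words L" "inv\<^bsub>P\<^esub> dr g \<otimes>\<^bsub>P\<^esub> g = art T m u" by blast
  have uT: "u \<in> words T" using u(1) words_mono[OF LT(1)] by blast
  have "artin_retract L m (art T m u) = art L m u"
    using even_artin.artin_retract_art[OF retract_T LT(1) uT] by (simp add: restrict_word_id u(1))
  then have st: "st g = word_act lact u ([], \<one>\<^bsub>A2\<^esub>)"
    unfolding st_def u(2) using lact.class_act_pcl[OF u(1) base_\<Omega>] by simp
  show "st g \<in> \<Omega>" unfolding st by (rule lact.word_act_closed[OF u(1) base_\<Omega>])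
  have "g = dr g \<otimes>\<^bsub>P\<^esub> (inv\<^bsub>P\<^esub> dr g \<otimes>\<^bsub>P\<^esub> g)" using g by (simp add: P.inv_cancel_left)
  also have "\<dots> = dr g \<otimes>\<^bsub>P\<^esub> (R (sg g) \<otimes>\<^bsub>P\<^esub> \<iota>2 (snd (st g)))"
    unfolding u(2) sg_def st word_act_rep[OF u(1)] ..
  finally show "g = dr g \<otimes>\<^bsub>P\<^esub> (R (sg g) \<otimes>\<^bsub>P\<^esub> \<iota>2 (snd (st g)))" .
qed

lemma st_closed:
  assumes "g \<in> carrier P"
  shows "syl_ok E (sg g)" "snd (st g) \<in> carrier A2"
  using st_nf(1)[OF assms] by (auto simp: \<Omega>_def sg_def)

lemma st_letter:
  assumes g: "g \<in> carrier P" and x: "x \<in> L"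
  shows "dr (g \<otimes>\<^bsub>P\<^esub> (if b then pgen x else inv\<^bsub>P\<^esub> pgen x)) = dr g"
    and "st (g \<otimes>\<^bsub>P\<^esub> (if b then pgen x else inv\<^bsub>P\<^esub> pgen x)) = lact x b (st g)"
proof -
  let ?y = "if b then pgen x else inv\<^bsub>P\<^esub> pgen x"
  have xT: "x \<in> T" using x LT by blast
  then have yc: "?y \<in> carrier P" by simp
  have y: "?y = art T m [(x, b)]" using xT by (simp add: pgen_def P_def art_letter)
  have "?y \<in> art T m ` words L" unfolding y using x by (intro imageI) simp
  then show dr: "dr (g \<otimes>\<^bsub>P\<^esub> ?y) = dr g" unfolding dr_def by (rule P.lrep_mult[OF subgroup_L g])
  let ?l = "inv\<^bsub>P\<^esub> dr g \<otimes>\<^bsub>P\<^esub> g"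
  have lc: "?l \<in> carrier P" using g by simp
  have hom: "artin_retract L m \<in> hom P (artin_group L m)"
    unfolding P_def by (rule even_artin.artin_retract_hom[OF retract_T LT(1)])
  have "inv\<^bsub>P\<^esub> dr g \<otimes>\<^bsub>P\<^esub> (g \<otimes>\<^bsub>P\<^esub> ?y) = ?l \<otimes>\<^bsub>P\<^esub> ?y" using g yc by (simp add: P.m_assoc del: if_split)
  then have "artin_retract L m (inv\<^bsub>P\<^esub> dr g \<otimes>\<^bsub>P\<^esub> (g \<otimes>\<^bsub>P\<^esub> ?y)) =
      artin_retract L m ?l \<otimes>\<^bsub>artin_group L m\<^esub> artin_retract L m ?y"
    using hom_mult[OF hom lc yc] by (simp only:)
  moreover have "artin_retract L m ?y = art L m [(x, b)]"
    unfolding y using even_artin.artin_retract_art[OF retract_T LT(1), of "[(x, b)]"] x xT by simp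
  moreover have "artin_retract L m ?l \<in> carrier (artin_group L m)" using hom lc by (rule hom_closedI)
  ultimately show "st (g \<otimes>\<^bsub>P\<^esub> ?y) = lact x b (st g)"
    unfolding st_def dr using lact.class_act_mult[of "artin_retract L m ?l" "art L m [(x, b)]" "([], \<one>\<^bsub>A2\<^esub>)"]
      lact.class_act_pcl[of "[(x, b)]"] lact.class_act_closed base_\<Omega> x art_closed[of "[(x, b)]" L m]
    by (simp add: artin_group_def)
qed

text \<open>The group on \<open>L2\<close> moves only the last coordinate, and it fixes
  \<open>conj\<close> because a label 2 means commuting with \<open>z\<close>. So
  \<open>conj\<close> is a function on the vertices of the forest.\<close>

lemma st_L2:
  assumes g: "g \<in> carrier P" and h: "h \<in> carrier A2"
  shows "dr (g \<otimes>\<^bsub>P\<^esub> \<iota>2 h) = dr g" "st (g \<otimes>\<^bsub>P\<^esub> \<iota>2 h) = (sg g, snd (st g) \<otimes>\<^bsub>A2\<^esub> h)"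
    "conj (g \<otimes>\<^bsub>P\<^esub> \<iota>2 h) = conj g"
proof -
  have "dr (g \<otimes>\<^bsub>P\<^esub> \<iota>2 (art L2 m u)) = dr g \<and>
      st (g \<otimes>\<^bsub>P\<^esub> \<iota>2 (art L2 m u)) = (sg g, snd (st g) \<otimes>\<^bsub>A2\<^esub> art L2 m u) \<and>
      conj (g \<otimes>\<^bsub>P\<^esub> \<iota>2 (art L2 m u)) = conj g" if "u \<in> words L2" for u
    using that
  proof (induction u rule: rev_induct)
    case Nil
    then show ?case using g st_closed[OF g] unfolding art_Nil A2_def[symmetric] by (simp add: sg_def)
  next
    case (snoc l u)
    obtain x b where l: "l = (x, b)" by fastforce
    have x: "x \<in> L2" "x \<in> L" "x \<in> T" "u \<in> words L2" using snoc.prems l LT by auto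
    let ?y = "if b then gen2 x else inv\<^bsub>A2\<^esub> gen2 x"
    let ?w = "if b then pgen x else inv\<^bsub>P\<^esub> pgen x"
    have "art L2 m (u @ [l]) = art L2 m u \<otimes>\<^bsub>A2\<^esub> ?y"
      unfolding A2_def gen2_def l using x
      by (simp only: art_append art_letter Cons_in_lists_iff mem_Sigma_iff UNIV_I lists.Nil simp_thms)
    moreover have v: "art L2 m u \<in> carrier A2" using x unfolding A2_def by (intro art_closed)
    moreover have yc: "?y \<in> carrier A2" using x by simp
    moreover have "\<iota>2 ?y = ?w" using x by (simp add: \<iota>2_gen2)
    ultimately have e: "art L2 m (u @ [l]) = art L2 m u \<otimes>\<^bsub>A2\<^esub> ?y"
      "g \<otimes>\<^bsub>P\<^esub> \<iota>2 (art L2 m (u @ [l])) = g \<otimes>\<^bsub>P\<^esub> \<iota>2 (art L2 m u) \<otimes>\<^bsub>P\<^esub> ?w"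
      using g x(3) by (simp_all add: P.m_assoc del: if_split)
    let ?g = "g \<otimes>\<^bsub>P\<^esub> \<iota>2 (art L2 m u)"
    have gc: "?g \<in> carrier P" using g v by simp
    have step: "conj (q \<otimes>\<^bsub>P\<^esub> pgen x) = conj q" if q: "q \<in> carrier P" for q
    proof -
      have "m z x = enat (2 * 1)" using x(1) by (simp add: L2_def numeral_eq_enat)
      then have "gprod G (\<lambda>j. conj (q \<otimes>\<^bsub>P\<^esub> pgen x [^]\<^bsub>P\<^esub> j)) 1 =
          gprod G (\<lambda>j. conj (q \<otimes>\<^bsub>P\<^esub> pgen x [^]\<^bsub>P\<^esub> Suc j)) 1"
        using compatible_conj x(3) q unfolding compatible_def by blast
      then show ?thesis using q x(3) by simp
    qed
    have "conj (?g \<otimes>\<^bsub>P\<^esub> ?w) = conj ?g"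
      using step[OF gc] step[of "?g \<otimes>\<^bsub>P\<^esub> inv\<^bsub>P\<^esub> pgen x"] gc x(3)
      by (cases b) (simp_all add: P.m_assoc)
    then show ?case
      using snoc.IH[OF x(4)] st_letter[OF gc x(2), of b] st_closed(2)[OF g] v yc x
      unfolding e(2) unfolding e(1) by (simp add: lact_def A2.m_assoc del: if_split)
  qed
  moreover obtain u where "u \<in> words L2" "h = art L2 m u"
    using h art_cases[of h L2 m] by (auto simp: A2_def)
  ultimately show "dr (g \<otimes>\<^bsub>P\<^esub> \<iota>2 h) = dr g" "st (g \<otimes>\<^bsub>P\<^esub> \<iota>2 h) = (sg g, snd (st g) \<otimes>\<^bsub>A2\<^esub> h)"
    "conj (g \<otimes>\<^bsub>P\<^esub> \<iota>2 h) = conj g" by blast+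
qed

text \<open>Multiplying by powers of \<open>t\<close> keeps the \<open>A2\<close> coordinate, so the
  direction of the line stays the same on the way.\<close>

lemma st_pow:
  assumes g: "g \<in> carrier P" and t: "t \<in> L4"
    and \<tau>: "sg g = syl_pt (t, cr t (snd (st g))) \<tau> n" "syl_ok E \<tau>"
      "fst (syl_split (t, cr t (snd (st g))) \<tau>) = 0"
  shows "dr (g \<otimes>\<^bsub>P\<^esub> pgen t [^]\<^bsub>P\<^esub> i) = dr g \<and>
    st (g \<otimes>\<^bsub>P\<^esub> pgen t [^]\<^bsub>P\<^esub> i) = (syl_pt (t, cr t (snd (st g))) \<tau> (n + i), snd (st g))"
proof -
  let ?g = "\<lambda>i::int. g \<otimes>\<^bsub>P\<^esub> pgen t [^]\<^bsub>P\<^esub> i"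
  have tc: "pgen t \<in> carrier P" "t \<in> L" "t \<notin> L2" using t disjoint LT by auto
  have gc: "?g i \<in> carrier P" for i using g tc by simp
  have step: "?g (i + (if b then 1 else - 1)) = ?g i \<otimes>\<^bsub>P\<^esub> (if b then pgen t else inv\<^bsub>P\<^esub> pgen t)" for i b
    using g tc P.int_pow_mult[OF tc(1), of i "- 1"] P.int_pow_mult[OF tc(1), of i 1]
    by (simp add: P.m_assoc P.int_pow_neg)
  have ind: "dr (?g (i + (if b then 1 else - 1))) = dr g \<and>
      st (?g (i + (if b then 1 else - 1))) =
      (syl_pt (t, cr t (snd (st g))) \<tau> (n + (i + (if b then 1 else - 1))), snd (st g))"
    if "dr (?g i) = dr g \<and> st (?g i) = (syl_pt (t, cr t (snd (st g))) \<tau> (n + i), snd (st g))" for i b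
    using that st_letter[OF gc tc(2), of i b] tc(3) \<tau>(2,3)
    unfolding step by (simp add: lact_def syl_shift_pt add.assoc del: if_split)
  show ?thesis
  proof (induction i rule: int_induct[of _ 0])
    case base
    then show ?case using g \<tau>(1) by (simp add: sg_def prod_eq_iff)
  next
    case (step1 i)
    then show ?case using ind[of i True] by simp
  next
    case (step2 i)
    then show ?case using ind[of i False] by simp
  qed
qed

text \<open>
  Extends values \<open>f\<close> on the basic syllable lists along the lines of the forest; \<open>f\<close> is only
  evaluated at basic lists.
\<close>

fun Zf :: "('h, 'r) monoid_scheme \<Rightarrow> ((('a \<times> 'a word set) \<times> int) list \<Rightarrow> 'h) \<Rightarrow>
    (('a \<times> 'a word set) \<times> int) list \<Rightarrow> 'h" where
  "Zf H f [] = f []"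
| "Zf H f ((e, i) # \<tau>) =
    rext H (half (fst e)) (\<lambda>j. if j = 0 then Zf H f \<tau> else f ((e, int j) # \<tau>)) i"

lemma half_E: "e \<in> E \<Longrightarrow> half (fst e) \<ge> 2"
  by (auto simp: E_def L4D)

lemma Zf_closed:
  assumes "group H" "\<And>\<sigma>. f \<sigma> \<in> carrier H" "syl_ok E \<sigma>"
  shows "Zf H f \<sigma> \<in> carrier H"
  using assms(3)
proof (induction \<sigma> rule: list.induct)
  case (Cons s \<tau>)
  obtain e i where s: "s = (e, i)" by fastforce
  then have e: "half (fst e) \<ge> 2" "syl_ok E \<tau>" using Cons.prems half_E by auto
  then show ?case using Cons.IH assms(2) unfolding s Zf.simps
    by (intro group.rext_closed[OF assms(1)]) auto
qed (use assms in simp)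

text \<open>At i = 0 the syllable disappears; there the extension returns its value at 0, which was
  set to that of the base vertex.\<close>

lemma Zf_pt:
  assumes "group H" "\<And>\<sigma>. f \<sigma> \<in> carrier H" "e \<in> E" "syl_ok E \<tau>"
  shows "Zf H f (syl_pt e \<tau> i) =
    rext H (half (fst e)) (\<lambda>j. if j = 0 then Zf H f \<tau> else f ((e, int j) # \<tau>)) i"
proof (cases "i = 0")
  case True
  have "Zf H f \<tau> \<in> carrier H" using Zf_closed assms by blast
  then show ?thesis
    using group.rext_small[OF assms(1), of 0 "half (fst e)"
        "\<lambda>j. if j = 0 then Zf H f \<tau> else f ((e, int j) # \<tau>)"] half_E[OF assms(3)] assms(2) True
    by simp
qed (simp add: syl_pt_def)

text \<open>Any values at the basic lists extend to a compatible family; this freedom is the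
  independence of the generators of \<open>K\<close>.\<close>

lemma compatible_Zf:
  assumes H: "group H" and f: "\<And>d \<sigma>. f d \<sigma> \<in> carrier H"
  shows "compatible H (\<lambda>g. Zf H (f (dr g)) (sg g))"
  unfolding compatible_def
proof (intro conjI ballI allI impI)
  fix g assume g: "g \<in> carrier P"
  then show "Zf H (f (dr g)) (sg g) \<in> carrier H" using Zf_closed[OF H] f st_closed by blast
  fix t k assume t: "t \<in> T" and k: "m z t = enat (2 * k)"
  have tS: "t \<in> S" "z \<noteq> t" using t TD by auto
  have k1: "k \<ge> 1" using k by (cases rule: label_cases[OF z tS]) auto
  let ?\<zeta> = "\<lambda>g. Zf H (f (dr g)) (sg g)"
  show "gprod H (\<lambda>j. ?\<zeta> (g \<otimes>\<^bsub>P\<^esub> pgen t [^]\<^bsub>P\<^esub> j)) k =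
      gprod H (\<lambda>j. ?\<zeta> (g \<otimes>\<^bsub>P\<^esub> pgen t [^]\<^bsub>P\<^esub> Suc j)) k"
  proof (cases "k = 1")
    case True
    then have "t \<in> L2" using t k by (simp add: L2_def numeral_eq_enat)
    then have "?\<zeta> (g \<otimes>\<^bsub>P\<^esub> pgen t) = ?\<zeta> g"
      using st_L2(1,2)[OF g, of "gen2 t"] by (simp add: \<iota>2_gen2 sg_def)
    then show ?thesis using True g t by simp
  next
    case False
    then have t4: "t \<in> L4" "half t = k" using t k k1 half_eq by (auto simp: L4_def)
    define e where "e = (t, cr t (snd (st g)))"
    have e: "e \<in> E" using t4 st_closed[OF g] by (simp add: e_def E_def)
    obtain \<tau> n where \<tau>: "sg g = syl_pt e \<tau> n" "syl_ok E \<tau>" "fst (syl_split e \<tau>) = 0"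
      using st_closed(1)[OF g] by (rule syl_pt_cases)
    define Y where "Y = rext H k (\<lambda>j. if j = 0 then Zf H (f (dr g)) \<tau> else f (dr g) ((e, int j) # \<tau>))"
    have Y: "?\<zeta> (g \<otimes>\<^bsub>P\<^esub> pgen t [^]\<^bsub>P\<^esub> i) = Y (n + i)" for i :: int
      using st_pow[OF g t4(1) \<tau>[unfolded e_def], of i] Zf_pt[OF H f e \<tau>(2)] t4
      by (simp add: sg_def e_def[symmetric] Y_def) (simp add: e_def)
    have "rseq H k Y" unfolding Y_def
      using Zf_closed[OF H f \<tau>(2)] f k1 by (intro group.rseq_rext[OF H]) auto
    then have "gprod H (\<lambda>j. Y (n + int j)) k = gprod H (\<lambda>j. Y (n + 1 + int j)) k"
      by (simp add: rseq_def)
    moreover have "?\<zeta> (g \<otimes>\<^bsub>P\<^esub> pgen t [^]\<^bsub>P\<^esub> j) = Y (n + int j)" for j :: nat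
      using Y[of "int j"] by (simp add: int_pow_int)
    moreover have "n + int (Suc j) = n + 1 + int j" for j by simp
    ultimately show ?thesis by (simp only:)
  qed
qed

text \<open>The roots, and positions 1 to k - 1 of each line: position 0 is the base vertex, whose
  value is already fixed, and these \<open>k\<close> consecutive values determine the rest.\<close>

definition "basic \<sigma> \<longleftrightarrow>
  (case \<sigma> of [] \<Rightarrow> True | (e, i) # \<tau> \<Rightarrow> 0 < i \<and> i < int (half (fst e)))"

definition "X = conj ` {g \<in> carrier P. basic (sg g)}"

lemma conj_nf:
  assumes "g \<in> carrier P"
  shows "conj (dr g \<otimes>\<^bsub>P\<^esub> R (sg g)) = conj g"
proof -
  have c: "dr g \<otimes>\<^bsub>P\<^esub> R (sg g) \<in> carrier P" using assms st_closed by simp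
  have "g = dr g \<otimes>\<^bsub>P\<^esub> R (sg g) \<otimes>\<^bsub>P\<^esub> \<iota>2 (snd (st g))"
    using st_nf(2)[OF assms] assms st_closed[OF assms] by (simp add: P.m_assoc)
  then show ?thesis using st_L2(3)[OF c st_closed(2)[OF assms]] by simp
qed

text \<open>Lets the induction along the forest pass from \<open>g\<close> to group elements at the
  other vertices of a line, with the same root.\<close>

lemma nf_line:
  assumes g: "g \<in> carrier P" and sg: "sg g = (e, i) # \<tau>"
  obtains g' where "g' \<in> carrier P" "dr g' = dr g" "sg g' = syl_pt e \<tau> j"
proof -
  obtain t c where e: "e = (t, c)" by fastforce
  have ok: "e \<in> E" "i \<noteq> 0" "fst (syl_split e \<tau>) = 0" "syl_ok E \<tau>"
    using st_closed(1)[OF g] by (simp_all add: sg)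
  then have t: "t \<in> L4" "c \<in> carrier A2" "cr t c = c" by (auto simp: e E_def)
  \<comment> \<open>Moves the \<open>A2\<close> coordinate to \<open>c\<close>, so that powers of
    \<open>t\<close> then act on the syllable (t, c).\<close>
  let ?h = "inv\<^bsub>A2\<^esub> snd (st g) \<otimes>\<^bsub>A2\<^esub> c"
  let ?g = "g \<otimes>\<^bsub>P\<^esub> \<iota>2 ?h"
  have h: "?h \<in> carrier A2" using t st_closed[OF g] by simp
  have gc: "?g \<in> carrier P" using g h by simp
  have st: "dr ?g = dr g" "st ?g = (sg g, c)"
    using st_L2(1,2)[OF g h] t st_closed[OF g] by (simp_all add: A2.inv_cancel_left)
  have "sg ?g = syl_pt (t, cr t (snd (st ?g))) \<tau> i"
    using st sg ok t by (simp add: sg_def[of ?g] e syl_pt_def)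
  from st_pow[OF gc t(1) this, of "j - i"] have
    "dr (?g \<otimes>\<^bsub>P\<^esub> pgen t [^]\<^bsub>P\<^esub> (j - i)) = dr g"
    "sg (?g \<otimes>\<^bsub>P\<^esub> pgen t [^]\<^bsub>P\<^esub> (j - i)) = syl_pt e \<tau> j"
    using ok t by (simp_all add: st e sg_def)
  then show thesis using that[of "?g \<otimes>\<^bsub>P\<^esub> pgen t [^]\<^bsub>P\<^esub> (j - i)"] gc t by simp
qed

text \<open>Up to a right factor from \<open>A2\<close>, which \<open>conj\<close> ignores, the
  points of the line are a t^i, and along these the relations between \<open>z\<close> and
  \<open>t\<close> are the window identities.\<close>

lemma rseq_conj:
  assumes d: "d \<in> carrier P" and e: "e \<in> E" and \<tau>: "syl_ok E \<tau>"
  shows "rseq G (half (fst e)) (\<lambda>i. conj (d \<otimes>\<^bsub>P\<^esub> R (syl_pt e \<tau> i)))"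
proof -
  obtain t c where tc: "e = (t, c)" by fastforce
  have t: "t \<in> L4" "c \<in> carrier A2" "t \<in> T" using e LT by (auto simp: tc E_def)
  define a where "a = d \<otimes>\<^bsub>P\<^esub> R \<tau> \<otimes>\<^bsub>P\<^esub> \<iota>2 c"
  have ac: "a \<in> carrier P" using d \<tau> t by (simp add: a_def)
  have pc: "a \<otimes>\<^bsub>P\<^esub> pgen t [^]\<^bsub>P\<^esub> i \<in> carrier P" for i :: int using ac t by simp
  have Y: "conj (d \<otimes>\<^bsub>P\<^esub> R (syl_pt e \<tau> i)) = conj (a \<otimes>\<^bsub>P\<^esub> pgen t [^]\<^bsub>P\<^esub> i)" for i
  proof -
    have "d \<otimes>\<^bsub>P\<^esub> R (syl_pt e \<tau> i) = a \<otimes>\<^bsub>P\<^esub> pgen t [^]\<^bsub>P\<^esub> i \<otimes>\<^bsub>P\<^esub> \<iota>2 (inv\<^bsub>A2\<^esub> c)"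
      using R_pt[OF e[unfolded tc] \<tau>] d \<tau> t by (simp add: tc a_def P.m_assoc)
    then show ?thesis using st_L2(3)[OF pc, of "inv\<^bsub>A2\<^esub> c"] t by simp
  qed
  have "gprod G (\<lambda>j. conj (a \<otimes>\<^bsub>P\<^esub> pgen t [^]\<^bsub>P\<^esub> (i + int j))) (half t) =
      gprod G (\<lambda>j. conj (a \<otimes>\<^bsub>P\<^esub> pgen t [^]\<^bsub>P\<^esub> (i + 1 + int j))) (half t)" for i
  proof -
    have "gprod G (\<lambda>j. conj (a \<otimes>\<^bsub>P\<^esub> pgen t [^]\<^bsub>P\<^esub> i \<otimes>\<^bsub>P\<^esub> pgen t [^]\<^bsub>P\<^esub> j)) (half t) =
        gprod G (\<lambda>j. conj (a \<otimes>\<^bsub>P\<^esub> pgen t [^]\<^bsub>P\<^esub> i \<otimes>\<^bsub>P\<^esub> pgen t [^]\<^bsub>P\<^esub> Suc j)) (half t)"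
      using compatible_conj t(3) L4D(1)[OF t(1)] pc unfolding compatible_def by blast
    moreover have "a \<otimes>\<^bsub>P\<^esub> pgen t [^]\<^bsub>P\<^esub> i \<otimes>\<^bsub>P\<^esub> pgen t [^]\<^bsub>P\<^esub> j = a \<otimes>\<^bsub>P\<^esub> pgen t [^]\<^bsub>P\<^esub> (i + int j)" for j :: nat
      using ac t by (simp add: P.m_assoc P.int_pow_mult int_pow_int)
    moreover have "i + int (Suc j) = i + 1 + int j" for j by simp
    ultimately show ?thesis by (simp only:)
  qed
  then show ?thesis
    unfolding rseq_def Y using pc by (auto simp: tc)
qed

theorem kernel_free: "is_free_group (G\<lparr>carrier := kernel G P \<pi>\<rparr>)"
proof -
  let ?K = "G\<lparr>carrier := kernel G P \<pi>\<rparr>"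
  define F where "F = presented_group X {}"
  define pg where "pg = pres_gen X {}"
  interpret F: group F unfolding F_def by (rule group_presented_group)
  interpret K: group ?K by (rule group_kernel)
  have XK: "X \<subseteq> carrier ?K" using conj_kernel by (auto simp: X_def)
  have pg: "x \<in> X \<Longrightarrow> pg x \<in> carrier F" for x unfolding pg_def F_def by (rule pres_gen_closed)
  \<comment> \<open>Values are named by the element \<open>conj\<close> itself, so two descriptions
    of one generator get the same value; the default 1 keeps \<open>f\<close> in \<open>F\<close>
    everywhere.\<close>
  define f where "f d \<sigma> = (let x = conj (d \<otimes>\<^bsub>P\<^esub> R \<sigma>) in if x \<in> X then pg x else \<one>\<^bsub>F\<^esub>)" for d \<sigma>
  have f: "f d \<sigma> \<in> carrier F" for d \<sigma> using pg by (simp add: f_def Let_def)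
  have f_basic: "f (dr g) (sg g) = pg (conj g)" "conj g \<in> X"
    if "g \<in> carrier P" "basic (sg g)" for g
    using that by (auto simp: f_def conj_nf X_def)
  let ?\<zeta> = "\<lambda>g. Zf F (f (dr g)) (sg g)"
  have comp: "compatible F ?\<zeta>" by (rule compatible_Zf[OF F.is_group f])
  obtain \<psi> where \<psi>: "\<psi> \<in> hom ?K F" "\<And>g. g \<in> carrier P \<Longrightarrow> \<psi> (conj g) = ?\<zeta> g"
    by (rule compatible_hom[OF F.is_group comp]) (rule that)
  obtain \<theta> where \<theta>: "\<theta> \<in> hom F ?K" "\<And>x. x \<in> X \<Longrightarrow> \<theta> (pg x) = x"
    unfolding F_def pg_def by (rule free_group_hom[OF group_kernel, of "\<lambda>x. x" X]) (use XK in auto)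
  have "\<theta> \<in> hom F G" using \<theta>(1) by (auto simp: hom_def kernel_def)
  then have \<theta>G: "group_hom F G \<theta>" by (simp add: group_hom_def group_hom_axioms_def F.is_group G.is_group)
  have \<theta>_Zf: "\<theta> (Zf F (f (dr g)) \<sigma>) = conj (dr g \<otimes>\<^bsub>P\<^esub> R \<sigma>)" if "g \<in> carrier P" "sg g = \<sigma>" for g \<sigma>
    using that
  proof (induction \<sigma> arbitrary: g rule: list.induct)
    case Nil
    then have "basic (sg g)" by (simp add: basic_def)
    from f_basic[OF Nil(1) this] show ?case using Nil conj_nf[OF Nil(1)] \<theta>(2) by simp
  next
    case (Cons s \<tau>)
    obtain e i where s: "s = (e, i)" by fastforce
    note g = Cons.prems(1) Cons.prems(2)[unfolded s]
    let ?d = "dr g" and ?k = "half (fst e)"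
    let ?y = "\<lambda>j. if j = 0 then Zf F (f ?d) \<tau> else f ?d ((e, int j) # \<tau>)"
    let ?Y = "\<lambda>i. conj (?d \<otimes>\<^bsub>P\<^esub> R (syl_pt e \<tau> i))"
    have ok: "e \<in> E" "i \<noteq> 0" "syl_ok E \<tau>" using st_closed(1)[OF g(1)] by (simp_all add: g(2))
    have k: "?k > 0" using half_E[OF ok(1)] by simp
    have y: "\<theta> (?y j) = ?Y (int j)" if j: "j < ?k" for j
    proof (cases "j = 0")
      case True
      obtain g' where g': "g' \<in> carrier P" "dr g' = ?d" "sg g' = syl_pt e \<tau> 0"
        by (rule nf_line[OF g])
      then show ?thesis using Cons.IH[of g'] True by simp
    next
      case False
      obtain g' where g': "g' \<in> carrier P" "dr g' = ?d" "sg g' = syl_pt e \<tau> (int j)"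
        by (rule nf_line[OF g])
      have pt: "syl_pt e \<tau> (int j) = (e, int j) # \<tau>" using False by (simp add: syl_pt_def)
      have "basic (sg g')" using False j by (simp add: g' pt basic_def)
      from f_basic[OF g'(1) this] conj_nf[OF g'(1)]
      show ?thesis using False \<theta>(2) by (simp add: g' pt)
    qed
    have "\<theta> (Zf F (f ?d) (s # \<tau>)) = rext G ?k (\<lambda>j. \<theta> (?y j)) i"
      unfolding s Zf.simps using k f Zf_closed[OF F.is_group f ok(3)]
      by (intro F.hom_rext[OF \<theta>G]) auto
    also have "\<dots> = rext G ?k (\<lambda>j. ?Y (int j)) i"
      using k y by (rule rext_cong)
    \<comment> \<open>In \<open>G\<close> the conjugates along the line form a window sequence too,
      so the same formula recovers them from the first \<open>?k\<close> of them.\<close>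
    also have "\<dots> = ?Y i"
      using G.rseq_eq_rext[OF rseq_conj[OF dr_closed[OF g(1)] ok(1,3)] k, of i] by simp
    finally show ?case using ok(2) by (simp add: s syl_pt_def)
  qed
  have "presented_group X {} \<cong> ?K"
    unfolding F_def[symmetric]
  proof (rule isoI_inverse[OF \<theta>(1) \<psi>(1)])
    fix A assume A: "A \<in> carrier F"
    have "\<psi> (\<theta> (pg x)) = pg x" if x: "x \<in> X" for x
    proof -
      obtain g where g: "g \<in> carrier P" "basic (sg g)" "x = conj g" using x by (auto simp: X_def)
      \<comment> \<open>A basic position lies in the initial window, where the extension returns the
        prescribed value.\<close>
      have "?\<zeta> g = f (dr g) (sg g)"
      proof (cases "sg g")
        case (Cons s \<tau>)
        obtain e i where s: "s = (e, i)" by fastforce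
        have i: "0 < i" "i < int (half (fst e))" using g(2) by (simp_all add: Cons s basic_def)
        have ok: "syl_ok E \<tau>" using st_closed(1)[OF g(1)] by (simp add: Cons s)
        have "Zf F (f (dr g)) (sg g) = (\<lambda>j. if j = 0 then Zf F (f (dr g)) \<tau> else f (dr g) ((e, int j) # \<tau>)) (nat i)"
          unfolding Cons s Zf.simps
          using F.rext_small[of "nat i" "half (fst e)" "\<lambda>j. if j = 0 then Zf F (f (dr g)) \<tau> else f (dr g) ((e, int j) # \<tau>)"]
            i f Zf_closed[OF F.is_group f ok] by simp
        then show ?thesis using i by (simp add: Cons s)
      qed simp
      then show ?thesis using \<theta>(2)[OF x] \<psi>(2)[OF g(1)] f_basic[OF g(1,2)] g(3) by simp
    qed
    then show "\<psi> (\<theta> A) = A"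
      using presented_group_hom_eqI[OF F.is_group[unfolded F_def] hom_comp[OF \<theta>(1) \<psi>(1), unfolded F_def] hom_id _ A[unfolded F_def]]
      unfolding pg_def F_def by blast
  next
    fix A assume A: "A \<in> carrier ?K"
    have "\<theta> (\<psi> (conj g)) = conj g" if "g \<in> carrier P" for g
      using \<theta>_Zf[OF that HOL.refl] conj_nf[OF that] \<psi>(2)[OF that] by simp
    then show "\<theta> (\<psi> A) = A"
      using kernel_hom_eqI[OF group_kernel hom_comp[OF \<psi>(1) \<theta>(1)] hom_id _, of A] A by simp
  qed
  then show ?thesis unfolding is_free_group_def using group_kernel XK by blast
qed

section \<open>Removing the vertices one at a time\<close>

lemma \<pi>_onto: "\<pi> ` carrier G = carrier P"
proof
  show "carrier P \<subseteq> \<pi> ` carrier G" using \<pi>_\<iota> \<iota>.hom_closed by (metis image_eqI subsetI)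
qed auto

lemma poly_free_step: "poly_free P \<Longrightarrow> poly_free G"
  using poly_free_extension[OF \<pi>.group_hom_axioms \<pi>_onto kernel_free] .

end

theorem theorem3p17:
  fixes S :: "'a set" and m :: "'a \<Rightarrow> 'a \<Rightarrow> enat"
  assumes "finite S"
    and "coxeter_matrix S m"
    and "even_type S m"
    and "FC_type S m"
  shows "poly_free (artin_group S m)"
  using assms
proof (induction S rule: finite_psubset_induct)
  case (psubset S)
  show ?case
  proof (cases "S = {}")
    case True
    have "carrier (artin_group {} m) = {\<one>\<^bsub>artin_group {} m\<^esub>}"
    proof
      show "carrier (artin_group {} m) \<subseteq> {\<one>\<^bsub>artin_group {} m\<^esub>}"
      proof
        fix A assume "A \<in> carrier (artin_group {} m)"
        then obtain u where "u \<in> words {}" "A = art {} m u" by (rule art_cases)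
        then show "A \<in> {\<one>\<^bsub>artin_group {} m\<^esub>}" using art_Nil[of "{}" m] by (simp add: lists_empty)
      qed
    qed (simp add: group.is_monoid group_artin monoid.one_closed)
    then show ?thesis
      unfolding True poly_free_def using group_artin group.triv_subgroup[OF group_artin]
      by (intro conjI exI[of _ 0] exI[of _ "\<lambda>_. {\<one>\<^bsub>artin_group {} m\<^esub>}"]) auto
  next
    case False
    then obtain z where z: "z \<in> S" by blast
    interpret artin_kill_FC S m z using psubset.prems z by unfold_locales
    have sub: "S - {z} \<subset> S" using z by blast
    have "even_artin (S - {z}) m" by (rule subset) blast
    then have "coxeter_matrix (S - {z}) m" "even_type (S - {z}) m"
      by (auto simp: even_artin_def)
    moreover have "FC_type (S - {z}) m"
      using psubset.prems(3) unfolding FC_type_def by (meson Diff_subset subset_trans)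
    ultimately have "poly_free P"
      unfolding P_def T_def by (rule psubset.IH[OF sub])
    then have "poly_free G" by (rule poly_free_step)
    then show ?thesis by (simp only: G_def)
  qed
qed

end
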